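(* Let $1\le d\le n-1$ and let $X_w$, $w\in W^P$, be a smooth toric Schubert variety in $\mathrm{Gr}(d,n)$. Then $X_w$ is isomorphic to the complex projective space $\mathbb{C}\mathrm{P}^{\ell(w)}$.
   Context: $G=\mathrm{SL}_n(\mathbb{C})$, $B$ is the Borel subgroup of upper triangular matrices, $T\subset B$ is the maximal torus of diagonal matrices, $P=P_d\supset B$ is the maximal parabolic subgroup with $G/P\cong \mathrm{Gr}(d,n)$. The Weyl group is $\mathfrak{S}_n$, $W^P=\{w\in\mathfrak{S}_n \mid w(1)<\cdots<w(d),\ w(d+1)<\cdots<w(n)\}$, and $\ell(w)$ is the length of $w$ with respect to the simple reflections $s_i=(i\ i+1)$. For $w\in W^P$, $X_w=\overline{BwP/P}\subset G/P$, of dimension $\ell(w)$; it is toric if it is a toric variety with respect to the left $T$-action (normal with a dense $T$-orbit; the action need not be effective). *)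

theory Defs
  imports
    "HOL-Analysis.Abstract_Limits"
    "HOL-Library.Extended_Nat"
    "HOL-Combinatorics.Permutations"
    "HOL-Algebra.Coset"
    "HOL-Algebra.Ring_Divisibility"
    "Jordan_Normal_Form.Determinant"
begin

section \<open>Complex varieties as spaces with functions\<close>

text \<open>
  A variety is a topological space together with its sheaf of complex-valued regular functions.
  A section over an open set \<open>U\<close> is represented by any total function that restricts to it, so
  the values outside \<open>U\<close> are irrelevant. The field \<open>sections\<close> is meaningful on open sets only.
\<close>

record 'a fspace =
  ftop :: "'a topology"
  sections :: "'a set \<Rightarrow> ('a \<Rightarrow> complex) set"

abbreviation points :: "('a, 'm) fspace_scheme \<Rightarrow> 'a set" where
  "points X \<equiv> topspace (ftop X)"

definition morphism :: "'a fspace \<Rightarrow> 'b fspace \<Rightarrow> ('a \<Rightarrow> 'b) \<Rightarrow> bool" where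
  "morphism X Y \<phi> \<longleftrightarrow>
     continuous_map (ftop X) (ftop Y) \<phi> \<and>
     (\<forall>V f. openin (ftop Y) V \<longrightarrow> f \<in> sections Y V \<longrightarrow>
        f \<circ> \<phi> \<in> sections X {x \<in> points X. \<phi> x \<in> V})"

definition isomorphic_fspaces :: "'a fspace \<Rightarrow> 'b fspace \<Rightarrow> bool" where
  "isomorphic_fspaces X Y \<longleftrightarrow>
     (\<exists>\<phi> \<psi>. morphism X Y \<phi> \<and> morphism Y X \<psi> \<and>
        (\<forall>x \<in> points X. \<psi> (\<phi> x) = x) \<and> (\<forall>y \<in> points Y. \<phi> (\<psi> y) = y))"

definition sub_fspace :: "'a fspace \<Rightarrow> 'a set \<Rightarrow> 'a fspace" where
  "sub_fspace X S =
     \<lparr> ftop = subtopology (ftop X) S,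
       sections = (\<lambda>U. {f. \<forall>x \<in> U. \<exists>V g. openin (ftop X) V \<and> x \<in> V \<and> g \<in> sections X V \<and>
                                       (\<forall>y \<in> U \<inter> V. f y = g y)}) \<rparr>"

definition quotient_fspace :: "'a fspace \<Rightarrow> ('a \<Rightarrow> 'b) \<Rightarrow> 'b fspace" where
  "quotient_fspace X \<pi> =
     \<lparr> ftop = topology (\<lambda>U. U \<subseteq> \<pi> ` points X \<and> openin (ftop X) {x \<in> points X. \<pi> x \<in> U}),
       sections = (\<lambda>U. {f. f \<circ> \<pi> \<in> sections X {x \<in> points X. \<pi> x \<in> U}}) \<rparr>"

text \<open>
  Polynomial functions: the algebra of functions generated by the constants and a set \<open>C\<close> of
  coordinate functions.
\<close>

inductive_set polyfuns :: "('a \<Rightarrow> complex) set \<Rightarrow> ('a \<Rightarrow> complex) set"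
  for C :: "('a \<Rightarrow> complex) set" where
  const: "(\<lambda>_. c) \<in> polyfuns C"
| coord: "f \<in> C \<Longrightarrow> f \<in> polyfuns C"
| add: "f \<in> polyfuns C \<Longrightarrow> g \<in> polyfuns C \<Longrightarrow> (\<lambda>x. f x + g x) \<in> polyfuns C"
| mult: "f \<in> polyfuns C \<Longrightarrow> g \<in> polyfuns C \<Longrightarrow> (\<lambda>x. f x * g x) \<in> polyfuns C"

definition zariski :: "('a \<Rightarrow> complex) set \<Rightarrow> 'a set \<Rightarrow> 'a topology" where
  "zariski C S = topology (\<lambda>U. \<exists>F \<subseteq> polyfuns C. U = {x \<in> S. \<exists>f \<in> F. f x \<noteq> 0})"

text \<open>
  For a locally closed subset \<open>S\<close> of an affine space with coordinate functions \<open>C\<close>: the regular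
  functions are those that are locally quotients of polynomials.
\<close>

definition quasi_affine :: "('a \<Rightarrow> complex) set \<Rightarrow> 'a set \<Rightarrow> 'a fspace" where
  "quasi_affine C S =
     \<lparr> ftop = zariski C S,
       sections = (\<lambda>U. {f. \<forall>x \<in> U. \<exists>V g h. openin (zariski C S) V \<and> x \<in> V \<and>
                            g \<in> polyfuns C \<and> h \<in> polyfuns C \<and>
                            (\<forall>y \<in> U \<inter> V. h y \<noteq> 0 \<and> f y = g y / h y)}) \<rparr>"

lemma openin_zariski:
  "openin (zariski C S) U \<longleftrightarrow> (\<exists>F \<subseteq> polyfuns C. U = {x \<in> S. \<exists>f \<in> F. f x \<noteq> 0})"
proof -
  let ?P = "\<lambda>U. \<exists>F \<subseteq> polyfuns C. U = {x \<in> S. \<exists>f \<in> F. f x \<noteq> 0}"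
  have "?P (U \<inter> V)" if U: "?P U" and V: "?P V" for U V
  proof -
    obtain F G where F: "F \<subseteq> polyfuns C" "U = {x \<in> S. \<exists>f \<in> F. f x \<noteq> 0}"
      and G: "G \<subseteq> polyfuns C" "V = {x \<in> S. \<exists>f \<in> G. f x \<noteq> 0}"
      using U V by blast
    let ?H = "{(\<lambda>x. f x * g x) | f g. f \<in> F \<and> g \<in> G}"
    have "?H \<subseteq> polyfuns C"
      using F(1) G(1) by (auto intro: polyfuns.mult)
    moreover have "U \<inter> V = {x \<in> S. \<exists>h \<in> ?H. h x \<noteq> 0}"
      unfolding F(2) G(2) by fastforce
    ultimately show ?thesis
      by blast
  qed
  moreover have "?P (\<Union>\<K>)" if "\<forall>K \<in> \<K>. ?P K" for \<K>
  proof -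
    have "\<forall>K \<in> \<K>. \<exists>F. F \<subseteq> polyfuns C \<and> K = {x \<in> S. \<exists>f \<in> F. f x \<noteq> 0}"
      using that by simp
    from bchoice[OF this] obtain F where F: "\<forall>K \<in> \<K>. F K \<subseteq> polyfuns C \<and> K = {x \<in> S. \<exists>f \<in> F K. f x \<noteq> 0}"
      by (elim exE)
    have "(\<Union>K \<in> \<K>. F K) \<subseteq> polyfuns C"
      using F by blast
    moreover have "\<Union>\<K> = (\<Union>K \<in> \<K>. {x \<in> S. \<exists>f \<in> F K. f x \<noteq> 0})"
      using F by simp
    then have "\<Union>\<K> = {x \<in> S. \<exists>f \<in> (\<Union>K \<in> \<K>. F K). f x \<noteq> 0}"
      by blast
    ultimately show ?thesis
      by blast
  qed
  ultimately have "istopology ?P"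
    unfolding istopology_def by blast
  then show ?thesis
    unfolding zariski_def by (simp add: topology_inverse')
qed

lemma topspace_zariski: "topspace (zariski C S) = S"
proof -
  have "openin (zariski C S) S"
    unfolding openin_zariski
    by (rule exI[of _ "{\<lambda>_. 1}"]) (auto intro: polyfuns.const)
  moreover have "U \<subseteq> S" if "openin (zariski C S) U" for U
    using that unfolding openin_zariski by auto
  ultimately show ?thesis
    by (intro subset_antisym) (simp_all add: openin_subset)
qed

lemma openin_quotient_fspace:
  "openin (ftop (quotient_fspace X \<pi>)) U \<longleftrightarrow>
     U \<subseteq> \<pi> ` points X \<and> openin (ftop X) {x \<in> points X. \<pi> x \<in> U}"
proof -
  let ?P = "\<lambda>U. U \<subseteq> \<pi> ` points X \<and> openin (ftop X) {x \<in> points X. \<pi> x \<in> U}"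
  have "?P (U \<inter> V)" if "?P U" "?P V" for U V
  proof -
    have "{x \<in> points X. \<pi> x \<in> U \<inter> V} = {x \<in> points X. \<pi> x \<in> U} \<inter> {x \<in> points X. \<pi> x \<in> V}"
      by blast
    with that show ?thesis
      by auto
  qed
  moreover have "?P (\<Union>\<K>)" if "\<forall>K \<in> \<K>. ?P K" for \<K>
  proof -
    have "{x \<in> points X. \<pi> x \<in> \<Union>\<K>} = (\<Union>K \<in> \<K>. {x \<in> points X. \<pi> x \<in> K})"
      by blast
    moreover have "openin (ftop X) (\<Union>K \<in> \<K>. {x \<in> points X. \<pi> x \<in> K})"
      using that by (intro openin_Union) blast
    ultimately show ?thesis
      using that by (simp add: Union_least)
  qed
  ultimately have "istopology ?P"
    unfolding istopology_def by blast
  then show ?thesis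
    unfolding quotient_fspace_def by (simp add: topology_inverse')
qed

lemma points_quotient_fspace: "points (quotient_fspace X \<pi>) = \<pi> ` points X"
proof -
  have "{x \<in> points X. \<pi> x \<in> \<pi> ` points X} = points X"
    by blast
  then have "openin (ftop (quotient_fspace X \<pi>)) (\<pi> ` points X)"
    unfolding openin_quotient_fspace by simp
  then show ?thesis
    using openin_quotient_fspace[of X \<pi> "points (quotient_fspace X \<pi>)"]
    by (intro subset_antisym) (simp_all add: openin_subset)
qed


section \<open>Local rings, normality and smoothness\<close>

text \<open>
  A germ at \<open>x\<close> is represented as the set of all functions that agree with a given one near \<open>x\<close>.
\<close>

definition germ :: "'a fspace \<Rightarrow> 'a \<Rightarrow> ('a \<Rightarrow> complex) \<Rightarrow> ('a \<Rightarrow> complex) set" where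
  "germ X x f = {g. eventually (\<lambda>y. g y = f y) (nhdsin (ftop X) x)}"

definition stalk :: "'a fspace \<Rightarrow> 'a \<Rightarrow> ('a \<Rightarrow> complex) set ring" where
  "stalk X x =
     \<lparr> carrier = {germ X x f | f U. openin (ftop X) U \<and> x \<in> U \<and> f \<in> sections X U},
       mult = (\<lambda>A B. \<Union>f \<in> A. \<Union>g \<in> B. germ X x (\<lambda>y. f y * g y)),
       one = germ X x (\<lambda>_. 1),
       zero = germ X x (\<lambda>_. 0),
       add = (\<lambda>A B. \<Union>f \<in> A. \<Union>g \<in> B. germ X x (\<lambda>y. f y + g y)) \<rparr>"

lemma germ_eq_iff:
  "germ X x f = germ X x g \<longleftrightarrow> eventually (\<lambda>y. f y = g y) (nhdsin (ftop X) x)"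
proof
  assume "germ X x f = germ X x g"
  moreover have "f \<in> germ X x f"
    by (simp add: germ_def)
  ultimately have "f \<in> germ X x g"
    by simp
  then show "eventually (\<lambda>y. f y = g y) (nhdsin (ftop X) x)"
    by (simp add: germ_def)
next
  assume e: "eventually (\<lambda>y. f y = g y) (nhdsin (ftop X) x)"
  have "eventually (\<lambda>y. h y = f y) (nhdsin (ftop X) x) \<longleftrightarrow>
        eventually (\<lambda>y. h y = g y) (nhdsin (ftop X) x)" for h
    using e by (intro eventually_subst) (simp add: eventually_mono)
  then show "germ X x f = germ X x g"
    by (simp add: germ_def)
qed

lemma stalk_mult_germ:
  "germ X x f \<otimes>\<^bsub>stalk X x\<^esub> germ X x g = germ X x (\<lambda>y. f y * g y)"
proof -
  have "germ X x (\<lambda>y. f' y * g' y) = germ X x (\<lambda>y. f y * g y)"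
    if "f' \<in> germ X x f" "g' \<in> germ X x g" for f' g'
  proof -
    have "eventually (\<lambda>y. f' y = f y) (nhdsin (ftop X) x)"
      "eventually (\<lambda>y. g' y = g y) (nhdsin (ftop X) x)"
      using that by (simp_all add: germ_def)
    then show ?thesis
      unfolding germ_eq_iff by eventually_elim simp
  qed
  then have "(\<Union>f' \<in> germ X x f. \<Union>g' \<in> germ X x g. germ X x (\<lambda>y. f' y * g' y)) =
      (\<Union>f' \<in> germ X x f. \<Union>g' \<in> germ X x g. germ X x (\<lambda>y. f y * g y))"
    by (intro SUP_cong refl)
  moreover have "f \<in> germ X x f" "g \<in> germ X x g"
    by (simp_all add: germ_def)
  then have "germ X x f \<noteq> {}" "germ X x g \<noteq> {}"
    by blast+
  ultimately show ?thesis
    by (simp add: stalk_def)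
qed

lemma stalk_add_germ:
  "germ X x f \<oplus>\<^bsub>stalk X x\<^esub> germ X x g = germ X x (\<lambda>y. f y + g y)"
proof -
  have "germ X x (\<lambda>y. f' y + g' y) = germ X x (\<lambda>y. f y + g y)"
    if "f' \<in> germ X x f" "g' \<in> germ X x g" for f' g'
  proof -
    have "eventually (\<lambda>y. f' y = f y) (nhdsin (ftop X) x)"
      "eventually (\<lambda>y. g' y = g y) (nhdsin (ftop X) x)"
      using that by (simp_all add: germ_def)
    then show ?thesis
      unfolding germ_eq_iff by eventually_elim simp
  qed
  then have "(\<Union>f' \<in> germ X x f. \<Union>g' \<in> germ X x g. germ X x (\<lambda>y. f' y + g' y)) =
      (\<Union>f' \<in> germ X x f. \<Union>g' \<in> germ X x g. germ X x (\<lambda>y. f y + g y))"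
    by (intro SUP_cong refl)
  moreover have "f \<in> germ X x f" "g \<in> germ X x g"
    by (simp_all add: germ_def)
  then have "germ X x f \<noteq> {}" "germ X x g \<noteq> {}"
    by blast+
  ultimately show ?thesis
    by (simp add: stalk_def)
qed

text \<open>
  A domain is integrally closed if every fraction \<open>a/b\<close> satisfying a monic equation lies in the
  domain; below the monic equation for \<open>a/b\<close> has been multiplied by \<open>b\<^sup>n\<close>.
\<close>

definition integrally_closed_domain :: "('a, 'm) ring_scheme \<Rightarrow> bool" where
  "integrally_closed_domain R \<longleftrightarrow>
     domain R \<and>
     (\<forall>a \<in> carrier R. \<forall>b \<in> carrier R - {\<zero>\<^bsub>R\<^esub>}. \<forall>n::nat. \<forall>c \<in> {..<n} \<rightarrow> carrier R.
        a [^]\<^bsub>R\<^esub> n \<oplus>\<^bsub>R\<^esub>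
          (\<Oplus>\<^bsub>R\<^esub>i \<in> {..<n}. c i \<otimes>\<^bsub>R\<^esub> (a [^]\<^bsub>R\<^esub> i \<otimes>\<^bsub>R\<^esub> b [^]\<^bsub>R\<^esub> (n - i))) = \<zero>\<^bsub>R\<^esub>
        \<longrightarrow> (\<exists>q \<in> carrier R. a = q \<otimes>\<^bsub>R\<^esub> b))"

definition krull_dim :: "('a, 'm) ring_scheme \<Rightarrow> enat" where
  "krull_dim R = (SUP k \<in> {k. \<exists>p. (\<forall>i \<le> k. primeideal (p i) R) \<and> (\<forall>i < k. p i \<subset> p (Suc i))}. enat k)"

definition min_generators :: "('a, 'm) ring_scheme \<Rightarrow> 'a set \<Rightarrow> enat" where
  "min_generators R I =
     (INF S \<in> {S. finite S \<and> S \<subseteq> carrier R \<and> genideal R S = I}. enat (card S))"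

text \<open>
  By Nakayama's lemma, \<open>min_generators R m\<close> is the dimension of the Zariski cotangent space
  \<open>m / m\<^sup>2\<close> for the maximal ideal \<open>m\<close> of a Noetherian local ring.
\<close>

definition regular_local_ring :: "('a, 'm) ring_scheme \<Rightarrow> bool" where
  "regular_local_ring R \<longleftrightarrow>
     cring R \<and> noetherian_ring R \<and> (\<exists>!m. maximalideal m R) \<and>
     (\<forall>m. maximalideal m R \<longrightarrow> min_generators R m = krull_dim R)"

definition normal_variety :: "'a fspace \<Rightarrow> bool" where
  "normal_variety X \<longleftrightarrow> (\<forall>x \<in> points X. integrally_closed_domain (stalk X x))"

definition smooth_variety :: "'a fspace \<Rightarrow> bool" where
  "smooth_variety X \<longleftrightarrow> (\<forall>x \<in> points X. regular_local_ring (stalk X x))"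

text \<open>
  Toric with respect to the action \<open>act\<close> of \<open>T\<close>; the action need not be effective.
  The set \<open>T\<close> is meant to be a torus acting algebraically on the variety \<open>X\<close>. Irreducibility of
  \<open>X\<close> is not demanded separately, since a closure of an orbit of a torus is irreducible.
\<close>

definition toric_variety :: "'t set \<Rightarrow> ('t \<Rightarrow> 'a \<Rightarrow> 'a) \<Rightarrow> 'a fspace \<Rightarrow> bool" where
  "toric_variety T act X \<longleftrightarrow>
     normal_variety X \<and>
     (\<exists>x \<in> points X. (\<lambda>t. act t x) ` T \<subseteq> points X \<and>
        ftop X closure_of ((\<lambda>t. act t x) ` T) = points X)"


section \<open>Projective space\<close>

text \<open>
  The projective space of dimension \<open>l\<close> is the quotient of the punctured affine space of dimension
  \<open>l + 1\<close> by scaling; a point is a punctured line.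
\<close>

definition punctured_line :: "complex vec \<Rightarrow> complex vec set" where
  "punctured_line v = {c \<cdot>\<^sub>v v | c. c \<noteq> 0}"

definition projective_space :: "nat \<Rightarrow> complex vec set fspace" where
  "projective_space l =
     quotient_fspace
       (quasi_affine {(\<lambda>v. v $ i) | i. i < l + 1} (carrier_vec (l + 1) - {0\<^sub>v (l + 1)}))
       punctured_line"


section \<open>The Grassmannian and its Schubert varieties\<close>

text \<open>
  Indices run over \<open>{0..<n}\<close> instead of \<open>{1..n}\<close> throughout.
\<close>

definition SL :: "nat \<Rightarrow> complex mat monoid" where
  "SL n = \<lparr> carrier = {A \<in> carrier_mat n n. det A = 1}, mult = (*), one = 1\<^sub>m n \<rparr>"

definition borel_subgroup :: "nat \<Rightarrow> complex mat set" where
  "borel_subgroup n = {A \<in> carrier (SL n). upper_triangular A}"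

definition diag_torus :: "nat \<Rightarrow> complex mat set" where
  "diag_torus n = {A \<in> carrier (SL n). diagonal_mat A}"

text \<open>
  The stabilizer of the span of the first \<open>d\<close> standard basis vectors.
\<close>

definition parabolic :: "nat \<Rightarrow> nat \<Rightarrow> complex mat set" where
  "parabolic n d = {A \<in> carrier (SL n). \<forall>i j. d \<le> i \<longrightarrow> i < n \<longrightarrow> j < d \<longrightarrow> A $$ (i, j) = 0}"

text \<open>
  The quotient variety \<open>G/P\<close>: its points are the cosets \<open>gP\<close>, and a set or a function is open or
  regular if and only if its pullback to \<open>G\<close> is.
\<close>

definition grassmannian :: "nat \<Rightarrow> nat \<Rightarrow> complex mat set fspace" where
  "grassmannian n d =
     quotient_fspace
       (quasi_affine {(\<lambda>A. A $$ (i, j)) | i j. i < n \<and> j < n} (carrier (SL n)))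
       (\<lambda>g. g <#\<^bsub>SL n\<^esub> parabolic n d)"

definition min_coset_reps :: "nat \<Rightarrow> nat \<Rightarrow> (nat \<Rightarrow> nat) set" where
  "min_coset_reps n d =
     {w. w permutes {..<n} \<and> strict_mono_on {..<d} w \<and> strict_mono_on {d..<n} w}"

definition perm_length :: "nat \<Rightarrow> (nat \<Rightarrow> nat) \<Rightarrow> nat" where
  "perm_length n w =
     (LEAST k. \<exists>js. length js = k \<and> (\<forall>j \<in> set js. j + 1 < n) \<and>
        w = foldr (\<lambda>j u. Transposition.transpose j (j + 1) \<circ> u) js id)"

text \<open>
  A representative of \<open>w\<close> in the normalizer of the torus; the sign makes its determinant \<open>1\<close>.
\<close>

definition perm_rep :: "nat \<Rightarrow> (nat \<Rightarrow> nat) \<Rightarrow> complex mat" where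
  "perm_rep n w =
     mat n n (\<lambda>(i, j). if i = w j then (if j = 0 then of_int (sign w) else 1) else 0)"

definition schubert_cell :: "nat \<Rightarrow> nat \<Rightarrow> (nat \<Rightarrow> nat) \<Rightarrow> complex mat set set" where
  "schubert_cell n d w = (\<lambda>b. (b * perm_rep n w) <#\<^bsub>SL n\<^esub> parabolic n d) ` borel_subgroup n"

definition schubert_variety :: "nat \<Rightarrow> nat \<Rightarrow> (nat \<Rightarrow> nat) \<Rightarrow> complex mat set fspace" where
  "schubert_variety n d w =
     sub_fspace (grassmannian n d) (ftop (grassmannian n d) closure_of schubert_cell n d w)"

end

theory Submission
  imports Defs
begin

text \<open>
  If the Young diagram of \<open>w\<close> contains a \<open>2 \<times> 2\<close> square, then \<open>X\<^sub>w\<close> carries two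
  products of Pluecker coordinates of the same torus weight that are linearly independent on the
  open cell; they are proportional on the closure of a torus orbit, so \<open>X\<^sub>w\<close> is not toric. Hence
  the diagram is a hook. If both arms of the hook are nontrivial, \<open>X\<^sub>w\<close> is singular at the base
  point: the local ring there has Krull dimension at most \<open>dim X\<^sub>w\<close>, because the cell is an affine
  space and any \<open>r + 1\<close> rational functions in \<open>r\<close> variables are algebraically dependent, whereas
  the torus-stable curves through the base point have too many independent tangent directions. So
  the diagram is a row or a column. For a row, \<open>X\<^sub>w\<close> consists of the \<open>V\<close> with
  \<open>F\<^sub>d\<^sub>-\<^sub>1 \<subseteq> V \<subseteq> F\<^sub>d\<^sub>+\<^sub>a\<close> for the standard flag \<open>F\<close>, which is the projective space of
  \<open>F\<^sub>d\<^sub>+\<^sub>a / F\<^sub>d\<^sub>-\<^sub>1\<close>. The column case follows by the duality of \<open>Gr(d, n)\<close> and \<open>Gr(n - d, n)\<close>.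
\<close>

section \<open>Sheaves of functions and morphisms\<close>

text \<open>In zero-based indexing the rows of the Young diagram have the lengths
  \<open>w k - k\<close> for \<open>k < d\<close>. So, for \<open>d \<ge> 2\<close>, a 2 x 2 square
  means \<open>d \<le> w (d - 2)\<close>, one row means that every \<open>k < d - 1\<close> is
  fixed, and what remains has \<open>w (d - 2) = d - 1\<close>: a column if
  \<open>w (d - 1) = d\<close>, otherwise a hook with two arms. Smoothness enters as one chain of
  inequalities at the base point: independent tangent directions \<le> generators of the maximal
  ideal = Krull dimension \<le> number of boxes. For a hook whose arms, corner included, have
  \<open>x\<close> and \<open>y\<close> boxes, it would give \<open>x * y \<le> x + y - 1\<close>,
  false as soon as both exceed 1. The upper end comes from counting monomials against the points of
  a grid; the lower end from explicit curves that lie in the closure as limits of curves in the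
  cell. The Grassmannian is given only as a quotient of the special linear group. Hence maps into it
  are produced by completing \<open>d\<close> regular columns locally, and closed conditions on it
  are vanishing conditions on matrices that are stable under the parabolic subgroup.\<close>

definition function_sheaf :: "'a fspace \<Rightarrow> bool" where
  "function_sheaf X \<longleftrightarrow>
     (\<forall>U f g. openin (ftop X) U \<longrightarrow> f \<in> sections X U \<longrightarrow> (\<forall>x\<in>U. g x = f x) \<longrightarrow> g \<in> sections X U) \<and>
     (\<forall>U V f. openin (ftop X) U \<longrightarrow> openin (ftop X) V \<longrightarrow> V \<subseteq> U \<longrightarrow> f \<in> sections X U \<longrightarrow> f \<in> sections X V) \<and>
     (\<forall>U f. openin (ftop X) U \<longrightarrow>
        (\<forall>x\<in>U. \<exists>V. openin (ftop X) V \<and> x \<in> V \<and> V \<subseteq> U \<and> f \<in> sections X V) \<longrightarrow> f \<in> sections X U) \<and>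
     (\<forall>U c. openin (ftop X) U \<longrightarrow> (\<lambda>_. c) \<in> sections X U) \<and>
     (\<forall>U f g. openin (ftop X) U \<longrightarrow> f \<in> sections X U \<longrightarrow> g \<in> sections X U \<longrightarrow>
        (\<lambda>x. f x + g x) \<in> sections X U) \<and>
     (\<forall>U f g. openin (ftop X) U \<longrightarrow> f \<in> sections X U \<longrightarrow> g \<in> sections X U \<longrightarrow>
        (\<lambda>x. f x * g x) \<in> sections X U) \<and>
     (\<forall>U f. openin (ftop X) U \<longrightarrow> f \<in> sections X U \<longrightarrow> openin (ftop X) {x\<in>U. f x \<noteq> 0}) \<and>
     (\<forall>U f. openin (ftop X) U \<longrightarrow> f \<in> sections X U \<longrightarrow> (\<forall>x\<in>U. f x \<noteq> 0) \<longrightarrow>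
        (\<lambda>x. 1 / f x) \<in> sections X U)"

text \<open>The first clause reflects that a section is a total function whose values off
  \<open>U\<close> are irrelevant; the last two make a section invertible near each point where it
  does not vanish.\<close>

lemma
  assumes X: "function_sheaf X" and U: "openin (ftop X) U"
  shows sheaf_cong: "\<And>f g. f \<in> sections X U \<Longrightarrow> (\<And>x. x \<in> U \<Longrightarrow> g x = f x) \<Longrightarrow> g \<in> sections X U"
    and sheaf_restrict: "\<And>V f. f \<in> sections X U \<Longrightarrow> openin (ftop X) V \<Longrightarrow> V \<subseteq> U \<Longrightarrow> f \<in> sections X V"
    and sheaf_glue: "\<And>f. (\<And>x. x \<in> U \<Longrightarrow> \<exists>V. openin (ftop X) V \<and> x \<in> V \<and> V \<subseteq> U \<and> f \<in> sections X V)
      \<Longrightarrow> f \<in> sections X U"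
    and sheaf_const: "\<And>c. (\<lambda>_. c) \<in> sections X U"
    and sheaf_add: "\<And>f g. f \<in> sections X U \<Longrightarrow> g \<in> sections X U \<Longrightarrow> (\<lambda>x. f x + g x) \<in> sections X U"
    and sheaf_mult: "\<And>f g. f \<in> sections X U \<Longrightarrow> g \<in> sections X U \<Longrightarrow> (\<lambda>x. f x * g x) \<in> sections X U"
    and sheaf_nonzero: "\<And>f. f \<in> sections X U \<Longrightarrow> openin (ftop X) {x\<in>U. f x \<noteq> 0}"
    and sheaf_inverse: "\<And>f. f \<in> sections X U \<Longrightarrow> (\<And>x. x \<in> U \<Longrightarrow> f x \<noteq> 0) \<Longrightarrow> (\<lambda>x. 1 / f x) \<in> sections X U"
proof -
  note X' = X[unfolded function_sheaf_def]
  show "\<And>f g. f \<in> sections X U \<Longrightarrow> (\<And>x. x \<in> U \<Longrightarrow> g x = f x) \<Longrightarrow> g \<in> sections X U"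
    by (rule X'[THEN conjunct1, rule_format, OF U])
  show "\<And>V f. f \<in> sections X U \<Longrightarrow> openin (ftop X) V \<Longrightarrow> V \<subseteq> U \<Longrightarrow> f \<in> sections X V"
    by (rule X'[THEN conjunct2, THEN conjunct1, rule_format, OF U])
  show "\<And>f. (\<And>x. x \<in> U \<Longrightarrow> \<exists>V. openin (ftop X) V \<and> x \<in> V \<and> V \<subseteq> U \<and> f \<in> sections X V)
      \<Longrightarrow> f \<in> sections X U"
    by (rule X'[THEN conjunct2, THEN conjunct2, THEN conjunct1, rule_format, OF U])
  show "\<And>c. (\<lambda>_. c) \<in> sections X U"
    by (rule X'[THEN conjunct2, THEN conjunct2, THEN conjunct2, THEN conjunct1, rule_format, OF U])
  note X'' = X'[THEN conjunct2, THEN conjunct2, THEN conjunct2, THEN conjunct2]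
  show "\<And>f g. f \<in> sections X U \<Longrightarrow> g \<in> sections X U \<Longrightarrow> (\<lambda>x. f x + g x) \<in> sections X U"
    by (rule X''[THEN conjunct1, rule_format, OF U])
  show "\<And>f g. f \<in> sections X U \<Longrightarrow> g \<in> sections X U \<Longrightarrow> (\<lambda>x. f x * g x) \<in> sections X U"
    by (rule X''[THEN conjunct2, THEN conjunct1, rule_format, OF U])
  show "\<And>f. f \<in> sections X U \<Longrightarrow> openin (ftop X) {x\<in>U. f x \<noteq> 0}"
    by (rule X''[THEN conjunct2, THEN conjunct2, THEN conjunct1, rule_format, OF U])
  show "\<And>f. f \<in> sections X U \<Longrightarrow> (\<And>x. x \<in> U \<Longrightarrow> f x \<noteq> 0) \<Longrightarrow> (\<lambda>x. 1 / f x) \<in> sections X U"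
    by (rule X''[THEN conjunct2, THEN conjunct2, THEN conjunct2, rule_format, OF U])
qed

text \<open>For structures whose sections are defined by a condition at each point, most clauses
  hold over arbitrary sets, so openness is assumed only where it matters.\<close>

lemma function_sheafI:
  assumes "\<And>U f g. f \<in> sections X U \<Longrightarrow> \<forall>x\<in>U. g x = f x \<Longrightarrow> g \<in> sections X U"
    and "\<And>U V f. f \<in> sections X U \<Longrightarrow> V \<subseteq> U \<Longrightarrow> f \<in> sections X V"
    and "\<And>U f. \<forall>x\<in>U. \<exists>V. openin (ftop X) V \<and> x \<in> V \<and> V \<subseteq> U \<and> f \<in> sections X V \<Longrightarrow> f \<in> sections X U"
    and "\<And>U c. openin (ftop X) U \<Longrightarrow> (\<lambda>_. c) \<in> sections X U"
    and "\<And>U f g. f \<in> sections X U \<Longrightarrow> g \<in> sections X U \<Longrightarrow>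
        (\<lambda>x. f x + g x) \<in> sections X U \<and> (\<lambda>x. f x * g x) \<in> sections X U"
    and "\<And>U f. openin (ftop X) U \<Longrightarrow> f \<in> sections X U \<Longrightarrow> openin (ftop X) {x\<in>U. f x \<noteq> 0}"
    and "\<And>U f. f \<in> sections X U \<Longrightarrow> \<forall>x\<in>U. f x \<noteq> 0 \<Longrightarrow> (\<lambda>x. 1 / f x) \<in> sections X U"
  shows "function_sheaf X"
  unfolding function_sheaf_def
proof (intro conjI allI impI)
  fix U f g assume "f \<in> sections X U" "\<forall>x\<in>U. g x = f x"
  then show "g \<in> sections X U" by (rule assms(1))
next
  fix U V f assume "V \<subseteq> U" "f \<in> sections X U"
  then show "f \<in> sections X V" using assms(2) by simp
next
  fix U f assume "\<forall>x\<in>U. \<exists>V. openin (ftop X) V \<and> x \<in> V \<and> V \<subseteq> U \<and> f \<in> sections X V"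
  then show "f \<in> sections X U" by (rule assms(3))
next
  fix U c assume "openin (ftop X) U"
  then show "(\<lambda>_. c) \<in> sections X U" by (rule assms(4))
next
  fix U f g assume "f \<in> sections X U" "g \<in> sections X U"
  then show "(\<lambda>x. f x + g x) \<in> sections X U" "(\<lambda>x. f x * g x) \<in> sections X U"
    using assms(5) by blast+
next
  fix U f assume "openin (ftop X) U" "f \<in> sections X U"
  then show "openin (ftop X) {x\<in>U. f x \<noteq> 0}" by (rule assms(6))
next
  fix U f assume "f \<in> sections X U" "\<forall>x\<in>U. f x \<noteq> 0"
  then show "(\<lambda>x. 1 / f x) \<in> sections X U" by (rule assms(7))
qed

lemma sheaf_divide:
  assumes "function_sheaf X" "openin (ftop X) U" "f \<in> sections X U" "g \<in> sections X U"
    "\<And>x. x \<in> U \<Longrightarrow> g x \<noteq> 0"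
  shows "(\<lambda>x. f x / g x) \<in> sections X U"
  using sheaf_mult[OF assms(1-3) sheaf_inverse[OF assms(1,2,4,5)]] by simp

lemma sheaf_sum:
  assumes "function_sheaf X" "openin (ftop X) U" "\<And>i. i \<in> I \<Longrightarrow> f i \<in> sections X U"
  shows "(\<lambda>x. \<Sum>i\<in>I. f i x) \<in> sections X U"
  using assms(3)
proof (induction I rule: infinite_finite_induct)
  case (insert i I)
  then show ?case
    using sheaf_add[OF assms(1,2), of "f i" "\<lambda>x. \<Sum>i\<in>I. f i x"] by simp
qed (simp_all add: sheaf_const[OF assms(1,2)])

lemma sheaf_prod:
  assumes "function_sheaf X" "openin (ftop X) U" "\<And>i. i \<in> I \<Longrightarrow> f i \<in> sections X U"
  shows "(\<lambda>x. \<Prod>i\<in>I. f i x) \<in> sections X U"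
  using assms(3)
proof (induction I rule: infinite_finite_induct)
  case (insert i I)
  then show ?case
    using sheaf_mult[OF assms(1,2), of "f i" "\<lambda>x. \<Prod>i\<in>I. f i x"] by simp
qed (simp_all add: sheaf_const[OF assms(1,2)])

lemma sheaf_power:
  assumes "function_sheaf X" "openin (ftop X) U" "f \<in> sections X U"
  shows "(\<lambda>x. f x ^ k) \<in> sections X U"
  using sheaf_prod[OF assms(1,2), of "{..<k}" "\<lambda>_. f"] assms(3) by simp

lemma sheaf_polyfuns:
  assumes "function_sheaf X" "openin (ftop X) U"
    "\<And>c. c \<in> C \<Longrightarrow> (\<lambda>x. c (\<phi> x)) \<in> sections X U" "f \<in> polyfuns C"
  shows "(\<lambda>x. f (\<phi> x)) \<in> sections X U"
  using assms(4)
  by induction (auto intro: sheaf_const sheaf_add sheaf_mult assms)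

lemma sheaf_det:
  assumes X: "function_sheaf X" "openin (ftop X) U"
    and a: "\<And>i j. i < n \<Longrightarrow> j < n \<Longrightarrow> (\<lambda>x. a x i j) \<in> sections X U"
  shows "(\<lambda>x. det (mat n n (\<lambda>(i, j). a x i j))) \<in> sections X U"
proof -
  have eq: "det (mat n n (\<lambda>(i, j). a x i j)) =
      (\<Sum>p\<in>{p. p permutes {0..<n}}. signof p * (\<Prod>i=0..<n. a x i (p i)))" for x
    by (subst det_def'[of _ n])
      (auto intro!: sum.cong prod.cong arg_cong2[where f="(*)"] dest: permutes_in_image)
  show ?thesis
    unfolding eq
    by (intro sheaf_sum sheaf_mult sheaf_const sheaf_prod a X) (auto dest: permutes_in_image)
qed

lemma polyfuns_prod:
  "(\<And>i. i \<in> I \<Longrightarrow> f i \<in> polyfuns C) \<Longrightarrow> (\<lambda>x. \<Prod>i\<in>I. f i x) \<in> polyfuns C"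
proof (induction I rule: infinite_finite_induct)
  case (insert i I)
  then show ?case
    using polyfuns.mult[of "f i" C "\<lambda>x. \<Prod>i\<in>I. f i x"] by simp
qed (simp_all add: polyfuns.const)

section \<open>Regular functions on quasi-affine spaces\<close>

lemma openin_zariski_nonzero: "f \<in> polyfuns C \<Longrightarrow> openin (zariski C S) {x\<in>S. f x \<noteq> 0}"
  unfolding openin_zariski by (rule exI[of _ "{f}"]) auto

lemma ftop_quasi_affine [simp]: "ftop (quasi_affine C S) = zariski C S"
  by (simp add: quasi_affine_def)

lemma points_quasi_affine [simp]: "topspace (zariski C S) = S"
  by (rule topspace_zariski)

lemma sections_quasi_affine:
  "f \<in> sections (quasi_affine C S) U \<longleftrightarrow>
     (\<forall>x\<in>U. \<exists>V g h. openin (zariski C S) V \<and> x \<in> V \<and> g \<in> polyfuns C \<and> h \<in> polyfuns C \<and>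
        (\<forall>y\<in>U \<inter> V. h y \<noteq> 0 \<and> f y = g y / h y))"
  by (simp add: quasi_affine_def)

lemma polyfuns_section:
  assumes "f \<in> polyfuns C" "openin (zariski C S) U"
  shows "f \<in> sections (quasi_affine C S) U"
  unfolding sections_quasi_affine
proof
  fix x assume "x \<in> U"
  then show "\<exists>V g h. openin (zariski C S) V \<and> x \<in> V \<and> g \<in> polyfuns C \<and> h \<in> polyfuns C \<and>
        (\<forall>y\<in>U \<inter> V. h y \<noteq> 0 \<and> f y = g y / h y)"
    using assms polyfuns.const[of 1 C] by (intro exI[of _ U] exI[of _ f] exI[of _ "\<lambda>_. 1"]) auto
qed

lemma function_sheaf_quasi_affine: "function_sheaf (quasi_affine C S)"
proof -
  let ?X = "quasi_affine C S"
  let ?O = "openin (zariski C S)"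
  have A1: "g \<in> sections ?X U" if "f \<in> sections ?X U" "\<forall>x\<in>U. g x = f x" for U f g
    unfolding sections_quasi_affine
  proof
    fix x assume "x \<in> U"
    with that(1) obtain V a b where "?O V" "x \<in> V" "a \<in> polyfuns C" "b \<in> polyfuns C"
      "\<forall>y\<in>U \<inter> V. b y \<noteq> 0 \<and> f y = a y / b y"
      unfolding sections_quasi_affine by meson
    then show "\<exists>V a b. ?O V \<and> x \<in> V \<and> a \<in> polyfuns C \<and> b \<in> polyfuns C \<and>
        (\<forall>y\<in>U \<inter> V. b y \<noteq> 0 \<and> g y = a y / b y)"
      using that(2) by (intro exI[of _ V] exI[of _ a] exI[of _ b]) auto
  qed
  have A2: "f \<in> sections ?X V" if "f \<in> sections ?X U" "V \<subseteq> U" for U V f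
    unfolding sections_quasi_affine
  proof
    fix x assume "x \<in> V"
    with that have "x \<in> U" by auto
    with that(1) obtain W a b where "?O W" "x \<in> W" "a \<in> polyfuns C" "b \<in> polyfuns C"
      "\<forall>y\<in>U \<inter> W. b y \<noteq> 0 \<and> f y = a y / b y"
      unfolding sections_quasi_affine by meson
    then show "\<exists>W a b. ?O W \<and> x \<in> W \<and> a \<in> polyfuns C \<and> b \<in> polyfuns C \<and>
        (\<forall>y\<in>V \<inter> W. b y \<noteq> 0 \<and> f y = a y / b y)"
      using that(2) by (intro exI[of _ W] exI[of _ a] exI[of _ b]) auto
  qed
  have A3: "f \<in> sections ?X U"
    if loc: "\<forall>x\<in>U. \<exists>V. ?O V \<and> x \<in> V \<and> V \<subseteq> U \<and> f \<in> sections ?X V" for U f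
    unfolding sections_quasi_affine
  proof
    fix x assume "x \<in> U"
    with loc obtain V where V: "?O V" "x \<in> V" "V \<subseteq> U" "f \<in> sections ?X V" by meson
    then obtain W a b where W: "?O W" "x \<in> W" "a \<in> polyfuns C" "b \<in> polyfuns C"
      "\<forall>y\<in>V \<inter> W. b y \<noteq> 0 \<and> f y = a y / b y"
      unfolding sections_quasi_affine by meson
    then show "\<exists>W a b. ?O W \<and> x \<in> W \<and> a \<in> polyfuns C \<and> b \<in> polyfuns C \<and>
        (\<forall>y\<in>U \<inter> W. b y \<noteq> 0 \<and> f y = a y / b y)"
      using V by (intro exI[of _ "V \<inter> W"] exI[of _ a] exI[of _ b]) auto
  qed
  have A4: "(\<lambda>_. c) \<in> sections ?X U" if "?O U" for U c
    using that by (intro polyfuns_section polyfuns.const)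
  have A56: "(\<lambda>x. f x + g x) \<in> sections ?X U \<and> (\<lambda>x. f x * g x) \<in> sections ?X U"
    if f: "f \<in> sections ?X U" and g: "g \<in> sections ?X U" for U f g
  proof -
    have "\<exists>V a b a' b'. ?O V \<and> x \<in> V \<and> a \<in> polyfuns C \<and> b \<in> polyfuns C \<and> a' \<in> polyfuns C \<and> b' \<in> polyfuns C \<and>
       (\<forall>y\<in>U \<inter> V. b y \<noteq> 0 \<and> f y = a y / b y \<and> b' y \<noteq> 0 \<and> g y = a' y / b' y)" if x: "x \<in> U" for x
    proof -
      obtain V a b where V: "?O V" "x \<in> V" "a \<in> polyfuns C" "b \<in> polyfuns C"
        "\<forall>y\<in>U \<inter> V. b y \<noteq> 0 \<and> f y = a y / b y"
        using f x unfolding sections_quasi_affine by meson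
      obtain V' a' b' where V': "?O V'" "x \<in> V'" "a' \<in> polyfuns C" "b' \<in> polyfuns C"
        "\<forall>y\<in>U \<inter> V'. b' y \<noteq> 0 \<and> g y = a' y / b' y"
        using g x unfolding sections_quasi_affine by meson
      show ?thesis
        using V V' by (intro exI[of _ "V \<inter> V'"] exI[of _ a] exI[of _ b] exI[of _ a'] exI[of _ b']) auto
    qed
    note * = this
    have "(\<lambda>x. f x + g x) \<in> sections ?X U"
      unfolding sections_quasi_affine
    proof
      fix x assume "x \<in> U"
      with * obtain V a b a' b' where V: "?O V" "x \<in> V" "a \<in> polyfuns C" "b \<in> polyfuns C" "a' \<in> polyfuns C"
        "b' \<in> polyfuns C" and
        eq: "\<And>y. y \<in> U \<inter> V \<Longrightarrow> b y \<noteq> 0 \<and> f y = a y / b y \<and> b' y \<noteq> 0 \<and> g y = a' y / b' y"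
        by meson
      show "\<exists>V a b. ?O V \<and> x \<in> V \<and> a \<in> polyfuns C \<and> b \<in> polyfuns C \<and>
          (\<forall>y\<in>U \<inter> V. b y \<noteq> 0 \<and> f y + g y = a y / b y)"
        using V eq
        by (intro exI[of _ V] exI[of _ "\<lambda>y. a y * b' y + a' y * b y"] exI[of _ "\<lambda>y. b y * b' y"])
          (auto intro!: polyfuns.add polyfuns.mult simp: add_frac_eq)
    qed
    moreover have "(\<lambda>x. f x * g x) \<in> sections ?X U"
      unfolding sections_quasi_affine
    proof
      fix x assume "x \<in> U"
      with * obtain V a b a' b' where V: "?O V" "x \<in> V" "a \<in> polyfuns C" "b \<in> polyfuns C" "a' \<in> polyfuns C"
        "b' \<in> polyfuns C" and
        eq: "\<And>y. y \<in> U \<inter> V \<Longrightarrow> b y \<noteq> 0 \<and> f y = a y / b y \<and> b' y \<noteq> 0 \<and> g y = a' y / b' y"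
        by meson
      show "\<exists>V a b. ?O V \<and> x \<in> V \<and> a \<in> polyfuns C \<and> b \<in> polyfuns C \<and>
          (\<forall>y\<in>U \<inter> V. b y \<noteq> 0 \<and> f y * g y = a y / b y)"
        using V eq
        by (intro exI[of _ V] exI[of _ "\<lambda>y. a y * a' y"] exI[of _ "\<lambda>y. b y * b' y"])
          (auto intro!: polyfuns.add polyfuns.mult)
    qed
    ultimately show ?thesis ..
  qed
  have A7: "?O {x\<in>U. f x \<noteq> 0}" if U: "?O U" and f: "f \<in> sections ?X U" for U f
  proof (subst openin_subopen, safe)
    fix x assume x: "x \<in> U" "f x \<noteq> 0"
    with f obtain V a b where V: "?O V" "x \<in> V" "a \<in> polyfuns C" "b \<in> polyfuns C"
      "\<forall>y\<in>U \<inter> V. b y \<noteq> 0 \<and> f y = a y / b y"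
      unfolding sections_quasi_affine by meson
    have "U \<subseteq> S" using openin_subset[OF U] by simp
    then have "?O (U \<inter> V \<inter> {y\<in>S. a y \<noteq> 0})" "x \<in> U \<inter> V \<inter> {y\<in>S. a y \<noteq> 0}"
      "U \<inter> V \<inter> {y\<in>S. a y \<noteq> 0} \<subseteq> {x\<in>U. f x \<noteq> 0}"
      using V U x openin_zariski_nonzero[OF V(3), of S] by (auto intro!: openin_Int)
    then show "\<exists>T. ?O T \<and> x \<in> T \<and> T \<subseteq> {x\<in>U. f x \<noteq> 0}" by blast
  qed
  have A8: "(\<lambda>x. 1 / f x) \<in> sections ?X U" if f: "f \<in> sections ?X U" and nz: "\<forall>x\<in>U. f x \<noteq> 0" for U f
    unfolding sections_quasi_affine
  proof
    fix x assume "x \<in> U"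
    with f obtain V a b where "?O V" "x \<in> V" "a \<in> polyfuns C" "b \<in> polyfuns C"
      "\<forall>y\<in>U \<inter> V. b y \<noteq> 0 \<and> f y = a y / b y"
      unfolding sections_quasi_affine by meson
    then show "\<exists>V a b. ?O V \<and> x \<in> V \<and> a \<in> polyfuns C \<and> b \<in> polyfuns C \<and>
        (\<forall>y\<in>U \<inter> V. b y \<noteq> 0 \<and> 1 / f y = a y / b y)"
      using nz by (intro exI[of _ V] exI[of _ b] exI[of _ a]) fastforce
  qed
  show ?thesis
    by (rule function_sheafI; (unfold ftop_quasi_affine)?) (fact A1 A2 A3 A4 A56 A7 A8)+
qed

section \<open>The structure induced on a subset\<close>

lemma ftop_sub [simp]: "ftop (sub_fspace X S) = subtopology (ftop X) S"
  by (simp add: sub_fspace_def)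

lemma sections_sub:
  "f \<in> sections (sub_fspace X S) U \<longleftrightarrow>
     (\<forall>x \<in> U. \<exists>V g. openin (ftop X) V \<and> x \<in> V \<and> g \<in> sections X V \<and> (\<forall>y \<in> U \<inter> V. f y = g y))"
  by (simp add: sub_fspace_def)

lemma sections_sub_restrict:
  assumes X: "function_sheaf X" "openin (ftop X) U" and f: "f \<in> sections X U" and V: "V \<subseteq> U"
  shows "f \<in> sections (sub_fspace X S) V"
  unfolding sections_sub using assms by blast

lemma function_sheaf_sub:
  assumes X: "function_sheaf X"
  shows "function_sheaf (sub_fspace X S)"
proof -
  let ?X = "sub_fspace X S"
  let ?O = "openin (subtopology (ftop X) S)"
  have A1: "g \<in> sections ?X U" if "f \<in> sections ?X U" "\<forall>x\<in>U. g x = f x" for U f g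
    unfolding sections_sub
  proof
    fix x assume "x \<in> U"
    with that(1) obtain V h where "openin (ftop X) V" "x \<in> V" "h \<in> sections X V" "\<forall>y\<in>U \<inter> V. f y = h y"
      unfolding sections_sub by meson
    then show "\<exists>V h. openin (ftop X) V \<and> x \<in> V \<and> h \<in> sections X V \<and> (\<forall>y\<in>U \<inter> V. g y = h y)"
      using that(2) by (intro exI[of _ V] exI[of _ h]) auto
  qed
  have A2: "f \<in> sections ?X V" if "f \<in> sections ?X U" "V \<subseteq> U" for U V f
    unfolding sections_sub
  proof
    fix x assume "x \<in> V"
    with that have "x \<in> U" by auto
    with that(1) obtain W h where "openin (ftop X) W" "x \<in> W" "h \<in> sections X W" "\<forall>y\<in>U \<inter> W. f y = h y"
      unfolding sections_sub by meson
    then show "\<exists>W h. openin (ftop X) W \<and> x \<in> W \<and> h \<in> sections X W \<and> (\<forall>y\<in>V \<inter> W. f y = h y)"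
      using that(2) by (intro exI[of _ W] exI[of _ h]) auto
  qed
  have A3: "f \<in> sections ?X U"
    if loc: "\<forall>x\<in>U. \<exists>V. ?O V \<and> x \<in> V \<and> V \<subseteq> U \<and> f \<in> sections ?X V" for U f
    unfolding sections_sub
  proof
    fix x assume x: "x \<in> U"
    with loc obtain V where V: "?O V" "x \<in> V" "V \<subseteq> U" "f \<in> sections ?X V" by meson
    then obtain W g where W: "openin (ftop X) W" "x \<in> W" "g \<in> sections X W" "\<forall>y\<in>V \<inter> W. f y = g y"
      unfolding sections_sub by meson
    obtain V' where V': "openin (ftop X) V'" "V = V' \<inter> S"
      using V(1) unfolding openin_subtopology by auto
    have "g \<in> sections X (V' \<inter> W)"
      using V' W by (intro sheaf_restrict[OF X W(1,3)]) auto
    moreover have "\<forall>y\<in>U \<inter> (V' \<inter> W). y \<in> S \<longrightarrow> f y = g y"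
      using V' W by auto
    \<comment> \<open>\<open>U\<close> is arbitrary here, but the cover by open sets of the subspace
      keeps it inside \<open>S\<close>.\<close>
    moreover have "U \<subseteq> S"
    proof
      fix y assume "y \<in> U"
      with loc obtain V where "?O V" "y \<in> V" by meson
      then show "y \<in> S" using openin_subset by fastforce
    qed
    ultimately show "\<exists>V g. openin (ftop X) V \<and> x \<in> V \<and> g \<in> sections X V \<and> (\<forall>y \<in> U \<inter> V. f y = g y)"
      using V V' W by (intro exI[of _ "V' \<inter> W"] exI[of _ g]) auto
  qed
  have open_sub: "\<exists>W. openin (ftop X) W \<and> U = W \<inter> S" if "?O U" for U
    using that unfolding openin_subtopology by auto
  have A4: "(\<lambda>_. c) \<in> sections ?X U" if "?O U" for U c
    using open_sub[OF that] sections_sub_restrict[OF X _ sheaf_const[OF X]] by blast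
  have A56: "(\<lambda>x. f x + g x) \<in> sections ?X U \<and> (\<lambda>x. f x * g x) \<in> sections ?X U"
    if f: "f \<in> sections ?X U" and g: "g \<in> sections ?X U" for U f g
  proof -
    have "\<exists>V a b. openin (ftop X) V \<and> x \<in> V \<and> a \<in> sections X V \<and> b \<in> sections X V \<and>
       (\<forall>y\<in>U \<inter> V. f y = a y \<and> g y = b y)" if x: "x \<in> U" for x
    proof -
      obtain V a where V: "openin (ftop X) V" "x \<in> V" "a \<in> sections X V" "\<forall>y\<in>U \<inter> V. f y = a y"
        using f x unfolding sections_sub by meson
      obtain V' b where V': "openin (ftop X) V'" "x \<in> V'" "b \<in> sections X V'" "\<forall>y\<in>U \<inter> V'. g y = b y"
        using g x unfolding sections_sub by meson
      show ?thesis
        using V V' 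
        by (intro exI[of _ "V \<inter> V'"] exI[of _ a] exI[of _ b] conjI)
          (auto intro: sheaf_restrict[OF X V(1)] sheaf_restrict[OF X V'(1)])
    qed
    note * = this
    have "(\<lambda>x. f x + g x) \<in> sections ?X U"
      unfolding sections_sub
    proof
      fix x assume "x \<in> U"
      with * obtain V a b where "openin (ftop X) V" "x \<in> V" "a \<in> sections X V" "b \<in> sections X V"
        "\<forall>y\<in>U \<inter> V. f y = a y \<and> g y = b y" by meson
      then show "\<exists>V h. openin (ftop X) V \<and> x \<in> V \<and> h \<in> sections X V \<and> (\<forall>y\<in>U \<inter> V. f y + g y = h y)"
        by (intro exI[of _ V] exI[of _ "\<lambda>y. a y + b y"]) (auto intro: sheaf_add[OF X])
    qed
    moreover have "(\<lambda>x. f x * g x) \<in> sections ?X U"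
      unfolding sections_sub
    proof
      fix x assume "x \<in> U"
      with * obtain V a b where "openin (ftop X) V" "x \<in> V" "a \<in> sections X V" "b \<in> sections X V"
        "\<forall>y\<in>U \<inter> V. f y = a y \<and> g y = b y" by meson
      then show "\<exists>V h. openin (ftop X) V \<and> x \<in> V \<and> h \<in> sections X V \<and> (\<forall>y\<in>U \<inter> V. f y * g y = h y)"
        by (intro exI[of _ V] exI[of _ "\<lambda>y. a y * b y"]) (auto intro: sheaf_mult[OF X])
    qed
    ultimately show ?thesis ..
  qed
  have A7: "?O {x\<in>U. f x \<noteq> 0}" if U: "?O U" and f: "f \<in> sections ?X U" for U f
  proof (subst openin_subopen, safe)
    fix x assume x: "x \<in> U" "f x \<noteq> 0"
    with f obtain V a where V: "openin (ftop X) V" "x \<in> V" "a \<in> sections X V" "\<forall>y\<in>U \<inter> V. f y = a y"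
      unfolding sections_sub by meson
    obtain W where W: "openin (ftop X) W" "U = W \<inter> S" using open_sub[OF U] by blast
    have "openin (ftop X) (W \<inter> {y\<in>V. a y \<noteq> 0})"
      using W V sheaf_nonzero[OF X V(1,3)] by blast
    then have "?O (W \<inter> {y\<in>V. a y \<noteq> 0} \<inter> S)"
      by (auto simp: openin_subtopology)
    then show "\<exists>T. ?O T \<and> x \<in> T \<and> T \<subseteq> {x\<in>U. f x \<noteq> 0}"
      using V x W by (intro exI[of _ "W \<inter> {y\<in>V. a y \<noteq> 0} \<inter> S"]) auto
  qed
  have A8: "(\<lambda>x. 1 / f x) \<in> sections ?X U" if f: "f \<in> sections ?X U" and nz: "\<forall>x\<in>U. f x \<noteq> 0" for U f
    unfolding sections_sub
  proof
    fix x assume x: "x \<in> U"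
    with f obtain V a where V: "openin (ftop X) V" "x \<in> V" "a \<in> sections X V" "\<forall>y\<in>U \<inter> V. f y = a y"
      unfolding sections_sub by meson
    \<comment> \<open>The extension \<open>a\<close> of \<open>f\<close> may vanish off
      \<open>U\<close>, so its reciprocal lives only on this smaller ambient open set.\<close>
    let ?V = "{y\<in>V. a y \<noteq> 0}"
    have V': "openin (ftop X) ?V" by (rule sheaf_nonzero[OF X V(1,3)])
    have "(\<lambda>x. 1 / a x) \<in> sections X ?V"
      by (rule sheaf_inverse[OF X V']) (auto intro: sheaf_restrict[OF X V(1,3) V'])
    moreover have "x \<in> ?V" using V x nz by force
    ultimately show "\<exists>V g. openin (ftop X) V \<and> x \<in> V \<and> g \<in> sections X V \<and> (\<forall>y \<in> U \<inter> V. 1 / f y = g y)"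
      using V' V by (intro exI[of _ ?V] exI[of _ "\<lambda>x. 1 / a x"]) auto
  qed
  show ?thesis
    by (rule function_sheafI; (unfold ftop_sub)?) (fact A1 A2 A3 A4 A56 A7 A8)+
qed

section \<open>The quotient structure\<close>

lemma sections_quotient:
  "f \<in> sections (quotient_fspace X \<pi>) U \<longleftrightarrow> f \<circ> \<pi> \<in> sections X {x \<in> points X. \<pi> x \<in> U}"
  by (simp add: quotient_fspace_def)

lemma function_sheaf_quotient:
  assumes X: "function_sheaf X"
  shows "function_sheaf (quotient_fspace X \<pi>)"
proof -
  let ?Q = "quotient_fspace X \<pi>"
  let ?p = "\<lambda>U. {x \<in> points X. \<pi> x \<in> U}"
  have O: "openin (ftop X) (?p U)" if "openin (ftop ?Q) U" for U
    using that by (simp add: openin_quotient_fspace)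
  have A3: "f \<in> sections ?Q U"
    if U: "openin (ftop ?Q) U"
      and loc: "\<forall>x\<in>U. \<exists>V. openin (ftop ?Q) V \<and> x \<in> V \<and> V \<subseteq> U \<and> f \<in> sections ?Q V" for U f
    unfolding sections_quotient
  proof (rule sheaf_glue[OF X O[OF U]])
    fix x assume "x \<in> ?p U"
    with loc obtain V where "openin (ftop ?Q) V" "\<pi> x \<in> V" "V \<subseteq> U" "f \<in> sections ?Q V" "x \<in> points X"
      by blast
    then show "\<exists>V. openin (ftop X) V \<and> x \<in> V \<and> V \<subseteq> ?p U \<and> f \<circ> \<pi> \<in> sections X V"
      by (intro exI[of _ "?p V"]) (auto simp: sections_quotient O)
  qed
  have A7: "openin (ftop ?Q) {x\<in>U. f x \<noteq> 0}" if U: "openin (ftop ?Q) U" and f: "f \<in> sections ?Q U" for U f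
  proof -
    have "{x \<in> points X. \<pi> x \<in> {x\<in>U. f x \<noteq> 0}} = {x \<in> ?p U. (f \<circ> \<pi>) x \<noteq> 0}" by auto
    moreover have "openin (ftop X) {x \<in> ?p U. (f \<circ> \<pi>) x \<noteq> 0}"
      using f by (intro sheaf_nonzero[OF X O[OF U]]) (simp only: sections_quotient)
    ultimately show ?thesis
      using U by (auto simp: openin_quotient_fspace)
  qed
  show ?thesis
    unfolding function_sheaf_def
  proof (intro conjI allI impI)
    fix U f g assume "openin (ftop ?Q) U" "f \<in> sections ?Q U" "\<forall>x\<in>U. g x = f x"
    then show "g \<in> sections ?Q U"
      unfolding sections_quotient by (intro sheaf_cong[OF X O, of U "f \<circ> \<pi>" "g \<circ> \<pi>"]) auto
  next
    fix U V f assume U: "openin (ftop ?Q) U" "openin (ftop ?Q) V" "V \<subseteq> U" "f \<in> sections ?Q U"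
    show "f \<in> sections ?Q V"
      unfolding sections_quotient
      by (rule sheaf_restrict[OF X O[OF U(1)] U(4)[unfolded sections_quotient] O[OF U(2)]]) (use U(3) in auto)
  next
    fix U f assume "openin (ftop ?Q) U"
      "\<forall>x\<in>U. \<exists>V. openin (ftop ?Q) V \<and> x \<in> V \<and> V \<subseteq> U \<and> f \<in> sections ?Q V"
    then show "f \<in> sections ?Q U" by (rule A3)
  next
    fix U c assume "openin (ftop ?Q) U"
    then show "(\<lambda>_. c) \<in> sections ?Q U"
      unfolding sections_quotient o_def by (intro sheaf_const[OF X O])
  next
    fix U f g assume U: "openin (ftop ?Q) U" and f: "f \<in> sections ?Q U" "g \<in> sections ?Q U"
    show "(\<lambda>x. f x + g x) \<in> sections ?Q U" "(\<lambda>x. f x * g x) \<in> sections ?Q U"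
      using sheaf_add[OF X O[OF U] f[unfolded sections_quotient]]
        sheaf_mult[OF X O[OF U] f[unfolded sections_quotient]]
      unfolding sections_quotient o_def .
  next
    fix U f assume "openin (ftop ?Q) U" "f \<in> sections ?Q U"
    then show "openin (ftop ?Q) {x\<in>U. f x \<noteq> 0}" by (rule A7)
  next
    fix U f assume U: "openin (ftop ?Q) U" and f: "f \<in> sections ?Q U" and nz: "\<forall>x\<in>U. f x \<noteq> 0"
    have "(\<lambda>x. 1 / (f \<circ> \<pi>) x) \<in> sections X (?p U)"
      using nz by (intro sheaf_inverse[OF X O[OF U] f[unfolded sections_quotient]]) auto
    then show "(\<lambda>x. 1 / f x) \<in> sections ?Q U" by (simp only: sections_quotient o_def)
  qed
qed

text \<open>A morphism on an open subset, phrased with the sections of the whole of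
  \<open>X\<close>, so that local formulas can be glued without forming a subspace.\<close>

definition regular_on :: "'a fspace \<Rightarrow> 'b fspace \<Rightarrow> 'a set \<Rightarrow> ('a \<Rightarrow> 'b) \<Rightarrow> bool" where
  "regular_on X Y U \<phi> \<longleftrightarrow>
     openin (ftop X) U \<and> \<phi> ` U \<subseteq> points Y \<and>
     (\<forall>V. openin (ftop Y) V \<longrightarrow> openin (ftop X) {x\<in>U. \<phi> x \<in> V}) \<and>
     (\<forall>V f. openin (ftop Y) V \<longrightarrow> f \<in> sections Y V \<longrightarrow> f \<circ> \<phi> \<in> sections X {x\<in>U. \<phi> x \<in> V})"

lemma morphism_regular_on: "morphism X Y \<phi> \<longleftrightarrow> regular_on X Y (points X) \<phi>"
  unfolding morphism_def regular_on_def continuous_map_def by (auto simp: image_subset_iff Pi_iff)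

lemma
  assumes "regular_on X Y U \<phi>"
  shows regular_on_open: "openin (ftop X) U"
    and regular_on_image: "\<And>x. x \<in> U \<Longrightarrow> \<phi> x \<in> points Y"
    and regular_on_preimage: "\<And>V. openin (ftop Y) V \<Longrightarrow> openin (ftop X) {x\<in>U. \<phi> x \<in> V}"
    and regular_on_pullback: "\<And>V f. openin (ftop Y) V \<Longrightarrow> f \<in> sections Y V \<Longrightarrow> f \<circ> \<phi> \<in> sections X {x\<in>U. \<phi> x \<in> V}"
  using assms unfolding regular_on_def by auto

lemma
  assumes "morphism X Y \<phi>"
  shows morphism_image: "\<And>x. x \<in> points X \<Longrightarrow> \<phi> x \<in> points Y"
    and morphism_preimage: "\<And>V. openin (ftop Y) V \<Longrightarrow> openin (ftop X) {x\<in>points X. \<phi> x \<in> V}"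
    and morphism_pullback: "\<And>V f. openin (ftop Y) V \<Longrightarrow> f \<in> sections Y V \<Longrightarrow> f \<circ> \<phi> \<in> sections X {x\<in>points X. \<phi> x \<in> V}"
  using assms unfolding morphism_regular_on regular_on_def by auto

lemma morphism_closure:
  assumes "morphism X Y \<phi>" "x \<in> ftop X closure_of S" "\<phi> ` S \<subseteq> T"
  shows "\<phi> x \<in> ftop Y closure_of T"
  using assms continuous_map_image_closure_subset[of "ftop X" "ftop Y" \<phi> S]
    closure_of_mono[of "\<phi> ` S" T "ftop Y"]
  unfolding morphism_def by blast

lemma regular_on_cong:
  assumes X: "function_sheaf X" and f: "regular_on X Y U \<phi>" and eq: "\<And>x. x \<in> U \<Longrightarrow> \<psi> x = \<phi> x"
  shows "regular_on X Y U \<psi>"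
proof -
  have s: "{x\<in>U. \<psi> x \<in> V} = {x\<in>U. \<phi> x \<in> V}" for V using eq by auto
  have "h \<circ> \<psi> \<in> sections X {x\<in>U. \<phi> x \<in> V}" if "openin (ftop Y) V" "h \<in> sections Y V" for V h
    using eq by (intro sheaf_cong[OF X regular_on_preimage[OF f that(1)] regular_on_pullback[OF f that]]) auto
  then show ?thesis
    using f eq unfolding regular_on_def s by auto
qed

lemma regular_on_comp:
  assumes f: "regular_on X Y U \<phi>" and g: "morphism Y Z \<psi>"
  shows "regular_on X Z U (\<psi> \<circ> \<phi>)"
proof -
  have s: "{x\<in>U. (\<psi> \<circ> \<phi>) x \<in> V} = {x\<in>U. \<phi> x \<in> {y\<in>points Y. \<psi> y \<in> V}}" for V
    using regular_on_image[OF f] by auto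
  show ?thesis
    unfolding regular_on_def s
    using regular_on_open[OF f] regular_on_image[OF f] morphism_image[OF g] regular_on_preimage[OF f morphism_preimage[OF g]]
      regular_on_pullback[OF f morphism_preimage[OF g] morphism_pullback[OF g]]
    by (auto simp: comp_assoc)
qed

lemma morphism_comp:
  "morphism X Y \<phi> \<Longrightarrow> morphism Y Z \<psi> \<Longrightarrow> morphism X Z (\<psi> \<circ> \<phi>)"
  using regular_on_comp unfolding morphism_regular_on[of X] by metis

lemma morphism_cong:
  "function_sheaf X \<Longrightarrow> morphism X Y \<phi> \<Longrightarrow> (\<And>x. x \<in> points X \<Longrightarrow> \<psi> x = \<phi> x) \<Longrightarrow> morphism X Y \<psi>"
  unfolding morphism_regular_on by (rule regular_on_cong)

lemma morphism_glue:
  assumes X: "function_sheaf X"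
    and loc: "\<And>x. x \<in> points X \<Longrightarrow> \<exists>U. x \<in> U \<and> regular_on X Y U \<phi>"
  shows "morphism X Y \<phi>"
proof -
  have O: "openin (ftop X) {x\<in>points X. \<phi> x \<in> V}" if V: "openin (ftop Y) V" for V
  proof (subst openin_subopen, safe)
    fix x assume x: "x \<in> points X" "\<phi> x \<in> V"
    obtain U where U: "x \<in> U" "regular_on X Y U \<phi>" using loc[OF x(1)] by blast
    then show "\<exists>T. openin (ftop X) T \<and> x \<in> T \<and> T \<subseteq> {x\<in>points X. \<phi> x \<in> V}"
      using regular_on_preimage[OF U(2) V] openin_subset[OF regular_on_open[OF U(2)]] x
      by (intro exI[of _ "{x\<in>U. \<phi> x \<in> V}"]) auto
  qed
  have "f \<circ> \<phi> \<in> sections X {x\<in>points X. \<phi> x \<in> V}" if V: "openin (ftop Y) V" and f: "f \<in> sections Y V" for V f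
  proof (rule sheaf_glue[OF X O[OF V]])
    fix x assume "x \<in> {x\<in>points X. \<phi> x \<in> V}"
    then have x: "x \<in> points X" "\<phi> x \<in> V" by auto
    obtain U where U: "x \<in> U" "regular_on X Y U \<phi>" using loc[OF x(1)] by blast
    then show "\<exists>T. openin (ftop X) T \<and> x \<in> T \<and> T \<subseteq> {x\<in>points X. \<phi> x \<in> V} \<and> f \<circ> \<phi> \<in> sections X T"
      using regular_on_preimage[OF U(2) V] openin_subset[OF regular_on_open[OF U(2)]] x
        regular_on_pullback[OF U(2) V f]
      by (intro exI[of _ "{x\<in>U. \<phi> x \<in> V}"]) auto
  qed
  moreover have "\<phi> ` points X \<subseteq> points Y"
    using loc regular_on_image by fast
  ultimately show ?thesis
    using O unfolding morphism_regular_on regular_on_def by auto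
qed

text \<open>Regular coordinates suffice: polynomials in them are sections, so open sets pull back to
  unions of nonvanishing sets, and local fractions pull back to fractions of sections.\<close>

lemma regular_on_quasi_affine:
  assumes X: "function_sheaf X" and U: "openin (ftop X) U"
    and S: "\<And>x. x \<in> U \<Longrightarrow> \<phi> x \<in> S"
    and C: "\<And>c. c \<in> C \<Longrightarrow> (\<lambda>x. c (\<phi> x)) \<in> sections X U"
  shows "regular_on X (quasi_affine C S) U \<phi>"
proof -
  have P: "(\<lambda>x. f (\<phi> x)) \<in> sections X U" if "f \<in> polyfuns C" for f
    by (rule sheaf_polyfuns[OF X U C that])
  have O: "openin (ftop X) {x\<in>U. \<phi> x \<in> V}" if V: "openin (zariski C S) V" for V
  proof -
    obtain F where F: "F \<subseteq> polyfuns C" "V = {x\<in>S. \<exists>f\<in>F. f x \<noteq> 0}"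
      using V unfolding openin_zariski by auto
    have "{x\<in>U. \<phi> x \<in> V} = (\<Union>f\<in>F. {x\<in>U. f (\<phi> x) \<noteq> 0})"
      using S unfolding F(2) by auto
    moreover have "openin (ftop X) {x\<in>U. f (\<phi> x) \<noteq> 0}" if "f \<in> F" for f
      using sheaf_nonzero[OF X U P] F(1) that by auto
    ultimately show ?thesis by auto
  qed
  have "f \<circ> \<phi> \<in> sections X {x\<in>U. \<phi> x \<in> V}"
    if V: "openin (zariski C S) V" and f: "f \<in> sections (quasi_affine C S) V" for V f
  proof (rule sheaf_glue[OF X O[OF V]])
    fix x assume "x \<in> {x\<in>U. \<phi> x \<in> V}"
    then have x: "x \<in> U" "\<phi> x \<in> V" by auto
    then obtain W g h where W: "openin (zariski C S) W" "\<phi> x \<in> W" "g \<in> polyfuns C" "h \<in> polyfuns C"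
      "\<forall>y\<in>V \<inter> W. h y \<noteq> 0 \<and> f y = g y / h y"
      using f unfolding sections_quasi_affine by meson
    let ?T = "{x\<in>U. \<phi> x \<in> V \<inter> W}"
    have T: "openin (ftop X) ?T" using O[of "V \<inter> W"] V W by blast
    have sec: "(\<lambda>x. g (\<phi> x)) \<in> sections X ?T" "(\<lambda>x. h (\<phi> x)) \<in> sections X ?T"
      by (rule sheaf_restrict[OF X U P[OF W(3)] T], blast) (rule sheaf_restrict[OF X U P[OF W(4)] T], blast)
    have "(\<lambda>x. g (\<phi> x) / h (\<phi> x)) \<in> sections X ?T"
      using W by (intro sheaf_divide[OF X T sec]) auto
    then have "f \<circ> \<phi> \<in> sections X ?T"
      by (rule sheaf_cong[OF X T]) (use W in auto)
    then show "\<exists>T. openin (ftop X) T \<and> x \<in> T \<and> T \<subseteq> {x\<in>U. \<phi> x \<in> V} \<and> f \<circ> \<phi> \<in> sections X T"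
      using T x W by (intro exI[of _ ?T]) auto
  qed
  then show ?thesis
    using O S U unfolding regular_on_def by auto
qed

lemma morphism_quasi_affine:
  assumes "function_sheaf X" "\<And>x. x \<in> points X \<Longrightarrow> \<phi> x \<in> S"
    "\<And>c. c \<in> C \<Longrightarrow> (\<lambda>x. c (\<phi> x)) \<in> sections X (points X)"
  shows "morphism X (quasi_affine C S) \<phi>"
  unfolding morphism_regular_on by (rule regular_on_quasi_affine) (use assms in auto)

lemma morphism_quotient_map: "morphism X (quotient_fspace X \<pi>) \<pi>"
  unfolding morphism_regular_on regular_on_def
  by (auto simp: openin_quotient_fspace points_quotient_fspace sections_quotient)

text \<open>The universal property of the quotient, localized over an open set; opens and sections
  of the quotient are defined by pullback along the projection.\<close>

lemma regular_on_quotient: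
  assumes \<Omega>: "openin (ftop (quotient_fspace X \<pi>)) \<Omega>"
    and f: "regular_on X Y {x\<in>points X. \<pi> x \<in> \<Omega>} (f \<circ> \<pi>)"
  shows "regular_on (quotient_fspace X \<pi>) Y \<Omega> f"
proof -
  have \<Omega>': "\<Omega> \<subseteq> \<pi> ` points X" using \<Omega> by (simp add: openin_quotient_fspace)
  have s: "{x\<in>points X. \<pi> x \<in> {y\<in>\<Omega>. f y \<in> V}} = {x\<in>{x\<in>points X. \<pi> x \<in> \<Omega>}. (f \<circ> \<pi>) x \<in> V}" for V
    by auto
  show ?thesis
    unfolding regular_on_def
  proof (intro conjI allI impI)
    show "f ` \<Omega> \<subseteq> points Y" using \<Omega>' regular_on_image[OF f] by force
    fix V assume V: "openin (ftop Y) V"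
    show "openin (ftop (quotient_fspace X \<pi>)) {y\<in>\<Omega>. f y \<in> V}"
      unfolding openin_quotient_fspace s using \<Omega>' regular_on_preimage[OF f V] by blast
    fix h assume "h \<in> sections Y V"
    then show "h \<circ> f \<in> sections (quotient_fspace X \<pi>) {y\<in>\<Omega>. f y \<in> V}"
      unfolding sections_quotient s using regular_on_pullback[OF f V] by (simp add: comp_assoc)
  qed (rule \<Omega>)
qed

lemma morphism_quotient:
  assumes "morphism X Y (f \<circ> \<pi>)"
  shows "morphism (quotient_fspace X \<pi>) Y f"
proof -
  have s: "{x \<in> points X. \<pi> x \<in> \<pi> ` points X} = points X" by auto
  show ?thesis
    using assms unfolding morphism_regular_on points_quotient_fspace
    by (intro regular_on_quotient) (auto simp: openin_quotient_fspace s)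
qed

lemma morphism_into_sub:
  assumes X: "function_sheaf X" and f: "morphism X Y \<phi>" and S: "\<And>x. x \<in> points X \<Longrightarrow> \<phi> x \<in> S"
  shows "morphism X (sub_fspace Y S) \<phi>"
proof -
  have pre: "\<exists>W. openin (ftop Y) W \<and> V = W \<inter> S \<and> {x\<in>points X. \<phi> x \<in> V} = {x\<in>points X. \<phi> x \<in> W}"
    if "openin (ftop (sub_fspace Y S)) V" for V
    using that S by (fastforce simp: openin_subtopology)
  have O: "openin (ftop X) {x\<in>points X. \<phi> x \<in> V}" if V: "openin (ftop (sub_fspace Y S)) V" for V
    using pre[OF V] morphism_preimage[OF f] by auto
  have "h \<circ> \<phi> \<in> sections X {x\<in>points X. \<phi> x \<in> V}"
    if V: "openin (ftop (sub_fspace Y S)) V" and h: "h \<in> sections (sub_fspace Y S) V" for V h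
  proof (rule sheaf_glue[OF X O[OF V]])
    fix x assume "x \<in> {x\<in>points X. \<phi> x \<in> V}"
    then have x: "x \<in> points X" "\<phi> x \<in> V" by auto
    then obtain W g where W: "openin (ftop Y) W" "\<phi> x \<in> W" "g \<in> sections Y W" "\<forall>y\<in>V \<inter> W. h y = g y"
      using h unfolding sections_sub by meson
    let ?T = "{x\<in>points X. \<phi> x \<in> V} \<inter> {x\<in>points X. \<phi> x \<in> W}"
    have T: "openin (ftop X) ?T" using O[OF V] morphism_preimage[OF f W(1)] by blast
    have "g \<circ> \<phi> \<in> sections X ?T"
      by (rule sheaf_restrict[OF X morphism_preimage[OF f W(1)] morphism_pullback[OF f W(1,3)] T]) auto
    then have "h \<circ> \<phi> \<in> sections X ?T"
      by (rule sheaf_cong[OF X T]) (use W in auto)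
    then show "\<exists>T. openin (ftop X) T \<and> x \<in> T \<and> T \<subseteq> {x\<in>points X. \<phi> x \<in> V} \<and> h \<circ> \<phi> \<in> sections X T"
      using T x W by (intro exI[of _ ?T]) auto
  qed
  then show ?thesis
    using O S morphism_image[OF f] unfolding morphism_regular_on regular_on_def by auto
qed

text \<open>The projective coordinates of a Schubert variety extend only to an open neighbourhood in
  the Grassmannian, so the restriction to \<open>S\<close> starts from a map defined near
  \<open>S\<close>.\<close>

lemma regular_on_sub:
  assumes X: "function_sheaf X" and f: "regular_on X Y U \<phi>" and S: "S \<subseteq> U"
  shows "morphism (sub_fspace X S) Y \<phi>"
proof -
  have p: "points (sub_fspace X S) = S"
    using S openin_subset[OF regular_on_open[OF f]] by auto
  have s: "{x\<in>S. \<phi> x \<in> V} = {x\<in>U. \<phi> x \<in> V} \<inter> S" for V using S by auto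
  show ?thesis
    unfolding morphism_regular_on regular_on_def p
  proof (intro conjI allI impI)
    show "openin (ftop (sub_fspace X S)) S"
      using p openin_topspace[of "ftop (sub_fspace X S)"] by metis
    show "\<phi> ` S \<subseteq> points Y" using regular_on_image[OF f] S by auto
    fix V assume V: "openin (ftop Y) V"
    show "openin (ftop (sub_fspace X S)) {x\<in>S. \<phi> x \<in> V}"
      using regular_on_preimage[OF f V] unfolding s by (auto simp: openin_subtopology)
    fix h assume "h \<in> sections Y V"
    then show "h \<circ> \<phi> \<in> sections (sub_fspace X S) {x\<in>S. \<phi> x \<in> V}"
      by (intro sections_sub_restrict[OF X regular_on_preimage[OF f V] regular_on_pullback[OF f V]]) (auto simp: s)
  qed
qed

lemma morphism_sub:
  assumes X: "function_sheaf X" and f: "morphism X Y \<phi>"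
  shows "morphism (sub_fspace X S) Y \<phi>"
proof -
  have p: "points (sub_fspace X S) = points X \<inter> S" by auto
  have s: "{x \<in> points X \<inter> S. \<phi> x \<in> V} = {x\<in>points X. \<phi> x \<in> V} \<inter> S" for V by auto
  show ?thesis
    unfolding morphism_regular_on regular_on_def p
  proof (intro conjI allI impI)
    show "openin (ftop (sub_fspace X S)) (points X \<inter> S)"
      using p openin_topspace[of "ftop (sub_fspace X S)"] by metis
    show "\<phi> ` (points X \<inter> S) \<subseteq> points Y" using morphism_image[OF f] by auto
    fix V assume V: "openin (ftop Y) V"
    show "openin (ftop (sub_fspace X S)) {x\<in>points X \<inter> S. \<phi> x \<in> V}"
      using morphism_preimage[OF f V] unfolding s by (auto simp: openin_subtopology)
    fix h assume "h \<in> sections Y V"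
    then show "h \<circ> \<phi> \<in> sections (sub_fspace X S) {x\<in>points X \<inter> S. \<phi> x \<in> V}"
      by (intro sections_sub_restrict[OF X morphism_preimage[OF f V] morphism_pullback[OF f V]]) (auto simp: s)
  qed
qed

lemma isomorphic_fspaces_trans:
  assumes "isomorphic_fspaces X Y" "isomorphic_fspaces Y Z"
  shows "isomorphic_fspaces X Z"
proof -
  obtain f g where f: "morphism X Y f" "morphism Y X g" "\<forall>x\<in>points X. g (f x) = x" "\<forall>y\<in>points Y. f (g y) = y"
    using assms(1) unfolding isomorphic_fspaces_def by blast
  obtain h k where h: "morphism Y Z h" "morphism Z Y k" "\<forall>x\<in>points Y. k (h x) = x" "\<forall>y\<in>points Z. h (k y) = y"
    using assms(2) unfolding isomorphic_fspaces_def by blast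
  show ?thesis
    unfolding isomorphic_fspaces_def
    using morphism_comp[OF f(1) h(1)] morphism_comp[OF h(2) f(2)] f(3,4) h(3,4)
      morphism_image[OF f(1)] morphism_image[OF h(2)]
    by (intro exI[of _ "h \<circ> f"] exI[of _ "g \<circ> k"]) simp
qed

section \<open>Polynomial functions on affine space\<close>

text \<open>Gaussian elimination, by induction on the equations. Arbitrary index types let it serve
  for every later dimension count, from monomials on a grid to columns of a matrix.\<close>

lemma homogeneous_system:
  fixes a :: "'k \<Rightarrow> 'm \<Rightarrow> 'f :: field"
  assumes "finite M" "finite K" "card M < card K"
  obtains c where "\<exists>k\<in>K. c k \<noteq> 0" "\<And>m. m \<in> M \<Longrightarrow> (\<Sum>k\<in>K. c k * a k m) = 0"
proof -
  have "\<exists>c. (\<exists>k\<in>K. c k \<noteq> 0) \<and> (\<forall>m\<in>M. (\<Sum>k\<in>K. c k * a k m) = 0)"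
    using assms
  proof (induction M arbitrary: K a rule: finite_induct)
    case empty
    then have "K \<noteq> {}" by auto
    then show ?case by (intro exI[of _ "\<lambda>_. 1"]) auto
  next
    case (insert m M)
    show ?case
    proof (cases "\<forall>k\<in>K. a k m = 0")
      case True
      have "card M < card K" using insert by simp
      from insert.IH[OF insert.prems(1) this, of a] obtain c where
        "\<exists>k\<in>K. c k \<noteq> 0" "\<forall>m\<in>M. (\<Sum>k\<in>K. c k * a k m) = 0" by blast
      then show ?thesis using True by (intro exI[of _ c]) auto
    next
      case False
      then obtain k0 where k0: "k0 \<in> K" "a k0 m \<noteq> 0" by blast
      let ?K = "K - {k0}"
      have "card M < card ?K" "finite ?K" using insert k0 by auto
      from insert.IH[OF this(2,1), of "\<lambda>k m'. a k m' - a k m / a k0 m * a k0 m'"] obtain c where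
        c: "\<exists>k\<in>?K. c k \<noteq> 0" "\<forall>m'\<in>M. (\<Sum>k\<in>?K. c k * (a k m' - a k m / a k0 m * a k0 m')) = 0" by blast
      \<comment> \<open>The eliminated unknown \<open>k0\<close> gets the value that solves equation
        \<open>m\<close>.\<close>
      define b where "b = c(k0 := - (\<Sum>k\<in>?K. c k * a k m) / a k0 m)"
      have split: "(\<Sum>k\<in>K. b k * a k m') = b k0 * a k0 m' + (\<Sum>k\<in>?K. c k * a k m')" for m'
        using insert.prems(1) k0(1) by (subst sum.remove[of K k0]) (auto simp: b_def)
      have "(\<Sum>k\<in>K. b k * a k m') = 0" if "m' \<in> M" for m'
      proof -
        have "(\<Sum>k\<in>K. b k * a k m') = (\<Sum>k\<in>?K. c k * (a k m' - a k m / a k0 m * a k0 m'))"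
          unfolding split
          by (simp add: b_def sum_subtractf sum_distrib_left sum_distrib_right sum_divide_distrib algebra_simps)
        then show ?thesis using c(2) that by simp
      qed
      moreover have "(\<Sum>k\<in>K. b k * a k m) = 0"
        unfolding split using k0 by (simp add: b_def)
      moreover have "\<exists>k\<in>K. b k \<noteq> 0" using c(1) by (auto simp: b_def)
      ultimately show ?thesis by (intro exI[of _ b]) auto
    qed
  qed
  then show ?thesis using that by blast
qed

definition coordinate_functions :: "'i set \<Rightarrow> (('i \<Rightarrow> complex) \<Rightarrow> complex) set" where
  "coordinate_functions Y = {(\<lambda>y. y i) | i. i \<in> Y}"

text \<open>All total functions serve as points; indices outside \<open>Y\<close> are invisible to
  the coordinate functions, so this stands for the affine space with coordinates
  \<open>Y\<close>.\<close>

abbreviation affine_space :: "'i set \<Rightarrow> ('i \<Rightarrow> complex) fspace" where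
  "affine_space Y \<equiv> quasi_affine (coordinate_functions Y) UNIV"

text \<open>The degree is bounded in each variable separately, which is what a test on a product
  grid sees, and it is a property of the function, so no polynomial has to be chosen.\<close>

definition coordinate_degree_le :: "nat \<Rightarrow> (('i \<Rightarrow> complex) \<Rightarrow> complex) \<Rightarrow> bool" where
  "coordinate_degree_le D f \<longleftrightarrow> (\<forall>i y. \<exists>p. degree p \<le> D \<and> (\<forall>t. f (y(i := t)) = poly p t))"

lemma coordinate_degree_le_mono:
  "coordinate_degree_le D f \<Longrightarrow> D \<le> E \<Longrightarrow> coordinate_degree_le E f"
  unfolding coordinate_degree_le_def by (meson le_trans)

lemma coordinate_degree_le_const: "coordinate_degree_le D (\<lambda>_. c)"
  unfolding coordinate_degree_le_def by (auto intro: exI[of _ "[:c:]"])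

lemma coordinate_degree_le_add:
  assumes "coordinate_degree_le D f" "coordinate_degree_le D g"
  shows "coordinate_degree_le D (\<lambda>y. f y + g y)"
  unfolding coordinate_degree_le_def
proof (intro allI)
  fix i y
  obtain p q where "degree p \<le> D" "\<forall>t. f (y(i := t)) = poly p t" "degree q \<le> D" "\<forall>t. g (y(i := t)) = poly q t"
    using assms unfolding coordinate_degree_le_def by meson
  then show "\<exists>p. degree p \<le> D \<and> (\<forall>t. f (y(i := t)) + g (y(i := t)) = poly p t)"
    by (intro exI[of _ "p + q"]) (auto intro: degree_add_le)
qed

lemma coordinate_degree_le_mult:
  assumes "coordinate_degree_le D f" "coordinate_degree_le E g"
  shows "coordinate_degree_le (D + E) (\<lambda>y. f y * g y)"
  unfolding coordinate_degree_le_def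
proof (intro allI)
  fix i y
  obtain p q where "degree p \<le> D" "\<forall>t. f (y(i := t)) = poly p t" "degree q \<le> E" "\<forall>t. g (y(i := t)) = poly q t"
    using assms unfolding coordinate_degree_le_def by meson
  then show "\<exists>p. degree p \<le> D + E \<and> (\<forall>t. f (y(i := t)) * g (y(i := t)) = poly p t)"
    by (intro exI[of _ "p * q"]) (auto intro: order_trans[OF degree_mult_le])
qed

lemma coordinate_degree_le_sum:
  "(\<And>k. k \<in> K \<Longrightarrow> coordinate_degree_le D (f k)) \<Longrightarrow> coordinate_degree_le D (\<lambda>y. \<Sum>k\<in>K. f k y)"
  by (induction K rule: infinite_finite_induct)
    (auto intro: coordinate_degree_le_const coordinate_degree_le_add)

lemma coordinate_degree_le_prod:
  "(\<And>k. k \<in> K \<Longrightarrow> coordinate_degree_le D (f k)) \<Longrightarrow> coordinate_degree_le (card K * D) (\<lambda>y. \<Prod>k\<in>K. f k y)"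
proof (induction K rule: infinite_finite_induct)
  case (insert k K)
  then show ?case
    using coordinate_degree_le_mult[of D "f k" "card K * D" "\<lambda>y. \<Prod>k\<in>K. f k y"] by simp
qed (simp_all add: coordinate_degree_le_const)

lemma coordinate_degree_le_power:
  "coordinate_degree_le D f \<Longrightarrow> coordinate_degree_le (n * D) (\<lambda>y. f y ^ n)"
  using coordinate_degree_le_prod[of "{..<n}" D "\<lambda>_. f"] by simp

lemma polyfuns_coordinate_degree:
  "f \<in> polyfuns (coordinate_functions Y) \<Longrightarrow> \<exists>D. coordinate_degree_le D f"
proof (induction rule: polyfuns.induct)
  case (const c)
  then show ?case using coordinate_degree_le_const by blast
next
  case (coord f)
  then obtain j where f: "f = (\<lambda>y. y j)" by (auto simp: coordinate_functions_def)
  have "\<exists>p. degree p \<le> 1 \<and> (\<forall>t. (y(i := t)) j = poly p t)" for i and y :: "'a \<Rightarrow> complex"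
    by (cases "i = j") (auto intro: exI[of _ "[:0, 1:]"] exI[of _ "[:y j:]"])
  then show ?case unfolding f coordinate_degree_le_def by blast
next
  case (add f g)
  then obtain D E where "coordinate_degree_le D f" "coordinate_degree_le E g" by blast
  then show ?case
    using coordinate_degree_le_add[of "max D E" f g] coordinate_degree_le_mono by (metis max.cobounded1 max.cobounded2)
next
  case (mult f g)
  then show ?case using coordinate_degree_le_mult by blast
qed

lemma polyfuns_depends:
  "f \<in> polyfuns (coordinate_functions Y) \<Longrightarrow> (\<And>i. i \<in> Y \<Longrightarrow> y i = z i) \<Longrightarrow> f y = f z"
  by (induction rule: polyfuns.induct) (auto simp: coordinate_functions_def)

text \<open>The coordinates are released from the grid one at a time. In the released coordinate
  \<open>f\<close> is a polynomial of degree at most \<open>D\<close> with the \<open>D + 1\<close>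
  zeros \<open>0, ..., D\<close>.\<close>

lemma vanishing_on_grid:
  assumes Y: "finite Y" and f: "coordinate_degree_le D f"
    and dep: "\<And>y z. (\<And>i. i \<in> Y \<Longrightarrow> y i = z i) \<Longrightarrow> f y = f z"
    and grid: "\<And>y. y \<in> Y \<rightarrow>\<^sub>E (of_nat ` {..D} :: complex set) \<Longrightarrow> f y = 0"
  shows "f y = 0"
proof -
  let ?G = "of_nat ` {..D} :: complex set"
  have "\<forall>y. (\<forall>i\<in>Y - Z. y i \<in> ?G) \<longrightarrow> f y = 0" if "Z \<subseteq> Y" for Z
    using finite_subset[OF that Y] that
  proof (induction Z rule: finite_induct)
    case empty
    show ?case
    proof (intro allI impI)
      fix y assume "\<forall>i\<in>Y - {}. y i \<in> ?G"
      then have "f (restrict y Y) = 0" by (intro grid) auto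
      then show "f y = 0" using dep[of y "restrict y Y"] by simp
    qed
  next
    case (insert j Z)
    show ?case
    proof (intro allI impI)
      fix y assume y: "\<forall>i\<in>Y - insert j Z. y i \<in> ?G"
      obtain p where p: "degree p \<le> D" "\<forall>t. f (y(j := t)) = poly p t"
        using f unfolding coordinate_degree_le_def by meson
      have z: "poly p t = 0" if "t \<in> ?G" for t
      proof -
        have "\<forall>i\<in>Y - Z. (y(j := t)) i \<in> ?G" using y that by auto
        then have "f (y(j := t)) = 0" using insert.IH insert.prems by blast
        then show ?thesis using p(2) by simp
      qed
      have "p = 0"
      proof (rule ccontr)
        assume p0: "p \<noteq> 0"
        have "card ?G = Suc D" by (subst card_image) (auto simp: inj_on_def)
        moreover have "card ?G \<le> card {t. poly p t = 0}"
          using z by (intro card_mono poly_roots_finite p0) auto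
        moreover have "card {t. poly p t = 0} \<le> degree p"
          using p0 by (rule card_poly_roots_bound)
        ultimately show False using p(1) by simp
      qed
      then show "f y = 0" using p(2)[rule_format, of "y j"] by simp
    qed
  qed
  from this[of Y] show ?thesis by auto
qed

text \<open>
  For large \<open>N\<close> there are more monomials \<open>\<Prod>j<k. (g j / h)^(\<alpha> j)\<close> with exponents at most \<open>N\<close> than
  grid points on which a polynomial of their degree has to be tested.
\<close>

lemma algebraic_relation:
  assumes Y: "finite Y" and k: "card Y < k"
    and g: "\<And>j. j < k \<Longrightarrow> g j \<in> polyfuns (coordinate_functions Y)" and h: "h \<in> polyfuns (coordinate_functions Y)"
  obtains N and c :: "(nat \<Rightarrow> nat) \<Rightarrow> complex" where
    "\<exists>\<alpha>\<in>{0..<k} \<rightarrow>\<^sub>E {..N}. c \<alpha> \<noteq> 0"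
    "\<And>y. h y \<noteq> 0 \<Longrightarrow> (\<Sum>\<alpha>\<in>{0..<k} \<rightarrow>\<^sub>E {..N}. c \<alpha> * (\<Prod>j\<in>{0..<k}. (g j y / h y) ^ \<alpha> j)) = 0"
proof -
  let ?C = "coordinate_functions Y"
  have "\<exists>D. \<forall>j<k. coordinate_degree_le D (g j)"
  proof -
    have "\<exists>D. \<forall>j<l. coordinate_degree_le D (g j)" if "l \<le> k" for l
      using that
    proof (induction l)
      case (Suc l)
      then obtain D where D: "\<forall>j<l. coordinate_degree_le D (g j)" by auto
      obtain E where E: "coordinate_degree_le E (g l)" using polyfuns_coordinate_degree g Suc by (metis Suc_le_lessD)
      have "coordinate_degree_le (max D E) (g j)" if "j < Suc l" for j
        using D E that coordinate_degree_le_mono[of D "g j" "max D E"] coordinate_degree_le_mono[of E "g l" "max D E"]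
        by (cases "j = l") auto
      then show ?case by blast
    qed simp
    then show ?thesis by blast
  qed
  then obtain D1 where D1: "\<And>j. j < k \<Longrightarrow> coordinate_degree_le D1 (g j)" by blast
  obtain D2 where D2: "coordinate_degree_le D2 h" using polyfuns_coordinate_degree h by blast
  define D where "D = max D1 D2"
  have Dg: "coordinate_degree_le D (g j)" if "j < k" for j
    using D1[OF that] by (rule coordinate_degree_le_mono) (simp add: D_def)
  have Dh: "coordinate_degree_le D h"
    using D2 by (rule coordinate_degree_le_mono) (simp add: D_def)
  let ?r = "card Y"
  \<comment> \<open>With \<open>r = card Y\<close>, the grid below has at most
    \<open>((k * D + 1) * (N + 1)) ^ r\<close> points. This choice of \<open>N\<close> turns the
    bound into \<open>N * (N + 1) ^ r\<close>, just below the \<open>(N + 1) ^ Suc r\<close>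
    monomials guaranteed by \<open>r < k\<close>.\<close>
  define N where "N = (k * D + 1) ^ ?r"
  define M where "M = k * (N * D)"
  let ?K = "{0..<k} \<rightarrow>\<^sub>E {..N}"
  let ?G = "Y \<rightarrow>\<^sub>E (of_nat ` {..M} :: complex set)"
  \<comment> \<open>The monomial in the fractions \<open>g j / h\<close>, multiplied by
    \<open>h ^ (k * N)\<close> to clear all denominators at once.\<close>
  define \<Phi> where "\<Phi> \<alpha> y = (\<Prod>j\<in>{0..<k}. g j y ^ \<alpha> j * h y ^ (N - \<alpha> j))" for \<alpha> y
  have finK: "finite ?K" by (intro finite_PiE) auto
  have finG: "finite ?G" using Y by (intro finite_PiE) auto
  have "card ?G = (M + 1) ^ ?r"
    using Y by (simp add: card_PiE card_image inj_on_def)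
  also have "\<dots> \<le> ((k * D + 1) * (N + 1)) ^ ?r"
    by (intro power_mono) (auto simp: M_def algebra_simps)
  also have "\<dots> = N * (N + 1) ^ ?r" unfolding power_mult_distrib N_def ..
  also have "\<dots> < (N + 1) * (N + 1) ^ ?r" by simp
  also have "\<dots> = (N + 1) ^ Suc ?r" by simp
  also have "\<dots> \<le> (N + 1) ^ k" using k by (intro power_increasing) auto
  also have "\<dots> = card ?K" by (simp add: card_PiE)
  finally have lt: "card ?G < card ?K" .
  obtain c where c: "\<exists>\<alpha>\<in>?K. c \<alpha> \<noteq> 0" "\<And>y. y \<in> ?G \<Longrightarrow> (\<Sum>\<alpha>\<in>?K. c \<alpha> * \<Phi> \<alpha> y) = 0"
    using homogeneous_system[OF finG finK lt, of \<Phi>] by blast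
  have deg: "coordinate_degree_le M (\<lambda>y. c \<alpha> * \<Phi> \<alpha> y)" if a: "\<alpha> \<in> ?K" for \<alpha>
  proof -
    have "coordinate_degree_le (N * D) (\<lambda>y. g j y ^ \<alpha> j * h y ^ (N - \<alpha> j))" if j: "j \<in> {0..<k}" for j
    proof -
      have "\<alpha> j \<le> N" using a j by auto
      then have "\<alpha> j * D + (N - \<alpha> j) * D = N * D" by (simp flip: add_mult_distrib)
      moreover have "coordinate_degree_le (\<alpha> j * D + (N - \<alpha> j) * D) (\<lambda>y. g j y ^ \<alpha> j * h y ^ (N - \<alpha> j))"
        by (intro coordinate_degree_le_mult coordinate_degree_le_power Dg Dh) (use j in auto)
      ultimately show ?thesis by simp
    qed
    then have "coordinate_degree_le (card {0..<k} * (N * D)) (\<Phi> \<alpha>)"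
      unfolding \<Phi>_def[abs_def] by (rule coordinate_degree_le_prod)
    then have "coordinate_degree_le (0 + card {0..<k} * (N * D)) (\<lambda>y. c \<alpha> * \<Phi> \<alpha> y)"
      by (intro coordinate_degree_le_mult coordinate_degree_le_const)
    then show ?thesis by (simp add: M_def)
  qed
  have zero: "(\<Sum>\<alpha>\<in>?K. c \<alpha> * \<Phi> \<alpha> y) = 0" for y
  proof (rule vanishing_on_grid[OF Y, where D = M and y = y and f = "\<lambda>y. \<Sum>\<alpha>\<in>?K. c \<alpha> * \<Phi> \<alpha> y"])
    show "coordinate_degree_le M (\<lambda>y. \<Sum>\<alpha>\<in>?K. c \<alpha> * \<Phi> \<alpha> y)"
      by (intro coordinate_degree_le_sum deg)
    fix y z :: "'a \<Rightarrow> complex" assume yz: "\<And>i. i \<in> Y \<Longrightarrow> y i = z i"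
    have "g j y = g j z" if "j < k" for j by (rule polyfuns_depends[OF g[OF that] yz])
    moreover have "h y = h z" by (rule polyfuns_depends[OF h yz])
    ultimately have "\<Phi> \<alpha> y = \<Phi> \<alpha> z" for \<alpha> unfolding \<Phi>_def by (intro prod.cong) auto
    then show "(\<Sum>\<alpha>\<in>?K. c \<alpha> * \<Phi> \<alpha> y) = (\<Sum>\<alpha>\<in>?K. c \<alpha> * \<Phi> \<alpha> z)" by simp
  qed (rule c(2))
  have "(\<Sum>\<alpha>\<in>?K. c \<alpha> * (\<Prod>j\<in>{0..<k}. (g j y / h y) ^ \<alpha> j)) = 0" if hy: "h y \<noteq> 0" for y
  proof -
    have "\<Phi> \<alpha> y = h y ^ (k * N) * (\<Prod>j\<in>{0..<k}. (g j y / h y) ^ \<alpha> j)" if a: "\<alpha> \<in> ?K" for \<alpha>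
    proof -
      have "\<Phi> \<alpha> y = (\<Prod>j\<in>{0..<k}. h y ^ N * (g j y / h y) ^ \<alpha> j)"
        unfolding \<Phi>_def
      proof (rule prod.cong)
        fix j assume "j \<in> {0..<k}"
        then have "\<alpha> j \<le> N" using a by auto
        then have "h y ^ N = h y ^ (N - \<alpha> j) * h y ^ \<alpha> j" by (simp flip: power_add)
        then show "g j y ^ \<alpha> j * h y ^ (N - \<alpha> j) = h y ^ N * (g j y / h y) ^ \<alpha> j"
          using hy by (simp add: power_divide)
      qed simp
      then show ?thesis by (simp add: prod.distrib power_mult mult.commute)
    qed
    then have "h y ^ (k * N) * (\<Sum>\<alpha>\<in>?K. c \<alpha> * (\<Prod>j\<in>{0..<k}. (g j y / h y) ^ \<alpha> j)) = (\<Sum>\<alpha>\<in>?K. c \<alpha> * \<Phi> \<alpha> y)"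
      unfolding sum_distrib_left by (intro sum.cong) (auto simp: mult.left_commute)
    then show ?thesis using zero hy by simp
  qed
  with c(1) show ?thesis by (rule that)
qed

text \<open>Join a point of \<open>U\<close> to a point of \<open>V\<close> by a line. The two
  defining polynomials restrict to nonzero polynomials in one variable, whose product has a nonzero
  value somewhere on the line.\<close>

lemma affine_space_irreducible:
  assumes U: "openin (zariski (coordinate_functions Y) UNIV) U" "U \<noteq> {}"
    and V: "openin (zariski (coordinate_functions Y) UNIV) V" "V \<noteq> {}"
  shows "U \<inter> V \<noteq> {}"
proof -
  let ?P = "polyfuns (coordinate_functions Y)"
  obtain F G where F: "F \<subseteq> ?P" "U = {x\<in>UNIV. \<exists>f\<in>F. f x \<noteq> 0}" and G: "G \<subseteq> ?P" "V = {x\<in>UNIV. \<exists>f\<in>G. f x \<noteq> 0}"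
    using U(1) V(1) unfolding openin_zariski by auto
  obtain f g x y where f: "f \<in> ?P" "f x \<noteq> 0" "f \<in> F" and g: "g \<in> ?P" "g y \<noteq> 0" "g \<in> G"
    using U(2) V(2) F G by blast
  define l where "l t = (\<lambda>i. x i + t * (y i - x i))" for t
  have poly: "\<exists>p. \<forall>t. f (l t) = poly p t" if "f \<in> ?P" for f
    using that
  proof (induction rule: polyfuns.induct)
    case (const c)
    then show ?case by (intro exI[of _ "[:c:]"]) simp
  next
    case (coord f)
    then obtain i where "f = (\<lambda>y. y i)" by (auto simp: coordinate_functions_def)
    then show ?case by (intro exI[of _ "[:x i, y i - x i:]"]) (simp add: l_def)
  next
    case (add f g)
    then show ?case by (metis poly_add)
  next
    case (mult f g)
    then show ?case by (metis poly_mult)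
  qed
  obtain p q where p: "\<forall>t. f (l t) = poly p t" and q: "\<forall>t. g (l t) = poly q t"
    using poly f(1) g(1) by meson
  have "l 0 = x" "l 1 = y" by (auto simp: l_def)
  then have "p \<noteq> 0" "q \<noteq> 0" using p q f g by (metis poly_0)+
  then have "p * q \<noteq> 0" by simp
  then obtain t where "poly (p * q) t \<noteq> 0" using poly_all_0_iff_0 by blast
  then have "f (l t) \<noteq> 0" "g (l t) \<noteq> 0" using p q by auto
  then have "l t \<in> U \<inter> V" unfolding F(2) G(2) using f(3) g(3) by blast
  then show ?thesis by blast
qed


section \<open>Local rings\<close>

text \<open>Representatives of the germs at \<open>x\<close>. Arguments about the stalk are carried
  out on them, away from the set-valued ring operations.\<close>

definition local_functions :: "'a fspace \<Rightarrow> 'a \<Rightarrow> ('a \<Rightarrow> complex) set" where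
  "local_functions X x = {f. \<exists>U. openin (ftop X) U \<and> x \<in> U \<and> f \<in> sections X U}"

lemma carrier_stalk: "carrier (stalk X x) = germ X x ` local_functions X x"
  unfolding stalk_def local_functions_def by auto

lemma
  assumes X: "function_sheaf X"
  shows local_functions_const: "x \<in> points X \<Longrightarrow> (\<lambda>_. c) \<in> local_functions X x"
    and local_functions_add: "f \<in> local_functions X x \<Longrightarrow> g \<in> local_functions X x \<Longrightarrow>
      (\<lambda>y. f y + g y) \<in> local_functions X x"
    and local_functions_mult: "f \<in> local_functions X x \<Longrightarrow> g \<in> local_functions X x \<Longrightarrow>
      (\<lambda>y. f y * g y) \<in> local_functions X x"
proof -
  show "(\<lambda>_. c) \<in> local_functions X x" if "x \<in> points X"
    unfolding local_functions_def using that sheaf_const[OF X openin_topspace] by blast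
  assume "f \<in> local_functions X x" "g \<in> local_functions X x"
  then obtain U V where U: "openin (ftop X) U" "x \<in> U" "f \<in> sections X U"
    and V: "openin (ftop X) V" "x \<in> V" "g \<in> sections X V"
    unfolding local_functions_def by blast
  have UV: "openin (ftop X) (U \<inter> V)" "x \<in> U \<inter> V" using U V by auto
  have "f \<in> sections X (U \<inter> V)" "g \<in> sections X (U \<inter> V)"
    using sheaf_restrict[OF X U(1,3) UV(1)] sheaf_restrict[OF X V(1,3) UV(1)] by auto
  then show "(\<lambda>y. f y + g y) \<in> local_functions X x" "(\<lambda>y. f y * g y) \<in> local_functions X x"
    unfolding local_functions_def using UV sheaf_add[OF X UV(1)] sheaf_mult[OF X UV(1)] by blast+
qed

text \<open>Pulled back to affine space and brought to a common denominator near a point, the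
  sections satisfy an algebraic relation there. The set where the relation fails is open; by
  irreducibility its preimage is empty, and by density so is the set itself.\<close>

lemma relation_of_sections:
  assumes X: "function_sheaf X" and Y: "finite Y" and \<phi>: "morphism (affine_space Y) X \<phi>"
    and dense: "ftop X closure_of range \<phi> = points X"
    and k: "card Y < k" and U: "openin (ftop X) U" "U \<noteq> {}"
    and f: "\<And>j. j < k \<Longrightarrow> f j \<in> sections X U"
  obtains N and c :: "(nat \<Rightarrow> nat) \<Rightarrow> complex" where
    "\<exists>\<alpha>\<in>{0..<k} \<rightarrow>\<^sub>E {..N}. c \<alpha> \<noteq> 0"
    "\<And>y. y \<in> U \<Longrightarrow> (\<Sum>\<alpha>\<in>{0..<k} \<rightarrow>\<^sub>E {..N}. c \<alpha> * (\<Prod>j\<in>{0..<k}. f j y ^ \<alpha> j)) = 0"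
proof -
  let ?C = "coordinate_functions Y"
  let ?O = "openin (zariski ?C UNIV)"
  have hit: "\<exists>y. \<phi> y \<in> T" if T: "openin (ftop X) T" "T \<noteq> {}" for T
  proof -
    obtain x where "x \<in> T" "x \<in> points X" using T(2) openin_subset[OF T(1)] by blast
    then have "x \<in> ftop X closure_of range \<phi>" using dense by simp
    then show ?thesis unfolding in_closure_of using \<open>x \<in> T\<close> T(1) by blast
  qed
  have pre: "?O {y. \<phi> y \<in> T}" if "openin (ftop X) T" for T
    using morphism_preimage[OF \<phi> that] by simp
  let ?W = "{y. \<phi> y \<in> U}"
  obtain y0 where y0: "y0 \<in> ?W" using hit[OF U] by auto
  define frac where "frac j V g h \<longleftrightarrow> ?O V \<and> y0 \<in> V \<and> g \<in> polyfuns ?C \<and> h \<in> polyfuns ?C \<and>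
      (\<forall>y\<in>?W \<inter> V. h y \<noteq> 0 \<and> f j (\<phi> y) = g y / h y)" for j V g h
  have "\<exists>V g h. frac j V g h" if "j < k" for j
  proof -
    have "f j \<circ> \<phi> \<in> sections (affine_space Y) ?W"
      using morphism_pullback[OF \<phi> U(1) f[OF that]] by simp
    then show ?thesis using y0 unfolding sections_quasi_affine frac_def by simp
  qed
  then obtain V g h where frac: "\<And>j. j < k \<Longrightarrow> frac j (V j) (g j) (h j)" by metis
  have V: "\<And>j. j < k \<Longrightarrow> ?O (V j)" "\<And>j. j < k \<Longrightarrow> y0 \<in> V j"
    and g: "\<And>j. j < k \<Longrightarrow> g j \<in> polyfuns ?C" and h: "\<And>j. j < k \<Longrightarrow> h j \<in> polyfuns ?C"
    and eq: "\<And>j y. j < k \<Longrightarrow> y \<in> ?W \<inter> V j \<Longrightarrow> h j y \<noteq> 0 \<and> f j (\<phi> y) = g j y / h j y"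
    using frac unfolding frac_def by auto
  define H where "H y = (\<Prod>j<k. h j y)" for y
  define G where "G j y = g j y * (\<Prod>i\<in>{..<k} - {j}. h i y)" for j y
  have HP: "H \<in> polyfuns ?C" unfolding H_def[abs_def] by (intro polyfuns_prod h) auto
  have GP: "G j \<in> polyfuns ?C" if "j < k" for j
    unfolding G_def[abs_def] by (intro polyfuns.mult polyfuns_prod g h) (use that in auto)
  obtain N and c :: "(nat \<Rightarrow> nat) \<Rightarrow> complex" where c: "\<exists>\<alpha>\<in>{0..<k} \<rightarrow>\<^sub>E {..N}. c \<alpha> \<noteq> 0"
    and rel: "\<And>y. H y \<noteq> 0 \<Longrightarrow> (\<Sum>\<alpha>\<in>{0..<k} \<rightarrow>\<^sub>E {..N}. c \<alpha> * (\<Prod>j\<in>{0..<k}. (G j y / H y) ^ \<alpha> j)) = 0"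
    using algebraic_relation[where g = G and h = H, OF Y k GP HP] by blast
  define R where "R y = (\<Sum>\<alpha>\<in>{0..<k} \<rightarrow>\<^sub>E {..N}. c \<alpha> * (\<Prod>j\<in>{0..<k}. f j y ^ \<alpha> j))" for y
  have R: "R \<in> sections X U"
    unfolding R_def[abs_def]
    by (intro sheaf_sum[OF X U(1)] sheaf_mult[OF X U(1)] sheaf_const[OF X U(1)] sheaf_prod[OF X U(1)]
        sheaf_power[OF X U(1)] f) auto
  let ?T = "{y\<in>U. R y \<noteq> 0}"
  have T: "openin (ftop X) ?T" by (rule sheaf_nonzero[OF X U(1) R])
  let ?V = "?W \<inter> (\<Inter>j\<in>{..<k}. V j)"
  have "?O ?V"
    using V(1) pre[OF U(1)] k by (intro openin_Int openin_Inter) auto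
  moreover have "y0 \<in> ?V" using y0 V(2) by auto
  moreover have "R (\<phi> y) = 0" if y: "y \<in> ?V" for y
  proof -
    have hn: "h j y \<noteq> 0" "f j (\<phi> y) = g j y / h j y" if "j < k" for j
      using eq[OF that, of y] y that by auto
    then have H0: "H y \<noteq> 0" unfolding H_def by auto
    have "f j (\<phi> y) = G j y / H y" if "j < k" for j
    proof -
      have "H y = h j y * (\<Prod>i\<in>{..<k} - {j}. h i y)"
        unfolding H_def using that by (subst prod.remove[of _ j]) auto
      then show ?thesis using hn[OF that] H0 unfolding G_def by (simp add: field_simps)
    qed
    then have "R (\<phi> y) = (\<Sum>\<alpha>\<in>{0..<k} \<rightarrow>\<^sub>E {..N}. c \<alpha> * (\<Prod>j\<in>{0..<k}. (G j y / H y) ^ \<alpha> j))"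
      unfolding R_def by (intro sum.cong arg_cong2[where f="(*)"] prod.cong) auto
    then show ?thesis using rel[OF H0] by simp
  qed
  ultimately have "{y. \<phi> y \<in> ?T} = {}"
    using affine_space_irreducible[OF _ _ pre[OF T], of ?V] by blast
  then have "?T = {}" using hit[OF T] by blast
  then have "R y = 0" if "y \<in> U" for y using that by blast
  with c show ?thesis unfolding R_def by (rule that)
qed

text \<open>
  If \<open>x s\<close> lies in \<open>Q (Suc s)\<close> but not in \<open>Q s\<close>, then a relation in \<open>x s, x (Suc s), \<dots>\<close> modulo \<open>Q s\<close>
  can be divided by the lowest power of \<open>x s\<close>, and its lowest coefficient is a relation in
  \<open>x (Suc s), \<dots>\<close> modulo \<open>Q (Suc s)\<close>.
\<close>

lemma no_relation_along_prime_chain: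
  fixes L :: "('a \<Rightarrow> complex) set" and Q :: "nat \<Rightarrow> ('a \<Rightarrow> complex) set"
  assumes Lc: "\<And>c. (\<lambda>_. c) \<in> L"
    and La: "\<And>f g. f \<in> L \<Longrightarrow> g \<in> L \<Longrightarrow> (\<lambda>y. f y + g y) \<in> L"
    and Lm: "\<And>f g. f \<in> L \<Longrightarrow> g \<in> L \<Longrightarrow> (\<lambda>y. f y * g y) \<in> L"
    and QL: "\<And>i. i \<le> k \<Longrightarrow> Q i \<subseteq> L"
    and Qa: "\<And>i f g. i \<le> k \<Longrightarrow> f \<in> Q i \<Longrightarrow> g \<in> Q i \<Longrightarrow> (\<lambda>y. f y + g y) \<in> Q i"
    and Qm: "\<And>i f g. i \<le> k \<Longrightarrow> f \<in> L \<Longrightarrow> g \<in> Q i \<Longrightarrow> (\<lambda>y. f y * g y) \<in> Q i"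
    and Qp: "\<And>i f g. i \<le> k \<Longrightarrow> f \<in> L \<Longrightarrow> g \<in> L \<Longrightarrow> (\<lambda>y. f y * g y) \<in> Q i \<Longrightarrow> f \<in> Q i \<or> g \<in> Q i"
    and Q1: "\<And>i. i \<le> k \<Longrightarrow> (\<lambda>_. 1) \<notin> Q i"
    and chain: "\<And>i. i < k \<Longrightarrow> Q i \<subseteq> Q (Suc i)"
    and x: "\<And>i. i < k \<Longrightarrow> x i \<in> Q (Suc i)" "\<And>i. i < k \<Longrightarrow> x i \<notin> Q i"
    and c: "\<exists>\<alpha>\<in>{0..<k} \<rightarrow>\<^sub>E {..N}. c \<alpha> \<noteq> 0"
    and rel: "(\<lambda>y. \<Sum>\<alpha>\<in>{0..<k} \<rightarrow>\<^sub>E {..N}. c \<alpha> * (\<Prod>j\<in>{0..<k}. x j y ^ \<alpha> j)) \<in> Q 0"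
  shows False
proof -
  define P where "P s c = (\<lambda>y. \<Sum>\<alpha>\<in>{s..<k} \<rightarrow>\<^sub>E {..N}. c \<alpha> * (\<Prod>j\<in>{s..<k}. x j y ^ \<alpha> j))"
    for s and c :: "(nat \<Rightarrow> nat) \<Rightarrow> complex"
  have xL: "x i \<in> L" if "i < k" for i using x(1)[OF that] QL[of "Suc i"] that by auto
  have Lsum: "(\<lambda>y. \<Sum>i\<in>I. f i y) \<in> L" if "\<And>i. i \<in> I \<Longrightarrow> f i \<in> L" for I :: "(nat \<Rightarrow> nat) set" and f
    using that by (induction I rule: infinite_finite_induct) (auto intro: Lc La)
  have Lprod: "(\<lambda>y. \<Prod>i\<in>I. f i y) \<in> L" if "\<And>i. i \<in> I \<Longrightarrow> f i \<in> L" for I :: "nat set" and f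
    using that by (induction I rule: infinite_finite_induct) (auto intro: Lc Lm)
  have Lsum': "(\<lambda>y. \<Sum>i\<in>I. f i y) \<in> L" if "\<And>i. i \<in> I \<Longrightarrow> f i \<in> L" for I :: "nat set" and f
    using that by (induction I rule: infinite_finite_induct) (auto intro: Lc La)
  have Lpow: "(\<lambda>y. f y ^ n) \<in> L" if "f \<in> L" for f and n :: nat
    using that by (induction n) (auto intro: Lc Lm)
  have PL: "P s c \<in> L" for s c
  proof -
    have "(\<lambda>y. c \<alpha> * (\<Prod>j\<in>{s..<k}. x j y ^ \<alpha> j)) \<in> L" for \<alpha>
      by (intro Lm Lc Lprod Lpow xL) auto
    then show ?thesis unfolding P_def by (rule Lsum)
  qed
  \<comment> \<open>The exponent of the variable \<open>x s\<close> is split off, leaving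
    coefficients that involve only the later variables.\<close>
  have rec: "P s c = (\<lambda>y. \<Sum>e\<in>{..N}. x s y ^ e * P (Suc s) (\<lambda>\<alpha>. c (\<alpha>(s := e))) y)" if "s < k" for s c
  proof
    fix y
    let ?A = "{Suc s..<k} \<rightarrow>\<^sub>E {..N}"
    have ins: "{s..<k} = insert s {Suc s..<k}" using that by auto
    have img: "{s..<k} \<rightarrow>\<^sub>E {..N} = (\<lambda>(e, \<alpha>). \<alpha>(s := e)) ` ({..N} \<times> ?A)"
      unfolding ins PiE_insert_eq ..
    have inj: "inj_on (\<lambda>(e, \<alpha>). \<alpha>(s := e)) ({..N} \<times> ?A)"
      by (rule inj_combinator) simp
    have "P s c y = (\<Sum>(e, \<alpha>)\<in>{..N} \<times> ?A. c (\<alpha>(s := e)) * (\<Prod>j\<in>{s..<k}. x j y ^ (\<alpha>(s := e)) j))"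
      unfolding P_def img by (subst sum.reindex[OF inj]) (auto intro!: sum.cong)
    also have "\<dots> = (\<Sum>(e, \<alpha>)\<in>{..N} \<times> ?A. x s y ^ e * (c (\<alpha>(s := e)) * (\<Prod>j\<in>{Suc s..<k}. x j y ^ \<alpha> j)))"
    proof -
      have "(\<Prod>j\<in>{s..<k}. x j y ^ (\<alpha>(s := e)) j) = x s y ^ e * (\<Prod>j\<in>{Suc s..<k}. x j y ^ \<alpha> j)" for e \<alpha>
        unfolding ins by (subst prod.insert) (auto intro!: prod.cong)
      then show ?thesis by (simp add: ac_simps)
    qed
    also have "\<dots> = (\<Sum>e\<in>{..N}. x s y ^ e * P (Suc s) (\<lambda>\<alpha>. c (\<alpha>(s := e))) y)"
      unfolding P_def sum_distrib_left by (subst sum.cartesian_product) simp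
    finally show "P s c y = (\<Sum>e\<in>{..N}. x s y ^ e * P (Suc s) (\<lambda>\<alpha>. c (\<alpha>(s := e))) y)" .
  qed
  have "\<exists>c. (\<exists>\<alpha>\<in>{s..<k} \<rightarrow>\<^sub>E {..N}. c \<alpha> \<noteq> 0) \<and> P s c \<in> Q s" if "s \<le> k" for s
    using that
  proof (induction s)
    case 0
    then show ?case using c rel unfolding P_def by blast
  next
    case (Suc s)
    then have s: "s < k" by simp
    from Suc obtain c where c: "\<exists>\<alpha>\<in>{s..<k} \<rightarrow>\<^sub>E {..N}. c \<alpha> \<noteq> 0" "P s c \<in> Q s" by auto
    define G where "G e = P (Suc s) (\<lambda>\<alpha>. c (\<alpha>(s := e)))" for e
    let ?nz = "\<lambda>e. e \<le> N \<and> (\<exists>\<alpha>\<in>{Suc s..<k} \<rightarrow>\<^sub>E {..N}. c (\<alpha>(s := e)) \<noteq> 0)"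
    have "\<exists>e. ?nz e"
    proof -
      have ins: "{s..<k} = insert s {Suc s..<k}" using s by auto
      obtain \<alpha> where "\<alpha> \<in> {s..<k} \<rightarrow>\<^sub>E {..N}" "c \<alpha> \<noteq> 0" using c by blast
      then obtain e \<beta> where "e \<le> N" "\<beta> \<in> {Suc s..<k} \<rightarrow>\<^sub>E {..N}" "\<alpha> = \<beta>(s := e)"
        unfolding ins PiE_insert_eq by auto
      then show ?thesis using \<open>c \<alpha> \<noteq> 0\<close> by blast
    qed
    then obtain e0 where e0: "?nz e0" "\<And>e. e < e0 \<Longrightarrow> \<not> ?nz e"
      using exists_least_iff[of ?nz] by blast
    have G0: "G e = (\<lambda>_. 0)" if "e < e0" for e
    proof -
      have "e \<le> N" using that e0(1) by simp
      then have "\<And>\<alpha>. \<alpha> \<in> {Suc s..<k} \<rightarrow>\<^sub>E {..N} \<Longrightarrow> c (\<alpha>(s := e)) = 0" using e0(2)[OF that] by blast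
      then show ?thesis unfolding G_def P_def by (intro ext sum.neutral) auto
    qed
    define T where "T = (\<lambda>y. \<Sum>e\<in>{e0..N}. x s y ^ (e - e0) * G e y)"
    define R where "R = (\<lambda>y. \<Sum>e\<in>{Suc e0..N}. x s y ^ (e - Suc e0) * G e y)"
    have GL: "G e \<in> L" for e unfolding G_def by (rule PL)
    have TL: "T \<in> L" unfolding T_def by (intro Lsum' Lm Lpow xL s GL)
    have RL: "R \<in> L" unfolding R_def by (intro Lsum' Lm Lpow xL s GL)
    have PT: "P s c = (\<lambda>y. x s y ^ e0 * T y)"
    proof
      fix y
      have "P s c y = (\<Sum>e\<in>{..N}. x s y ^ e * G e y)" using rec[OF s, of c] unfolding G_def by metis
      also have "\<dots> = (\<Sum>e\<in>{e0..N}. x s y ^ e * G e y)"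
      proof (rule sum.mono_neutral_right)
        show "\<forall>e\<in>{..N} - {e0..N}. x s y ^ e * G e y = 0" using G0 by force
      qed auto
      also have "\<dots> = x s y ^ e0 * T y"
        unfolding T_def sum_distrib_left
        by (intro sum.cong) (auto simp flip: power_add simp: mult.assoc[symmetric])
      finally show "P s c y = x s y ^ e0 * T y" .
    qed
    \<comment> \<open>No power of \<open>x s\<close> lies in the prime \<open>Q s\<close>, so the
      power factored out of the relation can be cancelled modulo \<open>Q s\<close>.\<close>
    have pow: "(\<lambda>y. x s y ^ n) \<notin> Q s" for n
    proof (induction n)
      case 0
      then show ?case using Q1[of s] s by simp
    next
      case (Suc n)
      then show ?case using Qp[of s "x s" "\<lambda>y. x s y ^ n"] xL[OF s] Lpow[of "x s" n] x(2)[OF s] s by auto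
    qed
    have "T \<in> Q s"
      using Qp[of s "\<lambda>y. x s y ^ e0" T] c(2) pow[of e0] Lpow[OF xL[OF s]] TL s unfolding PT by auto
    then have T: "T \<in> Q (Suc s)" using chain[OF s] by auto
    have xR: "(\<lambda>y. R y * x s y) \<in> Q (Suc s)" using Qm[of "Suc s" R "x s"] RL x(1)[OF s] Suc.prems by auto
    have "(\<lambda>y. T y + (- 1) * (R y * x s y)) \<in> Q (Suc s)"
      using Qa[OF Suc.prems T Qm[OF Suc.prems Lc xR, of "-1"]] .
    \<comment> \<open>Modulo \<open>x s\<close>, which lies in the next prime, the cancelled
      relation reduces to its lowest coefficient.\<close>
    moreover have "(\<lambda>y. T y + (- 1) * (R y * x s y)) = G e0"
    proof
      fix y
      have "T y = G e0 y + (\<Sum>e\<in>{Suc e0..N}. x s y ^ (e - e0) * G e y)"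
        unfolding T_def using e0(1) by (simp add: sum.atLeast_Suc_atMost)
      also have "(\<Sum>e\<in>{Suc e0..N}. x s y ^ (e - e0) * G e y) = R y * x s y"
        unfolding R_def sum_distrib_right
      proof (rule sum.cong)
        fix e assume "e \<in> {Suc e0..N}"
        then have "e - e0 = Suc (e - Suc e0)" by auto
        then show "x s y ^ (e - e0) * G e y = x s y ^ (e - Suc e0) * G e y * x s y" by simp
      qed simp
      finally show "T y + (- 1) * (R y * x s y) = G e0 y" by simp
    qed
    ultimately show ?case using e0(1) unfolding G_def by (intro exI[of _ "\<lambda>\<alpha>. c (\<alpha>(s := e0))"]) auto
  qed
  \<comment> \<open>No variables are left: the only exponent function is constantly
    \<open>undefined\<close>, and a nonzero constant lies in the proper ideal
    \<open>Q k\<close>.\<close>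
  from this[of k] obtain c where c: "c (\<lambda>_. undefined) \<noteq> 0" "P k c \<in> Q k" by auto
  have "P k c = (\<lambda>_. c (\<lambda>_. undefined))" unfolding P_def by simp
  then have "(\<lambda>_. 1 / c (\<lambda>_. undefined) * c (\<lambda>_. undefined)) \<in> Q k"
    using Qm[OF order_refl Lc c(2), of "1 / c (\<lambda>_. undefined)"] by simp
  then show False using Q1[of k] c(1) by simp
qed

text \<open>In a chain of primes longer than \<open>card Y\<close>, functions picked between
  consecutive primes are algebraically dependent, which \<open>no_relation_along_prime_chain\<close>
  excludes.\<close>

lemma krull_dim_stalk_le:
  assumes X: "function_sheaf X" and Y: "finite Y" and \<phi>: "morphism (affine_space Y) X \<phi>"
    and dense: "ftop X closure_of range \<phi> = points X" and x: "x \<in> points X"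
  shows "krull_dim (stalk X x) \<le> enat (card Y)"
  unfolding krull_dim_def
proof (rule SUP_least, clarify)
  fix k p
  assume prime: "\<forall>i\<le>k. primeideal (p i) (stalk X x)" and chain: "\<forall>i<k. p i \<subset> p (Suc i)"
  let ?L = "local_functions X x"
  let ?R = "stalk X x"
  show "enat k \<le> enat (card Y)"
  proof (rule ccontr)
    assume "\<not> enat k \<le> enat (card Y)"
    then have k: "card Y < k" by simp
    \<comment> \<open>The primes are lifted from germs to functions, the form in which the chain
      argument is stated.\<close>
    define Q where "Q i = {f \<in> ?L. germ X x f \<in> p i}" for i
    have I: "ideal (p i) ?R" if "i \<le> k" for i using prime that primeideal.axioms(1) by blast
    have "\<exists>f. f \<in> Q (Suc i) \<and> f \<notin> Q i" if i: "i < k" for i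
    proof -
      obtain a where a: "a \<in> p (Suc i)" "a \<notin> p i" using chain i by blast
      have "p (Suc i) \<subseteq> carrier ?R"
        using I[of "Suc i"] i additive_subgroup.a_subset ideal.axioms(1) by fastforce
      then obtain f where "a = germ X x f" "f \<in> ?L" using a(1) unfolding carrier_stalk by auto
      then show ?thesis using a by (auto simp: Q_def)
    qed
    then obtain f where f: "\<And>i. i < k \<Longrightarrow> f i \<in> Q (Suc i)" "\<And>i. i < k \<Longrightarrow> f i \<notin> Q i" by metis
    have "\<exists>U. openin (ftop X) U \<and> x \<in> U \<and> f j \<in> sections X U" if "j < k" for j
      using f(1)[OF that] unfolding Q_def local_functions_def by blast
    then obtain U where U: "\<And>j. j < k \<Longrightarrow> openin (ftop X) (U j) \<and> x \<in> U j \<and> f j \<in> sections X (U j)" by metis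
    let ?U = "\<Inter>j\<in>{..<k}. U j"
    have U': "openin (ftop X) ?U" using U k by (intro openin_Inter) auto
    have fU: "f j \<in> sections X ?U" if "j < k" for j
      using U[OF that] that by (intro sheaf_restrict[OF X, of "U j" "f j" ?U] U') auto
    have xU: "x \<in> ?U" using U by auto
    then have ne: "?U \<noteq> {}" by blast
    obtain N and c :: "(nat \<Rightarrow> nat) \<Rightarrow> complex" where c: "\<exists>\<alpha>\<in>{0..<k} \<rightarrow>\<^sub>E {..N}. c \<alpha> \<noteq> 0"
      and rel: "\<And>y. y \<in> ?U \<Longrightarrow> (\<Sum>\<alpha>\<in>{0..<k} \<rightarrow>\<^sub>E {..N}. c \<alpha> * (\<Prod>j\<in>{0..<k}. f j y ^ \<alpha> j)) = 0"
      using relation_of_sections[where f = f, OF X Y \<phi> dense k U' ne fU] by blast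
    define R where "R y = (\<Sum>\<alpha>\<in>{0..<k} \<rightarrow>\<^sub>E {..N}. c \<alpha> * (\<Prod>j\<in>{0..<k}. f j y ^ \<alpha> j))" for y
    have g0: "germ X x g = \<zero>\<^bsub>?R\<^esub>" if "\<forall>y\<in>?U. g y = 0" for g
    proof -
      have "\<zero>\<^bsub>?R\<^esub> = germ X x (\<lambda>_. 0)" by (simp add: stalk_def)
      moreover have "eventually (\<lambda>y. g y = 0) (nhdsin (ftop X) x)"
        using U' xU that x unfolding eventually_nhdsin by blast
      ultimately show ?thesis by (simp add: germ_eq_iff)
    qed
    have R_sec: "R \<in> sections X ?U"
      unfolding R_def[abs_def]
      by (intro sheaf_sum[OF X U'] sheaf_mult[OF X U'] sheaf_const[OF X U'] sheaf_prod[OF X U']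
          sheaf_power[OF X U'] fU) auto
    have RQ: "R \<in> Q 0"
    proof -
      have "R \<in> ?L" using R_sec U' xU unfolding local_functions_def by blast
      moreover have "germ X x R = \<zero>\<^bsub>?R\<^esub>" by (rule g0) (use rel in \<open>simp add: R_def\<close>)
      ultimately show ?thesis
        using additive_subgroup.zero_closed[OF ideal.axioms(1)[OF I[of 0]]] by (simp add: Q_def)
    qed
    show False
    proof (rule no_relation_along_prime_chain[of ?L k Q f N c])
      show "(\<lambda>_. c) \<in> ?L" for c by (rule local_functions_const[OF X x])
      show "(\<lambda>y. f y + g y) \<in> ?L" "(\<lambda>y. f y * g y) \<in> ?L" if "f \<in> ?L" "g \<in> ?L" for f g
        using that by (simp_all add: local_functions_add[OF X] local_functions_mult[OF X])
      show "Q i \<subseteq> ?L" for i by (auto simp: Q_def)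
      show "(\<lambda>y. f y + g y) \<in> Q i" if "i \<le> k" "f \<in> Q i" "g \<in> Q i" for i f g
        using that additive_subgroup.a_closed[OF ideal.axioms(1)[OF I[OF that(1)]], of "germ X x f" "germ X x g"]
        by (simp add: Q_def local_functions_add[OF X] stalk_add_germ)
      show "(\<lambda>y. f y * g y) \<in> Q i" if "i \<le> k" "f \<in> ?L" "g \<in> Q i" for i f g
        using that ideal.I_l_closed[OF I[OF that(1)], of "germ X x g" "germ X x f"]
        by (simp add: Q_def local_functions_mult[OF X] stalk_mult_germ carrier_stalk)
      show "f \<in> Q i \<or> g \<in> Q i" if "i \<le> k" "f \<in> ?L" "g \<in> ?L" "(\<lambda>y. f y * g y) \<in> Q i" for i f g
        using that primeideal.I_prime[of "p i" ?R "germ X x f" "germ X x g"] prime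
        by (simp add: Q_def stalk_mult_germ carrier_stalk)
      show "(\<lambda>_. 1) \<notin> Q i" if "i \<le> k" for i
      proof
        assume "(\<lambda>_. 1) \<in> Q i"
        then have "\<one>\<^bsub>?R\<^esub> \<in> p i" by (simp add: Q_def stalk_def)
        then have "p i = carrier ?R" using ideal.one_imp_carrier[OF I[OF that]] by simp
        then show False using prime that primeideal.I_notcarr by blast
      qed
      show "Q i \<subseteq> Q (Suc i)" if "i < k" for i using chain that by (auto simp: Q_def)
    qed (use f c RQ in \<open>auto simp: R_def[abs_def]\<close>)
  qed
qed

lemma germ_eq_imp_value: "germ X x f = germ X x g \<Longrightarrow> x \<in> points X \<Longrightarrow> f x = g x"
  unfolding germ_eq_iff eventually_nhdsin by auto

section \<open>The maximal ideal of a stalk and its generators\<close>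

lemma cring_idealI:
  assumes R: "cring R" and I: "I \<subseteq> carrier R" "I \<noteq> {}"
    and add: "\<And>a b. a \<in> I \<Longrightarrow> b \<in> I \<Longrightarrow> a \<oplus>\<^bsub>R\<^esub> b \<in> I"
    and mult: "\<And>r a. r \<in> carrier R \<Longrightarrow> a \<in> I \<Longrightarrow> r \<otimes>\<^bsub>R\<^esub> a \<in> I"
  shows "ideal I R"
proof -
  interpret cring R by (rule R)
  have neg: "\<ominus>\<^bsub>R\<^esub> a \<in> I" if a: "a \<in> I" for a
  proof -
    have ac: "a \<in> carrier R" using a I(1) by blast
    have "\<ominus>\<^bsub>R\<^esub> a = (\<ominus>\<^bsub>R\<^esub> \<one>\<^bsub>R\<^esub>) \<otimes>\<^bsub>R\<^esub> a" using ac by (simp add: l_minus)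
    then show ?thesis using mult[of "\<ominus>\<^bsub>R\<^esub> \<one>\<^bsub>R\<^esub>" a] a by simp
  qed
  obtain a where a: "a \<in> I" using I(2) by blast
  then have "a \<oplus>\<^bsub>R\<^esub> \<ominus>\<^bsub>R\<^esub> a \<in> I" using add neg by blast
  then have zero: "\<zero>\<^bsub>R\<^esub> \<in> I" using a I(1) r_neg by auto
  show ?thesis
  proof (rule idealI)
    show "subgroup I (add_monoid R)"
      by (rule subgroup.intro) (use I(1) add zero neg in \<open>auto simp: a_inv_def\<close>)
    show "x \<otimes>\<^bsub>R\<^esub> a \<in> I" if "a \<in> I" "x \<in> carrier R" for a x using mult that by blast
    then show "a \<otimes>\<^bsub>R\<^esub> x \<in> I" if "a \<in> I" "x \<in> carrier R" for a x
      using that I(1) m_comm[of a x] by auto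
  qed (rule ring_axioms)
qed

definition stalk_max_ideal :: "'a fspace \<Rightarrow> 'a \<Rightarrow> ('a \<Rightarrow> complex) set set" where
  "stalk_max_ideal X x = germ X x ` {f \<in> local_functions X x. f x = 0}"

lemma germ_ideal:
  assumes X: "function_sheaf X" and x: "x \<in> points X" and R: "cring (stalk X x)"
    and F: "F \<subseteq> local_functions X x" "F \<noteq> {}"
    and add: "\<And>f g. f \<in> F \<Longrightarrow> g \<in> F \<Longrightarrow> (\<lambda>y. f y + g y) \<in> F"
    and mult: "\<And>f g. f \<in> local_functions X x \<Longrightarrow> g \<in> F \<Longrightarrow> (\<lambda>y. f y * g y) \<in> F"
  shows "ideal (germ X x ` F) (stalk X x)"
proof (rule cring_idealI[OF R])
  show "germ X x ` F \<subseteq> carrier (stalk X x)" using F(1) unfolding carrier_stalk by blast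
  show "germ X x ` F \<noteq> {}" using F(2) by simp
  fix a b assume "a \<in> germ X x ` F" "b \<in> germ X x ` F"
  then obtain f g where "f \<in> F" "g \<in> F" "a = germ X x f" "b = germ X x g" by blast
  then show "a \<oplus>\<^bsub>stalk X x\<^esub> b \<in> germ X x ` F"
    unfolding stalk_add_germ using add by (simp add: stalk_add_germ)
next
  fix r a assume "r \<in> carrier (stalk X x)" "a \<in> germ X x ` F"
  then obtain f g where "f \<in> local_functions X x" "g \<in> F" "r = germ X x f" "a = germ X x g"
    unfolding carrier_stalk by blast
  then show "r \<otimes>\<^bsub>stalk X x\<^esub> a \<in> germ X x ` F"
    using mult by (simp add: stalk_mult_germ)
qed

text \<open>A germ that does not vanish at \<open>x\<close> has an inverse on the open set where it
  is nonzero, so an ideal containing such a germ is the whole ring.\<close>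

lemma maximalideal_stalk:
  assumes X: "function_sheaf X" and x: "x \<in> points X" and R: "cring (stalk X x)"
  shows "maximalideal (stalk_max_ideal X x) (stalk X x)"
proof (rule maximalidealI)
  have one: "\<one>\<^bsub>stalk X x\<^esub> = germ X x (\<lambda>_. 1)" by (simp add: stalk_def)
  show "ideal (stalk_max_ideal X x) (stalk X x)"
    unfolding stalk_max_ideal_def
  proof (rule germ_ideal[OF X x R])
    show "{f \<in> local_functions X x. f x = 0} \<noteq> {}" using local_functions_const[OF X x, of 0] by blast
  qed (auto intro: local_functions_add[OF X] local_functions_mult[OF X])
  have "germ X x (\<lambda>_. 1) \<notin> stalk_max_ideal X x"
    unfolding stalk_max_ideal_def using germ_eq_imp_value[OF _ x, of "\<lambda>_. 1"] by fastforce
  then show "carrier (stalk X x) \<noteq> stalk_max_ideal X x"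
    using local_functions_const[OF X x, of 1] unfolding carrier_stalk by blast
  fix J assume J: "ideal J (stalk X x)" "stalk_max_ideal X x \<subseteq> J" "J \<subseteq> carrier (stalk X x)"
  show "J = stalk_max_ideal X x \<or> J = carrier (stalk X x)"
  proof (cases "J \<subseteq> stalk_max_ideal X x")
    case False
    then obtain f where f: "germ X x f \<in> J" "f \<in> local_functions X x" "f x \<noteq> 0"
      using J(3) unfolding carrier_stalk stalk_max_ideal_def by blast
    obtain U where U: "openin (ftop X) U" "x \<in> U" "f \<in> sections X U"
      using f(2) unfolding local_functions_def by blast
    let ?U = "{y\<in>U. f y \<noteq> 0}"
    have U': "openin (ftop X) ?U" by (rule sheaf_nonzero[OF X U(1,3)])
    have "(\<lambda>y. 1 / f y) \<in> sections X ?U"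
      by (rule sheaf_inverse[OF X U' sheaf_restrict[OF X U(1,3) U']]) auto
    then have inv: "(\<lambda>y. 1 / f y) \<in> local_functions X x"
      unfolding local_functions_def using U' U(2) f(3) by blast
    have "germ X x (\<lambda>y. 1 / f y * f y) = germ X x (\<lambda>_. 1)"
      unfolding germ_eq_iff eventually_nhdsin using U' U(2) f(3) by (intro disjI2 exI[of _ ?U]) auto
    moreover have "germ X x (\<lambda>y. 1 / f y * f y) \<in> J"
      using ideal.I_l_closed[OF J(1) f(1), of "germ X x (\<lambda>y. 1 / f y)"] inv
      unfolding carrier_stalk stalk_mult_germ by blast
    ultimately have "\<one>\<^bsub>stalk X x\<^esub> \<in> J" unfolding one by simp
    then show ?thesis using ideal.one_imp_carrier[OF J(1)] by blast
  qed (use J(2) in blast)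
qed

text \<open>Linearly independent point derivations bound the dimension of the cotangent space from below.\<close>

lemma min_generators_ge:
  assumes X: "function_sheaf X" and x: "x \<in> points X" and R: "cring (stalk X x)" and K: "finite K"
    and germ: "\<And>k f g. k \<in> K \<Longrightarrow> f \<in> local_functions X x \<Longrightarrow> g \<in> local_functions X x \<Longrightarrow>
      germ X x f = germ X x g \<Longrightarrow> D k f = D k g"
    and add: "\<And>k f g. k \<in> K \<Longrightarrow> f \<in> local_functions X x \<Longrightarrow> g \<in> local_functions X x \<Longrightarrow>
      D k (\<lambda>y. f y + g y) = D k f + D k g"
    and mult: "\<And>k f g. k \<in> K \<Longrightarrow> f \<in> local_functions X x \<Longrightarrow> g \<in> local_functions X x \<Longrightarrow>
      D k (\<lambda>y. f y * g y) = D k f * g x + f x * D k g"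
    and z: "\<And>l. l \<in> K \<Longrightarrow> z l \<in> local_functions X x" "\<And>l. l \<in> K \<Longrightarrow> z l x = 0"
    and Dz: "\<And>k l. k \<in> K \<Longrightarrow> l \<in> K \<Longrightarrow> D k (z l) = (if k = l then 1 else 0 :: complex)"
  shows "enat (card K) \<le> min_generators (stalk X x) (stalk_max_ideal X x)"
  unfolding min_generators_def
proof (rule INF_greatest, clarify)
  fix S assume S: "finite S" "S \<subseteq> carrier (stalk X x)" "genideal (stalk X x) S = stalk_max_ideal X x"
  interpret cring "stalk X x" by (rule R)
  show "enat (card K) \<le> enat (card S)"
  proof (rule ccontr)
    assume "\<not> enat (card K) \<le> enat (card S)"
    then have lt: "card S < card K" by simp
    have "\<exists>f. s = germ X x f \<and> f \<in> local_functions X x \<and> f x = 0" if "s \<in> S" for s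
      using genideal_self[OF S(2)] that unfolding S(3) stalk_max_ideal_def by blast
    then obtain f where f: "\<And>s. s \<in> S \<Longrightarrow> s = germ X x (f s) \<and> f s \<in> local_functions X x \<and> f s x = 0"
      by metis
    \<comment> \<open>With fewer generators than derivations, a nonzero combination of the
      \<open>D k\<close> kills all of \<open>S\<close>. By the Leibniz rule it then kills the whole
      maximal ideal, yet its value at \<open>z l\<close> is \<open>c l\<close>.\<close>
    obtain c where c: "\<exists>k\<in>K. c k \<noteq> 0" "\<And>s. s \<in> S \<Longrightarrow> (\<Sum>k\<in>K. c k * D k (f s)) = 0"
      using homogeneous_system[OF S(1) K lt, of "\<lambda>k s. D k (f s)"] by blast
    define F where "F = {f \<in> local_functions X x. f x = 0 \<and> (\<Sum>k\<in>K. c k * D k f) = 0}"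
    have "ideal (germ X x ` F) (stalk X x)"
    proof (rule germ_ideal[OF X x R])
      show "F \<subseteq> local_functions X x" by (auto simp: F_def)
      have c0: "(\<lambda>_. 0) \<in> local_functions X x" by (rule local_functions_const[OF X x])
      have "D k (\<lambda>_. 0) = 0" if "k \<in> K" for k using mult[OF that c0 c0] by simp
      then have "(\<lambda>_. 0) \<in> F" using c0 by (simp add: F_def)
      then show "F \<noteq> {}" by blast
      show "(\<lambda>y. f y + g y) \<in> F" if "f \<in> F" "g \<in> F" for f g
        using that by (simp add: F_def local_functions_add[OF X] add distrib_left sum.distrib)
      show "(\<lambda>y. f y * g y) \<in> F" if f: "f \<in> local_functions X x" and g: "g \<in> F" for f g
      proof -
        have "(\<Sum>k\<in>K. c k * D k (\<lambda>y. f y * g y)) = f x * (\<Sum>k\<in>K. c k * D k g)"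
          using f g unfolding sum_distrib_left by (intro sum.cong) (auto simp: F_def mult)
        then show ?thesis using f g by (simp add: F_def local_functions_mult[OF X])
      qed
    qed
    moreover have "S \<subseteq> germ X x ` F"
    proof
      fix s assume s: "s \<in> S"
      then have "f s \<in> F" using f[OF s] c(2)[OF s] by (simp add: F_def)
      then show "s \<in> germ X x ` F" using f[OF s] by blast
    qed
    ultimately have sub: "stalk_max_ideal X x \<subseteq> germ X x ` F"
      using genideal_minimal[of "germ X x ` F" S] unfolding S(3) by blast
    obtain l where l: "l \<in> K" "c l \<noteq> 0" using c(1) by blast
    have "germ X x (z l) \<in> germ X x ` F" using sub z[OF l(1)] unfolding stalk_max_ideal_def by blast
    then obtain g where g: "g \<in> F" "germ X x (z l) = germ X x g" by blast
    have "(\<Sum>k\<in>K. c k * D k (z l)) = (\<Sum>k\<in>K. c k * D k g)"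
      using g germ[OF _ z(1)[OF l(1)], of _ g] by (intro sum.cong) (auto simp: F_def)
    then have "(\<Sum>k\<in>K. c k * D k (z l)) = 0" using g(1) by (simp add: F_def)
    moreover have "(\<Sum>k\<in>K. c k * D k (z l)) = (\<Sum>k\<in>K. if k = l then c l else 0)"
      using Dz[OF _ l(1)] by (intro sum.cong) auto
    ultimately show False using l K by simp
  qed
qed


section \<open>Curves\<close>

abbreviation affine_line :: "complex fspace" where
  "affine_line \<equiv> quasi_affine {\<lambda>t. t} UNIV"

lemma polyfuns_line: "f \<in> polyfuns {\<lambda>t::complex. t} \<Longrightarrow> \<exists>p. f = poly p"
proof (induction rule: polyfuns.induct)
  case (const c)
  then show ?case by (intro exI[of _ "[:c:]"]) auto
next
  case (coord f)
  then show ?case by (intro exI[of _ "[:0, 1:]"]) auto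
next
  case (add f g)
  then obtain p q where "f = poly p" "g = poly q" by blast
  then show ?case by (intro exI[of _ "p + q"]) auto
next
  case (mult f g)
  then obtain p q where "f = poly p" "g = poly q" by blast
  then show ?case by (intro exI[of _ "p * q"]) auto
qed

text \<open>The bridge to analysis: a cofinite set is open in the usual topology, so Zariski
  neighbourhoods can be used for complex derivatives.\<close>

lemma affine_line_cofinite:
  assumes U: "openin (zariski {\<lambda>t::complex. t} UNIV) U" and t: "t \<in> U"
  shows "finite (- U)"
proof -
  obtain F where F: "F \<subseteq> polyfuns {\<lambda>t::complex. t}" "U = {x\<in>UNIV. \<exists>f\<in>F. f x \<noteq> 0}"
    using U unfolding openin_zariski by auto
  obtain f where f: "f \<in> F" "f t \<noteq> 0" using t F by blast
  obtain p where p: "f = poly p" using polyfuns_line f(1) F(1) by blast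
  have "- U \<subseteq> {t. poly p t = 0}" using f p unfolding F(2) by auto
  moreover have "p \<noteq> 0" using f p by auto
  ultimately show ?thesis using poly_roots_finite finite_subset by blast
qed

lemma line_section_differentiable:
  assumes U: "openin (zariski {\<lambda>t::complex. t} UNIV) U" and t: "t \<in> U" and f: "f \<in> sections affine_line U"
  shows "\<exists>D. (f has_field_derivative D) (at t)"
proof -
  obtain V g h where V: "openin (zariski {\<lambda>t. t} UNIV) V" "t \<in> V"
    "g \<in> polyfuns {\<lambda>t. t}" "h \<in> polyfuns {\<lambda>t. t}" and eq: "\<And>y. y \<in> U \<inter> V \<Longrightarrow> h y \<noteq> 0 \<and> f y = g y / h y"
    using f t unfolding sections_quasi_affine by meson
  obtain p q where p: "g = poly p" "h = poly q" using polyfuns_line V by meson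
  have tUV: "t \<in> U \<inter> V" using t V by auto
  have "finite (- (U \<inter> V))" using affine_line_cofinite[OF openin_Int[OF U V(1)] tUV] .
  then have op: "open (U \<inter> V)" using finite_imp_closed open_closed by blast
  have "((\<lambda>y. poly p y / poly q y) has_field_derivative
      ((poly (pderiv p) t * poly q t - poly p t * poly (pderiv q) t) / (poly q t * poly q t))) (at t)"
    using eq[OF tUV] p by (intro DERIV_divide poly_DERIV) auto
  moreover have "\<forall>\<^sub>F y in nhds t. f y = poly p y / poly q y"
    using eq p op tUV unfolding eventually_nhds by blast
  ultimately show ?thesis using DERIV_cong_ev[of t t f "\<lambda>y. poly p y / poly q y"] by auto
qed

text \<open>The point derivation at \<open>c 0\<close> given by the velocity of the curve; the
  complex derivative supplies additivity and the Leibniz rule.\<close>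

definition curve_derivative :: "(complex \<Rightarrow> 'a) \<Rightarrow> ('a \<Rightarrow> complex) \<Rightarrow> complex" where
  "curve_derivative c f = (THE D. ((\<lambda>t. f (c t)) has_field_derivative D) (at 0))"

lemma curve_derivative_eqI: "((\<lambda>t. f (c t)) has_field_derivative D) (at 0) \<Longrightarrow> curve_derivative c f = D"
  unfolding curve_derivative_def by (rule the_equality) (auto intro: DERIV_unique)

lemma curve_derivative:
  assumes c: "morphism affine_line X c" and f: "f \<in> local_functions X (c 0)"
  shows "((\<lambda>t. f (c t)) has_field_derivative curve_derivative c f) (at 0)"
proof -
  obtain U where U: "openin (ftop X) U" "c 0 \<in> U" "f \<in> sections X U"
    using f unfolding local_functions_def by blast
  have "\<exists>D. (f \<circ> c has_field_derivative D) (at 0)"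
    using line_section_differentiable[of "{t\<in>points affine_line. c t \<in> U}" 0 "f \<circ> c"]
      morphism_preimage[OF c U(1)] morphism_pullback[OF c U(1,3)] U(2) by simp
  then obtain D where D: "((\<lambda>t. f (c t)) has_field_derivative D) (at 0)" by (auto simp: o_def)
  then show ?thesis using curve_derivative_eqI[of f c, OF D] by simp
qed

text \<open>The preimage of a neighbourhood of \<open>c t\<close> is cofinite, so it contains
  parameters outside the finite set \<open>B\<close>.\<close>

lemma curve_limit:
  assumes c: "morphism affine_line X c" and B: "finite B" and S: "\<And>t. t \<notin> B \<Longrightarrow> c t \<in> S"
  shows "c t \<in> ftop X closure_of S"
  unfolding in_closure_of
proof (intro conjI allI impI)
  show "c t \<in> points X" using morphism_image[OF c] by simp
  fix T assume T: "c t \<in> T \<and> openin (ftop X) T"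
  have "finite (- {t. c t \<in> T})"
    using affine_line_cofinite[of "{t. c t \<in> T}" t] morphism_preimage[OF c, of T] T by simp
  then have "finite (- {t. c t \<in> T} \<union> B)" using B by simp
  then obtain s where "s \<notin> - {t. c t \<in> T} \<union> B" using ex_new_if_finite[OF infinite_UNIV_char_0] by blast
  then show "\<exists>y. y \<in> S \<and> y \<in> T" using S by blast
qed

text \<open>The functions \<open>z\<close> are dual to the velocities of the curves
  \<open>c\<close>, so \<open>card K\<close> bounds the number of generators of the maximal ideal
  from below. At a regular point this number is the Krull dimension, which the dense parametrization
  bounds by \<open>card Y\<close>.\<close>

lemma regular_point_bound:
  assumes X: "function_sheaf X" and Y: "finite Y" and \<phi>: "morphism (affine_space Y) X \<phi>"
    and dense: "ftop X closure_of range \<phi> = points X" and x: "x \<in> points X"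
    and reg: "regular_local_ring (stalk X x)" and K: "finite K"
    and c: "\<And>k. k \<in> K \<Longrightarrow> morphism affine_line X (c k)" "\<And>k. k \<in> K \<Longrightarrow> c k 0 = x"
    and z: "\<And>l. l \<in> K \<Longrightarrow> z l \<in> local_functions X x" "\<And>l. l \<in> K \<Longrightarrow> z l x = 0"
    and Dz: "\<And>k l. k \<in> K \<Longrightarrow> l \<in> K \<Longrightarrow>
      ((\<lambda>t. z l (c k t)) has_field_derivative (if k = l then 1 else 0)) (at 0)"
  shows "card K \<le> card Y"
proof -
  have R: "cring (stalk X x)"
    and eq: "\<And>m. maximalideal m (stalk X x) \<Longrightarrow> min_generators (stalk X x) m = krull_dim (stalk X x)"
    using reg unfolding regular_local_ring_def by auto
  let ?L = "local_functions X x"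
  let ?D = "\<lambda>k. curve_derivative (c k)"
  have D: "((\<lambda>t. f (c k t)) has_field_derivative ?D k f) (at 0)" if "k \<in> K" "f \<in> ?L" for k f
    using curve_derivative[OF c(1)[OF that(1)]] c(2)[OF that(1)] that(2) by simp
  have "enat (card K) \<le> min_generators (stalk X x) (stalk_max_ideal X x)"
  proof (rule min_generators_ge[OF X x R K])
    fix k f g assume k: "k \<in> K" and f: "f \<in> ?L" and g: "g \<in> ?L"
    show "?D k (\<lambda>y. f y + g y) = ?D k f + ?D k g"
      by (rule curve_derivative_eqI) (intro DERIV_add D k f g)
    show "?D k (\<lambda>y. f y * g y) = ?D k f * g x + f x * ?D k g"
      by (rule curve_derivative_eqI) (use DERIV_mult[OF D[OF k f] D[OF k g]] c(2)[OF k] in \<open>simp add: mult.commute\<close>)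
    assume "germ X x f = germ X x g"
    then obtain U where U: "openin (ftop X) U" "x \<in> U" "\<And>y. y \<in> U \<Longrightarrow> f y = g y"
      using x unfolding germ_eq_iff eventually_nhdsin by blast
    have cont: "finite (- {t. c k t \<in> U})"
      using affine_line_cofinite[of "{t. c k t \<in> U}" 0] morphism_preimage[OF c(1)[OF k] U(1)] U(2) c(2)[OF k] by simp
    then have "open {t. c k t \<in> U}" using finite_imp_closed open_closed by blast
    then have "\<forall>\<^sub>F t in nhds 0. f (c k t) = g (c k t)"
      unfolding eventually_nhds using U(2,3) c(2)[OF k] by blast
    then have "((\<lambda>t. f (c k t)) has_field_derivative ?D k g) (at 0)"
      using D[OF k g] DERIV_cong_ev[of 0 0 "\<lambda>t. f (c k t)" "\<lambda>t. g (c k t)"] by auto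
    then show "?D k f = ?D k g" by (rule curve_derivative_eqI)
  next
    fix k l assume "k \<in> K" "l \<in> K"
    then show "?D k (z l) = (if k = l then 1 else 0)" by (intro curve_derivative_eqI Dz)
  qed (use z in auto)
  also have "\<dots> = krull_dim (stalk X x)" by (rule eq[OF maximalideal_stalk[OF X x R]])
  also have "\<dots> \<le> enat (card Y)" by (rule krull_dim_stalk_le[OF X Y \<phi> dense x])
  finally show ?thesis by simp
qed

section \<open>The special linear group and its cosets\<close>

lemma carrier_SL: "A \<in> carrier (SL n) \<longleftrightarrow> A \<in> carrier_mat n n \<and> det A = 1"
  and mult_SL: "A \<otimes>\<^bsub>SL n\<^esub> B = A * B"
  by (simp_all add: SL_def)

lemma index_mult_square:
  "A \<in> carrier_mat n n \<Longrightarrow> B \<in> carrier_mat n n \<Longrightarrow> i < n \<Longrightarrow> j < n \<Longrightarrow>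
    (A * B) $$ (i, j) = (\<Sum>k<n. A $$ (i, k) * B $$ (k, j))"
  by (auto simp: scalar_prod_def lessThan_atLeast0 intro!: sum.cong)

lemma SL_mult: "A \<in> carrier (SL n) \<Longrightarrow> B \<in> carrier (SL n) \<Longrightarrow> A * B \<in> carrier (SL n)"
  by (auto simp: carrier_SL det_mult)

text \<open>With determinant 1 the adjugate is the inverse. Its entries are polynomials in those of
  \<open>A\<close>, so it keeps inversion regular.\<close>

lemma SL_adj:
  assumes "A \<in> carrier (SL n)"
  shows "adj_mat A \<in> carrier (SL n)" "A * adj_mat A = 1\<^sub>m n" "adj_mat A * A = 1\<^sub>m n"
proof -
  have A: "A \<in> carrier_mat n n" "det A = 1" using assms by (auto simp: carrier_SL)
  show 1: "A * adj_mat A = 1\<^sub>m n" "adj_mat A * A = 1\<^sub>m n"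
    using adj_mat(2,3)[OF A(1)] A(2) by auto
  have "det A * det (adj_mat A) = 1"
    using det_mult[OF A(1) adj_mat(1)[OF A(1)]] 1(1) by simp
  then show "adj_mat A \<in> carrier (SL n)"
    using adj_mat(1)[OF A(1)] A(2) by (simp add: carrier_SL)
qed

lemma adj_mat_mult_SL:
  assumes A: "A \<in> carrier (SL n)" and B: "B \<in> carrier (SL n)"
  shows "adj_mat (A * B) = adj_mat B * adj_mat A"
proof -
  let ?X = "adj_mat (A * B)"
  let ?Z = "adj_mat B * adj_mat A"
  have c: "A \<in> carrier_mat n n" "B \<in> carrier_mat n n" "adj_mat A \<in> carrier_mat n n"
    "adj_mat B \<in> carrier_mat n n" "?X \<in> carrier_mat n n" "A * B \<in> carrier_mat n n" "?Z \<in> carrier_mat n n"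
    using A B SL_adj(1)[OF A] SL_adj(1)[OF B] SL_adj(1)[OF SL_mult[OF A B]] SL_mult[OF A B]
      SL_mult[OF SL_adj(1)[OF B] SL_adj(1)[OF A]] by (simp_all only: carrier_SL)
  have "A * B * ?Z = A * (B * adj_mat B) * adj_mat A"
    using c by (simp add: assoc_mult_mat[of _ n n _ n _ n])
  also have "\<dots> = 1\<^sub>m n" unfolding SL_adj(2)[OF B] using c SL_adj(2)[OF A] by simp
  finally have Z: "A * B * ?Z = 1\<^sub>m n" .
  have "?X = ?X * 1\<^sub>m n" using right_mult_one_mat[OF c(5)] by simp
  also have "\<dots> = ?X * (A * B * ?Z)" by (simp only: Z)
  also have "\<dots> = (?X * (A * B)) * ?Z" using c by (simp add: assoc_mult_mat[of ?X n n "A * B" n ?Z n])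
  also have "\<dots> = ?Z" unfolding SL_adj(3)[OF SL_mult[OF A B]] using c by simp
  finally show ?thesis .
qed

lemma SL_kernel:
  assumes A: "A \<in> carrier (SL n)" and z: "\<And>i. i < n \<Longrightarrow> (\<Sum>j<n. A $$ (i, j) * x j) = 0" and j: "j < n"
  shows "x j = (0 :: complex)"
proof -
  let ?B = "adj_mat A"
  have c: "A \<in> carrier_mat n n" "?B \<in> carrier_mat n n"
    using A SL_adj(1)[OF A] by (auto simp: carrier_SL)
  have "x j = (\<Sum>k<n. (?B * A) $$ (j, k) * x k)"
    unfolding SL_adj(3)[OF A] using j by (simp add: if_distrib[of "\<lambda>u. u * _"] cong: if_cong)
  also have "\<dots> = (\<Sum>k<n. \<Sum>i<n. ?B $$ (j, i) * (A $$ (i, k) * x k))"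
    using c j by (intro sum.cong) (auto simp: index_mult_square sum_distrib_right mult.assoc simp del: index_mult_mat)
  also have "\<dots> = (\<Sum>i<n. ?B $$ (j, i) * (\<Sum>k<n. A $$ (i, k) * x k))"
    by (subst sum.swap) (simp add: sum_distrib_left)
  also have "\<dots> = 0" using z by simp
  finally show ?thesis .
qed

lemma det_nonzero_if_kernel_trivial:
  assumes M: "M \<in> carrier_mat n n"
    and ker: "\<And>x j. (\<And>i. i < n \<Longrightarrow> (\<Sum>k<n. M $$ (i, k) * x k) = 0) \<Longrightarrow> j < n \<Longrightarrow> x j = (0::complex)"
  shows "det M \<noteq> 0"
proof
  assume "det M = 0"
  then obtain v where v: "v \<in> carrier_vec n" "v \<noteq> 0\<^sub>v n" "M *\<^sub>v v = 0\<^sub>v n"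
    using det_0_iff_vec_prod_zero_field[OF M] by auto
  have "(\<Sum>k<n. M $$ (i, k) * v $ k) = 0" if "i < n" for i
  proof -
    have "(M *\<^sub>v v) $ i = (\<Sum>k<n. M $$ (i, k) * v $ k)"
      using that M v(1) by (auto simp: scalar_prod_def lessThan_atLeast0 intro!: sum.cong)
    then show ?thesis using v(3) that by simp
  qed
  from ker[OF this] have "v = 0\<^sub>v n" using v(1) by (intro eq_vecI) auto
  with v(2) show False ..
qed

text \<open>Normalizes the determinant at the cost of one column. In each use below that column ends
  up outside the first \<open>d\<close> columns, which alone determine the coset.\<close>

definition rescale_column :: "nat \<Rightarrow> complex mat \<Rightarrow> complex mat" where
  "rescale_column d M = mat (dim_row M) (dim_col M) (\<lambda>(i, j). if j = d then M $$ (i, j) / det M else M $$ (i, j))"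

lemma rescale_column_SL:
  assumes M: "M \<in> carrier_mat n n" and d: "d < n" and nz: "det M \<noteq> 0"
  shows "rescale_column d M \<in> carrier (SL n)"
proof -
  let ?N = "rescale_column d M"
  have N: "?N \<in> carrier_mat n n" using M by (auto simp: rescale_column_def)
  have "mat_delete ?N i d = mat_delete M i d" if "i < n" for i
    using M that d by (intro eq_matI) (auto simp: mat_delete_def rescale_column_def)
  then have "det ?N = (\<Sum>i<n. M $$ (i, d) / det M * cofactor M i d)"
    using M d by (subst laplace_expansion_column[OF N d]) (auto simp: cofactor_def rescale_column_def intro!: sum.cong)
  also have "\<dots> = det M / det M"
    by (subst (2) laplace_expansion_column[OF M d]) (simp add: sum_divide_distrib)
  finally show ?thesis using N nz by (simp add: carrier_SL)
qed

section \<open>The parabolic subgroup and its cosets\<close>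

lemma parabolic_SL: "A \<in> parabolic n d \<Longrightarrow> A \<in> carrier (SL n)"
  and parabolic_zero: "A \<in> parabolic n d \<Longrightarrow> d \<le> i \<Longrightarrow> i < n \<Longrightarrow> j < d \<Longrightarrow> A $$ (i, j) = 0"
  by (simp_all add: parabolic_def)

lemma parabolic_sum:
  assumes "h \<in> parabolic n d" "j < d" "d \<le> n"
  shows "(\<Sum>s<n. f s * h $$ (s, j)) = (\<Sum>s<d. f s * h $$ (s, j))"
  by (rule sum.mono_neutral_right) (use assms parabolic_zero[OF assms(1)] in auto)

lemma index_mult_parabolic:
  assumes A: "A \<in> carrier_mat n n" and h: "h \<in> parabolic n d" and d: "d \<le> n" and ij: "i < n" "j < d"
  shows "(A * h) $$ (i, j) = (\<Sum>s<d. A $$ (i, s) * h $$ (s, j))"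
proof -
  have "h \<in> carrier_mat n n" using parabolic_SL[OF h] carrier_SL by blast
  then have "(A * h) $$ (i, j) = (\<Sum>s<n. A $$ (i, s) * h $$ (s, j))"
    using A ij d by (intro index_mult_square) auto
  then show ?thesis using parabolic_sum[OF h ij(2) d] by simp
qed

lemma parabolic_mult:
  assumes A: "A \<in> parabolic n d" and B: "B \<in> parabolic n d" and d: "d \<le> n"
  shows "A * B \<in> parabolic n d"
proof -
  have c: "A \<in> carrier_mat n n" "B \<in> carrier_mat n n"
    using A B parabolic_SL carrier_SL by blast+
  have "(A * B) $$ (i, j) = 0" if "d \<le> i" "i < n" "j < d" for i j
  proof -
    have "(A * B) $$ (i, j) = (\<Sum>s<d. A $$ (i, s) * B $$ (s, j))"
      by (rule index_mult_parabolic[OF c(1) B d that(2,3)])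
    then show ?thesis using that parabolic_zero[OF A] by simp
  qed
  then show ?thesis using SL_mult[OF parabolic_SL[OF A] parabolic_SL[OF B]] by (simp add: parabolic_def)
qed

text \<open>
  An element of the parabolic maps the span of the first \<open>d\<close> basis vectors into itself, and
  onto by a dimension count.
\<close>

lemma parabolic_adj:
  assumes A: "A \<in> parabolic n d" and d: "d \<le> n"
  shows "adj_mat A \<in> parabolic n d"
proof -
  let ?B = "adj_mat A"
  have AS: "A \<in> carrier (SL n)" by (rule parabolic_SL[OF A])
  have BS: "?B \<in> carrier (SL n)" by (rule SL_adj(1)[OF AS])
  have c: "A \<in> carrier_mat n n" "?B \<in> carrier_mat n n" using AS BS carrier_SL by blast+
  have "?B $$ (i, j) = 0" if i: "d \<le> i" "i < n" and j: "j < d" for i j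
  proof -
    have jn: "j < n" using j d by simp
    \<comment> \<open>The first \<open>d\<close> columns of \<open>A\<close>, followed by the unit
      vector \<open>j\<close>: these are \<open>d + 1\<close> vectors in dimension \<open>d\<close>,
      and a linear relation among them expresses column \<open>j\<close> of the inverse through the
      first \<open>d\<close> basis vectors.\<close>
    define a where "a k m = (if k < d then A $$ (m, k) else if m = j then 1 else 0)" for k m
    obtain x where x: "\<exists>k\<in>{..d}. x k \<noteq> 0" "\<And>m. m \<in> {..<d} \<Longrightarrow> (\<Sum>k\<in>{..d}. x k * a k m) = 0"
      using homogeneous_system[of "{..<d}" "{..d}" a] by auto
    define y where "y k = (if k < d then x k else 0)" for k
    have Ay: "(\<Sum>k<n. A $$ (m, k) * y k) = - x d * (if m = j then 1 else 0)" if m: "m < n" for m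
    proof -
      have "(\<Sum>k<n. A $$ (m, k) * y k) = (\<Sum>k<d. A $$ (m, k) * y k)"
        by (rule sum.mono_neutral_right) (use d in \<open>auto simp: y_def\<close>)
      also have "\<dots> = (\<Sum>k<d. x k * a k m)" by (intro sum.cong) (auto simp: a_def y_def)
      also have "\<dots> = - x d * (if m = j then 1 else 0)"
      proof (cases "m < d")
        case True
        have "(\<Sum>k\<in>{..d}. x k * a k m) = (\<Sum>k<d. x k * a k m) + x d * a d m"
          by (simp add: lessThan_Suc_atMost[symmetric])
        then show ?thesis using x(2)[of m] True by (auto simp: a_def eq_neg_iff_add_eq_0)
      next
        case False
        then have "(\<Sum>k<d. x k * a k m) = 0" using parabolic_zero[OF A] m by (simp add: a_def)
        then show ?thesis using False j by auto
      qed
      finally show ?thesis .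
    qed
    have BA: "y i = (\<Sum>m<n. ?B $$ (i, m) * (\<Sum>k<n. A $$ (m, k) * y k))"
    proof -
      have "(\<Sum>m<n. ?B $$ (i, m) * (\<Sum>k<n. A $$ (m, k) * y k)) = (\<Sum>k<n. (?B * A) $$ (i, k) * y k)"
        using c i by (simp add: index_mult_square sum_distrib_left sum_distrib_right mult.assoc del: index_mult_mat)
          (subst sum.swap, simp)
      also have "\<dots> = y i"
        unfolding SL_adj(3)[OF AS] using i by (simp add: if_distrib[of "\<lambda>u. u * _"] cong: if_cong)
      finally show ?thesis ..
    qed
    have "y i = - x d * ?B $$ (i, j)"
      unfolding BA using jn by (simp add: Ay if_distrib[of "\<lambda>u. _ * u"] cong: if_cong)
    \<comment> \<open>Otherwise the relation would be one among the columns of the invertible matrix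
      \<open>A\<close>.\<close>
    moreover have "x d \<noteq> 0"
    proof
      assume 0: "x d = 0"
      then have "y k = 0" if "k < n" for k using SL_kernel[OF AS _ that, of y] Ay by simp
      then have "\<forall>k\<in>{..d}. x k = 0" using 0 d by (metis (full_types) atMost_iff le_neq_implies_less order_less_le_trans y_def)
      then show False using x(1) by blast
    qed
    ultimately show ?thesis using i by (simp add: y_def)
  qed
  then show ?thesis using BS by (simp add: parabolic_def)
qed

abbreviation coset :: "nat \<Rightarrow> nat \<Rightarrow> complex mat \<Rightarrow> complex mat set" where
  "coset n d A \<equiv> A <#\<^bsub>SL n\<^esub> parabolic n d"

lemma coset_eq: "coset n d A = (\<lambda>h. A * h) ` parabolic n d"
  by (auto simp: l_coset_def mult_SL)

lemma one_parabolic: "1\<^sub>m n \<in> parabolic n d"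
  by (simp add: parabolic_def carrier_SL)

lemma coset_mult:
  assumes A: "A \<in> carrier (SL n)" and h: "h \<in> parabolic n d" and d: "d \<le> n"
  shows "coset n d (A * h) = coset n d A"
proof -
  have c: "A \<in> carrier_mat n n" "\<And>h. h \<in> parabolic n d \<Longrightarrow> h \<in> carrier_mat n n"
    using A parabolic_SL carrier_SL by blast+
  have "A * h * p \<in> (\<lambda>h. A * h) ` parabolic n d" if p: "p \<in> parabolic n d" for p
    using parabolic_mult[OF h p d] c(1) c(2)[OF h] c(2)[OF p] by (auto simp: assoc_mult_mat[of A n n h n p n])
  moreover have "A * p \<in> (\<lambda>p. A * h * p) ` parabolic n d" if p: "p \<in> parabolic n d" for p
  proof
    let ?q = "adj_mat h * p"
    have hi: "adj_mat h \<in> parabolic n d" by (rule parabolic_adj[OF h d])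
    show "?q \<in> parabolic n d" by (rule parabolic_mult[OF hi p d])
    have "h * ?q = p"
      using SL_adj(2)[OF parabolic_SL[OF h]] c(2)[OF h] c(2)[OF hi] c(2)[OF p]
      by (simp flip: assoc_mult_mat[of h n n "adj_mat h" n p n])
    then show "A * p = A * h * ?q"
      using c(1) c(2)[OF h] c(2)[OF hi] c(2)[OF p] by (simp add: assoc_mult_mat[of A n n h n ?q n])
  qed
  ultimately show ?thesis unfolding coset_eq by blast
qed

text \<open>A coset is the span of the first \<open>d\<close> columns of any representative. One
  inclusion of spans is enough, since it already puts \<open>adj_mat A * A'\<close> into the
  parabolic subgroup.\<close>

lemma coset_eq_iff:
  assumes A: "A \<in> carrier (SL n)" and A': "A' \<in> carrier (SL n)" and d: "d \<le> n"
  shows "coset n d A = coset n d A' \<longleftrightarrow>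
    (\<exists>Q. \<forall>r<n. \<forall>k<d. A' $$ (r, k) = (\<Sum>s<d. A $$ (r, s) * Q s k))"
proof
  have c: "A \<in> carrier_mat n n" "A' \<in> carrier_mat n n" using A A' carrier_SL by blast+
  assume "coset n d A = coset n d A'"
  moreover have "A' \<in> coset n d A'"
    unfolding coset_eq using one_parabolic c(2) by (intro image_eqI[of _ _ "1\<^sub>m n"]) auto
  ultimately obtain h where h: "h \<in> parabolic n d" "A' = A * h" unfolding coset_eq by auto
  have "A' $$ (r, k) = (\<Sum>s<d. A $$ (r, s) * h $$ (s, k))" if "r < n" "k < d" for r k
    unfolding h(2) by (rule index_mult_parabolic[OF c(1) h(1) d that])
  then show "\<exists>Q. \<forall>r<n. \<forall>k<d. A' $$ (r, k) = (\<Sum>s<d. A $$ (r, s) * Q s k)"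
    by (intro exI[of _ "\<lambda>s k. h $$ (s, k)"]) simp
next
  assume "\<exists>Q. \<forall>r<n. \<forall>k<d. A' $$ (r, k) = (\<Sum>s<d. A $$ (r, s) * Q s k)"
  then obtain Q where Q: "\<And>r k. r < n \<Longrightarrow> k < d \<Longrightarrow> A' $$ (r, k) = (\<Sum>s<d. A $$ (r, s) * Q s k)" by blast
  let ?B = "adj_mat A"
  let ?h = "?B * A'"
  have B: "?B \<in> carrier (SL n)" by (rule SL_adj(1)[OF A])
  have c: "A \<in> carrier_mat n n" "A' \<in> carrier_mat n n" "?B \<in> carrier_mat n n"
    using A A' B carrier_SL by blast+
  have "?h $$ (i, j) = 0" if i: "d \<le> i" "i < n" and j: "j < d" for i j
  proof -
    have "?h $$ (i, j) = (\<Sum>r<n. ?B $$ (i, r) * (\<Sum>s<d. A $$ (r, s) * Q s j))"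
      using c i j d by (subst index_mult_square[of _ n]) (auto simp: Q)
    also have "\<dots> = (\<Sum>s<d. (?B * A) $$ (i, s) * Q s j)"
      using c i d by (simp add: index_mult_square sum_distrib_left sum_distrib_right mult.assoc del: index_mult_mat)
        (subst sum.swap, simp)
    also have "\<dots> = 0" unfolding SL_adj(3)[OF A] using i by (intro sum.neutral) auto
    finally show ?thesis .
  qed
  then have h: "?h \<in> parabolic n d" using SL_mult[OF B A'] by (simp add: parabolic_def)
  have "A * ?h = A'" using c SL_adj(2)[OF A] by (simp flip: assoc_mult_mat[of A n n ?B n A' n])
  then show "coset n d A = coset n d A'" using coset_mult[OF A h d] by simp
qed

lemma coset_eqI:
  assumes "A \<in> carrier (SL n)" "A' \<in> carrier (SL n)" "d \<le> n"
    "\<And>r k. r < n \<Longrightarrow> k < d \<Longrightarrow> A' $$ (r, k) = (\<Sum>s<d. A $$ (r, s) * Q s k)"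
  shows "coset n d A = coset n d A'"
  unfolding coset_eq_iff[OF assms(1-3)] using assms(4) by blast

lemma coset_eq_columnsI:
  assumes "A \<in> carrier (SL n)" "A' \<in> carrier (SL n)" "d \<le> n"
    "\<And>r k. r < n \<Longrightarrow> k < d \<Longrightarrow> A' $$ (r, k) = A $$ (r, k)"
  shows "coset n d A = coset n d A'"
  by (rule coset_eqI[where Q = "\<lambda>s k. if s = k then 1 else 0"])
    (use assms in \<open>auto simp: if_distrib[of "\<lambda>u. _ * u"] cong: if_cong\<close>)

lemma coset_eqD:
  assumes "A \<in> carrier (SL n)" "A' \<in> carrier (SL n)" "coset n d A = coset n d A'"
  obtains h where "h \<in> parabolic n d" "A' = A * h"
proof -
  have "A' = A' * 1\<^sub>m n" using assms(2) right_mult_one_mat[of A' n n] by (simp add: carrier_SL)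
  then have "A' \<in> coset n d A'" unfolding coset_eq using one_parabolic by (rule image_eqI)
  then have "A' \<in> coset n d A" using assms(3) by simp
  then show ?thesis using that unfolding coset_eq by auto
qed

text \<open>The Pluecker coordinate for the rows \<open>J 0, ..., J (d - 1)\<close>. Since
  \<open>J\<close> is a function, one row is exchanged by a function update.\<close>

definition minor :: "nat \<Rightarrow> (nat \<Rightarrow> nat) \<Rightarrow> complex mat \<Rightarrow> complex" where
  "minor d J A = det (mat d d (\<lambda>(i, k). A $$ (J i, k)))"

lemma minor_mult:
  assumes A: "A \<in> carrier_mat n n" and h: "h \<in> parabolic n d" and d: "d \<le> n" and J: "\<And>i. i < d \<Longrightarrow> J i < n"
  shows "minor d J (A * h) = minor d J A * det (mat d d (\<lambda>(i, k). h $$ (i, k)))"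
proof -
  have "mat d d (\<lambda>(i, k). (A * h) $$ (J i, k)) = mat d d (\<lambda>(i, k). A $$ (J i, k)) * mat d d (\<lambda>(i, k). h $$ (i, k))"
    (is "?L = ?R")
  proof (rule eq_matI)
    fix i j assume "i < dim_row ?R" "j < dim_col ?R"
    then have ij: "i < d" "j < d" by auto
    have "?R $$ (i, j) = (\<Sum>s<d. A $$ (J i, s) * h $$ (s, j))"
      using ij by (subst index_mult_square[of _ d]) auto
    then show "?L $$ (i, j) = ?R $$ (i, j)" using index_mult_parabolic[OF A h d J[OF ij(1)] ij(2)] ij by simp
  qed auto
  then have "minor d J (A * h) = det (mat d d (\<lambda>(i, k). A $$ (J i, k)) * mat d d (\<lambda>(i, k). h $$ (i, k)))"
    unfolding minor_def by (rule arg_cong)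
  then show ?thesis unfolding minor_def by (subst (asm) det_mult[of _ d]) auto
qed

text \<open>The leading minor of the product of the inverse of \<open>h\<close> with
  \<open>h\<close> equals 1, and it has this determinant as a factor.\<close>

lemma parabolic_block_nonzero:
  assumes h: "h \<in> parabolic n d" and d: "d \<le> n"
  shows "det (mat d d (\<lambda>(i, k). h $$ (i, k))) \<noteq> 0"
proof
  assume 0: "det (mat d d (\<lambda>(i, k). h $$ (i, k))) = 0"
  have c: "adj_mat h \<in> carrier_mat n n"
    using SL_adj(1)[OF parabolic_SL[OF h]] carrier_SL by blast
  have "minor d id (adj_mat h * h) = 0" using minor_mult[OF c h d, of id] 0 d by simp
  moreover have "mat d d (\<lambda>(i, k). 1\<^sub>m n $$ (id i, k)) = (1\<^sub>m d :: complex mat)"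
    using d by (intro eq_matI) auto
  then have "minor d id (adj_mat h * h) = 1"
    unfolding SL_adj(3)[OF parabolic_SL[OF h]] minor_def by simp
  ultimately show False by simp
qed

text \<open>In the Leibniz expansion every permutation other than the identity moves some index
  \<open>i \<noteq> k\<close>, and meets a zero of the unit row \<open>i\<close>.\<close>

lemma det_row_replaced:
  assumes "k < d"
  shows "det (mat d d (\<lambda>(i, c). if i = k then v c else if i = c then 1 else 0)) = (v k :: complex)"
proof -
  let ?M = "mat d d (\<lambda>(i, c). if i = k then v c else if i = c then 1 else 0) :: complex mat"
  have "det ?M = (\<Sum>p\<in>{p. p permutes {0..<d}}. signof p * (\<Prod>i=0..<d. ?M $$ (i, p i)))"
    by (rule det_def') simp
  also have "\<dots> = (\<Sum>p\<in>{id}. signof p * (\<Prod>i=0..<d. ?M $$ (i, p i)))"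
  proof (rule sum.mono_neutral_right)
    show "\<forall>p\<in>{p. p permutes {0..<d}} - {id}. signof p * (\<Prod>i=0..<d. ?M $$ (i, p i)) = 0"
    proof
      fix p assume p: "p \<in> {p. p permutes {0..<d}} - {id}"
      then have perm: "p permutes {0..<d}" by simp
      have "\<exists>i<d. i \<noteq> k \<and> p i \<noteq> i"
      proof (rule ccontr)
        assume "\<not> ?thesis"
        then have fix': "p i = i" if "i \<noteq> k" for i
          using that permutes_not_in[OF perm, of i] by (cases "i < d") auto
        then have "p permutes {k}" using perm unfolding permutes_def by (metis singletonD)
        then have "p = id" by simp
        with p show False by simp
      qed
      then obtain i where i: "i < d" "i \<noteq> k" "p i \<noteq> i" by blast
      then have "?M $$ (i, p i) = 0" using permutes_in_image[OF perm, of i] by auto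
      then have "(\<Prod>i=0..<d. ?M $$ (i, p i)) = 0" using i by (intro prod_zero) auto
      then show "signof p * (\<Prod>i=0..<d. ?M $$ (i, p i)) = 0" by simp
    qed
  qed (auto simp: finite_permutations permutes_id)
  also have "\<dots> = v k"
  proof -
    have "(\<Prod>i=0..<d. ?M $$ (i, i)) = (\<Prod>i=0..<d. if i = k then v k else 1)" by (rule prod.cong) auto
    then show ?thesis using assms by simp
  qed
  finally show ?thesis .
qed


section \<open>Morphisms and closed subsets of the Grassmannian\<close>

abbreviation SL_space :: "nat \<Rightarrow> complex mat fspace" where
  "SL_space n \<equiv> quasi_affine {(\<lambda>A. A $$ (i, j)) | i j. i < n \<and> j < n} (carrier (SL n))"

lemma function_sheaf_grassmannian: "function_sheaf (grassmannian n d)"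
  unfolding grassmannian_def by (intro function_sheaf_quotient function_sheaf_quasi_affine)

lemma points_grassmannian: "points (grassmannian n d) = coset n d ` carrier (SL n)"
  unfolding grassmannian_def points_quotient_fspace by simp

lemma morphism_coset: "morphism (SL_space n) (grassmannian n d) (coset n d)"
  unfolding grassmannian_def by (rule morphism_quotient_map)

lemma openin_grassmannian:
  "openin (ftop (grassmannian n d)) U \<longleftrightarrow> U \<subseteq> coset n d ` carrier (SL n) \<and>
     openin (ftop (SL_space n)) {A \<in> carrier (SL n). coset n d A \<in> U}"
  unfolding grassmannian_def openin_quotient_fspace by simp

lemma openin_SL: "openin (ftop (SL_space n)) (carrier (SL n))"
  using openin_topspace[of "ftop (SL_space n)"] by simp

lemma entry_regular:
  "i < n \<Longrightarrow> j < n \<Longrightarrow> (\<lambda>A. A $$ (i, j)) \<in> sections (SL_space n) (carrier (SL n))"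
  using openin_SL by (intro polyfuns_section polyfuns.coord) auto

lemma minor_regular:
  assumes "d \<le> n" "\<And>i. i < d \<Longrightarrow> J i < n"
  shows "minor d J \<in> sections (SL_space n) (carrier (SL n))"
  unfolding minor_def[abs_def]
  by (intro sheaf_det[OF function_sheaf_quasi_affine openin_SL] entry_regular) (use assms in auto)

lemma cofactor_regular:
  assumes ij: "i < n" "j < n"
  shows "(\<lambda>A. cofactor A i j) \<in> sections (SL_space n) (carrier (SL n))"
proof -
  let ?f = "\<lambda>A. (-1) ^ (i + j) * det (mat (n - 1) (n - 1) (\<lambda>(i', j').
    A $$ (if i' < i then i' else Suc i', if j' < j then j' else Suc j')))"
  have "?f \<in> sections (SL_space n) (carrier (SL n))"
    by (intro sheaf_mult sheaf_const sheaf_det function_sheaf_quasi_affine openin_SL entry_regular) auto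
  then show ?thesis
    by (rule sheaf_cong[OF function_sheaf_quasi_affine openin_SL])
      (auto simp: cofactor_def mat_delete_def carrier_SL)
qed

lemma adj_regular:
  assumes "i < n" "j < n"
  shows "(\<lambda>A. adj_mat A $$ (i, j)) \<in> sections (SL_space n) (carrier (SL n))"
  by (rule sheaf_cong[OF function_sheaf_quasi_affine openin_SL cofactor_regular[OF assms(2,1)]])
    (use assms in \<open>auto simp: adj_mat_def carrier_SL\<close>)

text \<open>Invariance in one direction makes the nonvanishing set a union of cosets, because any
  two representatives \<open>A\<close> and \<open>B\<close> of a coset satisfy
  \<open>B = A * h\<close>.\<close>

lemma openin_grassmannian_nonzero:
  assumes f: "f \<in> sections (SL_space n) (carrier (SL n))"
    and inv: "\<And>A h. A \<in> carrier (SL n) \<Longrightarrow> h \<in> parabolic n d \<Longrightarrow> f (A * h) \<noteq> 0 \<Longrightarrow> f A \<noteq> 0"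
  shows "openin (ftop (grassmannian n d)) (coset n d ` {A \<in> carrier (SL n). f A \<noteq> 0})"
    and "A \<in> carrier (SL n) \<Longrightarrow> coset n d A \<in> coset n d ` {A \<in> carrier (SL n). f A \<noteq> 0} \<longleftrightarrow> f A \<noteq> 0"
proof -
  have iff: "coset n d A \<in> coset n d ` {A \<in> carrier (SL n). f A \<noteq> 0} \<longleftrightarrow> f A \<noteq> 0"
    if A: "A \<in> carrier (SL n)" for A
  proof
    assume "coset n d A \<in> coset n d ` {A \<in> carrier (SL n). f A \<noteq> 0}"
    then obtain B where B: "B \<in> carrier (SL n)" "f B \<noteq> 0" "coset n d A = coset n d B" by auto
    obtain h where "h \<in> parabolic n d" "B = A * h" by (rule coset_eqD[OF A B(1,3)])
    then show "f A \<noteq> 0" using inv[OF A] B(2) by blast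
  qed (use A in blast)
  then show "A \<in> carrier (SL n) \<Longrightarrow> coset n d A \<in> coset n d ` {A \<in> carrier (SL n). f A \<noteq> 0} \<longleftrightarrow> f A \<noteq> 0" .
  have "{A \<in> carrier (SL n). coset n d A \<in> coset n d ` {A \<in> carrier (SL n). f A \<noteq> 0}} = {A \<in> carrier (SL n). f A \<noteq> 0}"
    using iff by blast
  then show "openin (ftop (grassmannian n d)) (coset n d ` {A \<in> carrier (SL n). f A \<noteq> 0})"
    unfolding openin_grassmannian using sheaf_nonzero[OF function_sheaf_quasi_affine openin_SL f] by auto
qed

text \<open>Stated for a family because a single entry of a matrix is not determined up to a factor
  by its coset, whereas the joint vanishing of a suitable family of entries is stable under the
  parabolic subgroup.\<close>

lemma closure_vanishing:
  assumes F: "\<And>f. f \<in> F \<Longrightarrow> f \<in> sections (SL_space n) (carrier (SL n))"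
    and inv: "\<And>A h f. A \<in> carrier (SL n) \<Longrightarrow> h \<in> parabolic n d \<Longrightarrow> (\<forall>f\<in>F. f A = 0) \<Longrightarrow> f \<in> F \<Longrightarrow> f (A * h) = 0"
    and S: "\<And>A f. A \<in> carrier (SL n) \<Longrightarrow> coset n d A \<in> S \<Longrightarrow> f \<in> F \<Longrightarrow> f A = 0"
    and A: "A \<in> carrier (SL n)" "coset n d A \<in> ftop (grassmannian n d) closure_of S" and f: "f \<in> F"
  shows "f A = 0"
proof (rule ccontr)
  assume fA: "f A \<noteq> 0"
  let ?U = "coset n d ` {A \<in> carrier (SL n). \<exists>f\<in>F. f A \<noteq> 0}"
  have "(\<exists>f\<in>F. f B \<noteq> 0)" if B: "B \<in> carrier (SL n)" "coset n d B \<in> ?U" for B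
  proof (rule ccontr)
    assume "\<not> (\<exists>f\<in>F. f B \<noteq> 0)"
    then have z: "\<forall>f\<in>F. f B = 0" by blast
    obtain C g where C: "C \<in> carrier (SL n)" "g \<in> F" "g C \<noteq> 0" "coset n d B = coset n d C" using B(2) by blast
    obtain h where "h \<in> parabolic n d" "C = B * h" by (rule coset_eqD[OF B(1) C(1,4)])
    then show False using inv[OF B(1) _ z C(2)] C(3) by blast
  qed
  then have "{B \<in> carrier (SL n). coset n d B \<in> ?U} = (\<Union>f\<in>F. {B \<in> carrier (SL n). f B \<noteq> 0})" by blast
  moreover have "openin (ftop (SL_space n)) {B \<in> carrier (SL n). f B \<noteq> 0}" if "f \<in> F" for f
    by (rule sheaf_nonzero[OF function_sheaf_quasi_affine openin_SL F[OF that]])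
  then have "openin (ftop (SL_space n)) (\<Union>f\<in>F. {B \<in> carrier (SL n). f B \<noteq> 0})" by blast
  ultimately have "openin (ftop (grassmannian n d)) ?U"
    unfolding openin_grassmannian by (metis (no_types, lifting) image_mono mem_Collect_eq subsetI)
  moreover have "coset n d A \<in> ?U" using A(1) f fA by blast
  ultimately obtain y where y: "y \<in> S" "y \<in> ?U" using A(2) unfolding in_closure_of by meson
  then show False using S by blast
qed

text \<open>
  Near each point the columns \<open>a x\<close> are completed to a square matrix by constant columns, the
  first of which is rescaled to make the determinant \<open>1\<close>.
\<close>

lemma morphism_grassmannianI:
  assumes X: "function_sheaf X" and d: "d < n"
    and a: "\<And>r k. r < n \<Longrightarrow> k < d \<Longrightarrow> (\<lambda>x. a x r k) \<in> sections X (points X)"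
    and \<psi>: "\<And>x. x \<in> points X \<Longrightarrow>
      \<exists>A\<in>carrier (SL n). \<psi> x = coset n d A \<and> (\<forall>r<n. \<forall>k<d. A $$ (r, k) = a x r k)"
  shows "morphism X (grassmannian n d) \<psi>"
proof (rule morphism_glue[OF X])
  fix x0 assume x0: "x0 \<in> points X"
  obtain A0 where A0: "A0 \<in> carrier (SL n)" "\<forall>r<n. \<forall>k<d. A0 $$ (r, k) = a x0 r k"
    using \<psi>[OF x0] by blast
  define m where "m x r k = (if k < d then a x r k else A0 $$ (r, k))" for x r k
  define M where "M x = mat n n (\<lambda>(r, k). m x r k)" for x
  note T = openin_topspace[of "ftop X"]
  have m: "(\<lambda>x. m x r k) \<in> sections X (points X)" if "r < n" "k < n" for r k
    unfolding m_def using that a sheaf_const[OF X T] by (cases "k < d") auto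
  have D: "(\<lambda>x. det (M x)) \<in> sections X (points X)"
    unfolding M_def by (rule sheaf_det[OF X T m])
  let ?U = "{x\<in>points X. det (M x) \<noteq> 0}"
  have U: "openin (ftop X) ?U" by (rule sheaf_nonzero[OF X T D])
  have "M x0 = A0" unfolding M_def m_def using A0 by (intro eq_matI) (auto simp: carrier_SL)
  then have "x0 \<in> ?U" using x0 A0(1) by (simp add: carrier_SL)
  moreover have "regular_on X (grassmannian n d) ?U \<psi>"
  proof (rule regular_on_cong[OF X regular_on_comp[OF _ morphism_coset]])
    show N: "regular_on X (SL_space n) ?U (\<lambda>x. rescale_column d (M x))"
    proof (rule regular_on_quasi_affine[OF X U])
      show "rescale_column d (M x) \<in> carrier (SL n)" if "x \<in> ?U" for x
        using that d by (intro rescale_column_SL) (auto simp: M_def)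
      fix c :: "complex mat \<Rightarrow> complex" assume "c \<in> {(\<lambda>A. A $$ (i, j)) | i j. i < n \<and> j < n}"
      then obtain i j where c: "c = (\<lambda>A. A $$ (i, j))" "i < n" "j < n" by blast
      have mU: "(\<lambda>x. m x i j) \<in> sections X ?U" by (rule sheaf_restrict[OF X T m U]) (use c in auto)
      have DU: "(\<lambda>x. det (M x)) \<in> sections X ?U" by (rule sheaf_restrict[OF X T D U]) auto
      have "(\<lambda>x. m x i j / det (M x)) \<in> sections X ?U" by (rule sheaf_divide[OF X U mU DU]) auto
      then show "(\<lambda>x. c (rescale_column d (M x))) \<in> sections X ?U"
        using mU c by (cases "j = d") (simp_all add: rescale_column_def M_def)
    qed
    fix x assume x: "x \<in> ?U"
    then obtain A where A: "A \<in> carrier (SL n)" "\<psi> x = coset n d A" "\<forall>r<n. \<forall>k<d. A $$ (r, k) = a x r k"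
      using \<psi>[of x] by auto
    have "rescale_column d (M x) \<in> carrier (SL n)"
      using x d by (intro rescale_column_SL) (auto simp: M_def)
    then show "\<psi> x = (coset n d \<circ> (\<lambda>x. rescale_column d (M x))) x"
      unfolding A(2) o_apply using A d
      by (intro coset_eq_columnsI) (auto simp: rescale_column_def M_def m_def)
  qed
  ultimately show "\<exists>U. x0 \<in> U \<and> regular_on X (grassmannian n d) U \<psi>" by (intro exI[of _ ?U] conjI)
qed

section \<open>Schubert cells\<close>

text \<open>\<open>perm_rep\<close> with the correcting sign in an arbitrary column: column
  \<open>d\<close> keeps signs out of the first \<open>d\<close> columns, and duality carries column
  \<open>0\<close> to column \<open>n - 1\<close>.\<close>

definition signed_perm :: "nat \<Rightarrow> (nat \<Rightarrow> nat) \<Rightarrow> nat \<Rightarrow> complex mat" where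
  "signed_perm n w c = mat n n (\<lambda>(i, j). if i = w j then (if j = c then of_int (sign w) else 1) else 0)"

lemma perm_rep_signed_perm: "perm_rep n w = signed_perm n w 0"
  by (simp add: perm_rep_def signed_perm_def)

lemma signed_perm_SL:
  assumes w: "w permutes {..<n}" and c: "c < n"
  shows "signed_perm n w c \<in> carrier (SL n)"
proof -
  let ?s = "\<lambda>j. if j = c then of_int (sign w) else 1 :: complex"
  define D where "D = mat n n (\<lambda>(i, j). if i = j then ?s j else 0)"
  have D: "D \<in> carrier_mat n n" by (simp add: D_def)
  have w': "inv_into UNIV w permutes {0..<n}" using permutes_inv[OF w] by (simp add: lessThan_atLeast0)
  have sgn: "sign (inv_into UNIV w) = sign w"
    using w by (intro sign_inverse) (auto simp: permutation_permutes)
  have "signed_perm n w c = mat n n (\<lambda>(i, j). D $$ (inv_into UNIV w i, j))"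
    using permutes_in_image[OF w'] permutes_inv_eq[OF w]
    by (intro eq_matI) (auto simp: signed_perm_def D_def)
  then have "det (signed_perm n w c) = of_int (sign w) * det D"
    using det_permute_rows[OF D w'] sgn by simp
  also have "det D = prod_list (diag_mat D)"
    by (rule det_lower_triangular[OF _ D]) (auto simp: D_def)
  also have "\<dots> = (\<Prod>i=0..<n. ?s i)"
    unfolding prod_list_diag_prod by (rule prod.cong) (auto simp: D_def)
  also have "\<dots> = of_int (sign w)" using c by simp
  finally show ?thesis
    by (simp add: carrier_SL signed_perm_def flip: of_int_mult)
qed

lemma index_mult_signed_perm:
  assumes b: "b \<in> carrier_mat n n" and w: "w permutes {..<n}" and rk: "r < n" "k < n"
  shows "(b * signed_perm n w c) $$ (r, k) = b $$ (r, w k) * (if k = c then of_int (sign w) else 1)"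
proof -
  have wk: "w k < n" using permutes_in_image[OF w, of k] rk by simp
  have P: "signed_perm n w c \<in> carrier_mat n n" by (simp add: signed_perm_def)
  have "(b * signed_perm n w c) $$ (r, k) =
      (\<Sum>j<n. if j = w k then b $$ (r, w k) * (if k = c then of_int (sign w) else 1) else 0)"
    unfolding index_mult_square[OF b P rk] using rk by (intro sum.cong) (auto simp: signed_perm_def)
  then show ?thesis using wk by simp
qed

lemma borel_SL: "b \<in> borel_subgroup n \<Longrightarrow> b \<in> carrier (SL n)"
  by (simp add: borel_subgroup_def)

lemma borel_zero: "b \<in> borel_subgroup n \<Longrightarrow> j < i \<Longrightarrow> i < n \<Longrightarrow> b $$ (i, j) = 0"
  by (auto simp: borel_subgroup_def upper_triangular_def carrier_SL)

lemma borel_diag_nonzero: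
  assumes b: "b \<in> borel_subgroup n" and i: "i < n"
  shows "b $$ (i, i) \<noteq> 0"
proof
  assume 0: "b $$ (i, i) = 0"
  have c: "b \<in> carrier_mat n n" "upper_triangular b" "det b = 1"
    using b by (auto simp: borel_subgroup_def carrier_SL)
  have "det b = (\<Prod>i=0..<n. b $$ (i, i))"
    using det_upper_triangular[OF c(2,1)] c(1) by (simp add: prod_list_diag_prod)
  also have "\<dots> = 0" using 0 i by (intro prod_zero) auto
  finally show False using c(3) by simp
qed

text \<open>Inversion by bordering. That the inverse is again triangular is what preserves the zeros
  beyond the pivots when columns are normalized.\<close>

lemma upper_triangular_right_inverse:
  fixes L :: "nat \<Rightarrow> nat \<Rightarrow> complex"
  assumes "\<And>i k. k < i \<Longrightarrow> i < d \<Longrightarrow> L i k = 0" "\<And>i. i < d \<Longrightarrow> L i i \<noteq> 0"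
  obtains Q where "\<And>i k. i < d \<Longrightarrow> k < d \<Longrightarrow> (\<Sum>s<d. L i s * Q s k) = (if i = k then 1 else 0)"
    "\<And>s k. k < s \<Longrightarrow> s < d \<Longrightarrow> Q s k = 0"
proof -
  have "\<exists>Q. (\<forall>i<d. \<forall>k<d. (\<Sum>s<d. L i s * Q s k) = (if i = k then 1 else 0)) \<and> (\<forall>s<d. \<forall>k<s. Q s k = 0)"
    using assms
  proof (induction d)
    case (Suc d)
    then obtain Q where Q: "\<And>i k. i < d \<Longrightarrow> k < d \<Longrightarrow> (\<Sum>s<d. L i s * Q s k) = (if i = k then 1 else 0)"
      "\<And>s k. k < s \<Longrightarrow> s < d \<Longrightarrow> Q s k = 0" by (metis less_Suc_eq)
    \<comment> \<open>The new column solves the last-column equations: its upper part is minus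
      \<open>Q\<close> times the last column of \<open>L\<close>, and everything is divided by the
      corner \<open>L d d\<close>.\<close>
    define R where "R s k = (if k < d then if s < d then Q s k else 0 else if s < d
      then - (\<Sum>t<d. Q s t * L t d) / L d d else 1 / L d d)" for s k
    have Ld: "L d d \<noteq> 0" using Suc.prems(2) by simp
    have "(\<Sum>s<Suc d. L i s * R s k) = (if i = k then 1 else 0)" if ik: "i < Suc d" "k < Suc d" for i k
    proof -
      consider "k < d" "i < d" | "k < d" "i = d" | "k = d" "i < d" | "k = d" "i = d" using ik by linarith
      then show ?thesis
      proof cases
        case 1
        then show ?thesis using Q(1)[of i k] by (simp add: R_def)
      next
        case 2
        then show ?thesis using Suc.prems(1)[of _ d] by (simp add: R_def)
      next
        case 3
        have "(\<Sum>s<d. L i s * R s k) = - (\<Sum>s<d. \<Sum>t<d. L i s * Q s t * L t d) / L d d"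
          using 3 by (simp add: R_def sum_distrib_left sum_divide_distrib sum_negf mult.assoc)
        also have "(\<Sum>s<d. \<Sum>t<d. L i s * Q s t * L t d) = (\<Sum>t<d. (\<Sum>s<d. L i s * Q s t) * L t d)"
          by (subst sum.swap) (simp add: sum_distrib_right)
        also have "\<dots> = (\<Sum>t<d. if t = i then L i d else 0)"
          using 3 by (intro sum.cong) (auto simp: Q(1))
        also have "\<dots> = L i d" using 3 by simp
        finally show ?thesis using 3 by (simp add: R_def)
      next
        case 4
        then show ?thesis using Suc.prems(1)[of _ d] Ld by (simp add: R_def)
      qed
    qed
    moreover have "\<forall>s<Suc d. \<forall>k<s. R s k = 0" using Q(2) by (auto simp: R_def)
    ultimately show ?case by blast
  qed simp
  then show ?thesis using that by blast
qed

section \<open>Minimal coset representatives, cells and echelon forms\<close>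

locale schubert =
  fixes n d :: nat and w :: "nat \<Rightarrow> nat"
  assumes d: "d < n" and rep: "w \<in> min_coset_reps n d"
begin

lemma w: "w permutes {..<n}" using rep by (simp add: min_coset_reps_def)

lemma w_less: "k < n \<Longrightarrow> w k < n" using permutes_in_image[OF w, of k] by simp

lemma w_eq_iff: "w i = w j \<longleftrightarrow> i = j" using permutes_inj[OF w] by (auto simp: inj_def)

lemma w_mono: "i < j \<Longrightarrow> j < d \<Longrightarrow> w i < w j"
  using rep by (auto simp: min_coset_reps_def strict_mono_on_def)

lemma w_mono': "d \<le> i \<Longrightarrow> i < j \<Longrightarrow> j < n \<Longrightarrow> w i < w j"
  using rep by (auto simp: min_coset_reps_def strict_mono_on_def)

lemma w_less_iff: "i < d \<Longrightarrow> j < d \<Longrightarrow> w i < w j \<longleftrightarrow> i < j"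
  using w_mono by (metis linorder_neqE_nat order_less_asym w_eq_iff)

lemma w_ge: "k < d \<Longrightarrow> k \<le> w k"
proof (induction k)
  case (Suc k)
  then show ?case using w_mono[of k "Suc k"] by simp
qed simp

abbreviation gr where "gr \<equiv> grassmannian n d"
abbreviation cell where "cell \<equiv> schubert_cell n d w"
abbreviation pt where "pt \<equiv> coset n d"

lemma cell_signed_perm:
  assumes c: "c < n" and b: "b \<in> borel_subgroup n"
  shows "pt (b * signed_perm n w c) \<in> cell"
proof -
  have S: "b * signed_perm n w c \<in> carrier (SL n)" "b * signed_perm n w 0 \<in> carrier (SL n)"
    using SL_mult[OF borel_SL[OF b]] signed_perm_SL[OF w] c by auto
  have bc: "b \<in> carrier_mat n n" using borel_SL[OF b] carrier_SL by blast
  have "pt (b * signed_perm n w 0) = pt (b * signed_perm n w c)"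
  proof (rule coset_eqI[OF S(2,1), where Q = "\<lambda>s k. if s = k then
      (if k = 0 then of_int (sign w) else 1) * (if k = c then of_int (sign w) else 1) else 0"])
    fix r k assume "r < n" "k < d"
    then show "(b * signed_perm n w c) $$ (r, k) = (\<Sum>s<d. (b * signed_perm n w 0) $$ (r, s) *
      (if s = k then (if k = 0 then of_int (sign w) else 1) * (if k = c then of_int (sign w) else 1) else 0))"
      using d by (simp add: index_mult_signed_perm[OF bc w] if_distrib[of "\<lambda>u. _ * u"] del: index_mult_mat
          cong: if_cong flip: of_int_mult)
  qed (use d in simp)
  then show ?thesis using b unfolding schubert_cell_def perm_rep_signed_perm by auto
qed

lemma cellE:
  assumes "x \<in> cell"
  obtains b where "b \<in> borel_subgroup n" "x = pt (b * signed_perm n w 0)" "b * signed_perm n w 0 \<in> carrier (SL n)"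
proof -
  obtain b where b: "b \<in> borel_subgroup n" "x = pt (b * signed_perm n w 0)"
    using assms unfolding schubert_cell_def perm_rep_signed_perm by auto
  moreover have "b * signed_perm n w 0 \<in> carrier (SL n)"
    using SL_mult[OF borel_SL[OF b(1)] signed_perm_SL[OF w]] d by simp
  ultimately show ?thesis by (rule that)
qed

lemma cell_points: "cell \<subseteq> points gr"
  unfolding points_grassmannian using cellE by blast

text \<open>Membership is read off the pivots: the last nonzero entry of column \<open>f k\<close>
  sits in row \<open>w k\<close>. Placed at position \<open>w k\<close> and completed by unit
  vectors, these columns form an upper triangular matrix.\<close>

lemma in_cellI:
  assumes A: "A \<in> carrier (SL n)" and f: "\<And>k. k < d \<Longrightarrow> f k < d"
    and nz: "\<And>k. k < d \<Longrightarrow> A $$ (w k, f k) \<noteq> 0"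
    and z: "\<And>k r. k < d \<Longrightarrow> w k < r \<Longrightarrow> r < n \<Longrightarrow> A $$ (r, f k) = 0"
  shows "pt A \<in> cell"
proof -
  have Ac: "A \<in> carrier_mat n n" using A carrier_SL by blast
  \<comment> \<open>A column cannot have its last nonzero entry in two different rows.\<close>
  have "inj_on f {..<d}"
  proof (rule inj_onI)
    fix k l assume kl: "k \<in> {..<d}" "l \<in> {..<d}" "f k = f l"
    have wn: "w k < n" "w l < n" using kl d w_less by auto
    show "k = l"
    proof (rule ccontr)
      assume "k \<noteq> l"
      then have "w k \<noteq> w l" by (simp add: w_eq_iff)
      then consider "w k < w l" | "w l < w k" by linarith
      then show False using z[of k "w l"] z[of l "w k"] nz[of k] nz[of l] kl wn by cases auto
    qed
  qed
  then have "f ` {..<d} = {..<d}" using f by (intro card_subset_eq) (auto simp: card_image)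
  then obtain g where g: "\<And>k. k < d \<Longrightarrow> g k < d \<and> f (g k) = k"
    by (metis (no_types, lifting) image_iff lessThan_iff)
  \<comment> \<open>Column \<open>w k\<close> of \<open>b0\<close> is column \<open>f k\<close> of
    \<open>A\<close>, the remaining columns are unit vectors, and so every pivot lands on the
    diagonal.\<close>
  define b0 where "b0 = mat n n (\<lambda>(r, j). if inv_into UNIV w j < d then A $$ (r, f (inv_into UNIV w j)) else if r = j then 1 else 0)"
  have b0: "b0 \<in> carrier_mat n n" by (simp add: b0_def)
  have wi: "w (inv_into UNIV w j) = j" for j using permutes_inverses(1)[OF w] by simp
  have iw: "inv_into UNIV w (w j) = j" for j using permutes_inverses(2)[OF w] by simp
  have ut: "upper_triangular b0"
    unfolding upper_triangular_def using z[of "inv_into UNIV w _"] wi by (auto simp: b0_def)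
  have "b0 $$ (i, i) \<noteq> 0" if "i < n" for i
    using that nz[of "inv_into UNIV w i"] wi by (auto simp: b0_def)
  then have "(\<Prod>i=0..<n. b0 $$ (i, i)) \<noteq> 0" by simp
  then have det: "det b0 \<noteq> 0"
    using det_upper_triangular[OF ut b0] b0 by (simp add: prod_list_diag_prod)
  \<comment> \<open>The signed permutation moves column \<open>w d\<close> to column
    \<open>d\<close>, so rescaling it does not affect the coset.\<close>
  define b where "b = rescale_column (w d) b0"
  have "b \<in> carrier (SL n)" unfolding b_def by (rule rescale_column_SL[OF b0 w_less[OF d] det])
  moreover have "upper_triangular b"
    using ut b0 unfolding upper_triangular_def b_def by (auto simp: rescale_column_def)
  ultimately have b: "b \<in> borel_subgroup n" by (simp add: borel_subgroup_def)
  have bc: "b \<in> carrier_mat n n" using borel_SL[OF b] carrier_SL by blast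
  have be: "b $$ (r, w k) = A $$ (r, f k)" if "r < n" "k < d" for r k
    using that d w_less[of k] unfolding b_def
    by (auto simp: rescale_column_def b0_def iw w_eq_iff)
  have S: "b * signed_perm n w d \<in> carrier (SL n)"
    using SL_mult[OF borel_SL[OF b] signed_perm_SL[OF w d]] .
  have "pt (b * signed_perm n w d) = pt A"
  proof (rule coset_eqI[OF S A, where Q = "\<lambda>s k. if s = g k then 1 else 0"])
    fix r k assume rk: "r < n" "k < d"
    then show "A $$ (r, k) = (\<Sum>s<d. (b * signed_perm n w d) $$ (r, s) * (if s = g k then 1 else 0))"
      using d g[OF rk(2)] by (simp add: index_mult_signed_perm[OF bc w] be if_distrib[of "\<lambda>u. _ * u"] del: index_mult_mat
          cong: if_cong)
  qed (use d in simp)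
  then show ?thesis using cell_signed_perm[OF d b] by simp
qed

text \<open>The free entries of the reduced column echelon form with pivot rows
  \<open>w 0, ..., w (d - 1)\<close>; they correspond to the boxes of the Young diagram.\<close>

definition positions :: "(nat \<times> nat) set" where
  "positions = {(j, k). k < d \<and> j < w k \<and> j \<notin> w ` {..<d}}"

lemma finite_positions: "finite positions"
proof (rule finite_subset)
  show "positions \<subseteq> {..<n} \<times> {..<d}" using w_less d by (auto simp: positions_def) (meson less_trans)
qed simp

definition chart_entry :: "(nat \<times> nat \<Rightarrow> complex) \<Rightarrow> nat \<Rightarrow> nat \<Rightarrow> complex" where
  "chart_entry y r k = (if r = w k then 1 else if (r, k) \<in> positions then y (r, k) else 0)"

lemma chart_entry_w: "i < d \<Longrightarrow> k < d \<Longrightarrow> chart_entry y (w i) k = (if i = k then 1 else 0)"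
  by (auto simp: chart_entry_def positions_def w_eq_iff)

lemma chart_entry_zero: "w k < r \<Longrightarrow> chart_entry y r k = 0"
  by (auto simp: chart_entry_def positions_def)

text \<open>For \<open>k \<ge> d\<close> there are no positions, so \<open>chart_entry\<close>
  yields a unit column there. The left factor is therefore unipotent upper triangular, which gives
  determinant 1 and the completion of the echelon form in one stroke.\<close>

definition chart_mat :: "(nat \<times> nat \<Rightarrow> complex) \<Rightarrow> complex mat" where
  "chart_mat y = mat n n (\<lambda>(r, j). chart_entry y r (inv_into UNIV w j)) * signed_perm n w d"

lemma chart_mat_SL: "chart_mat y \<in> carrier (SL n)"
  and chart_mat_entry: "r < n \<Longrightarrow> k < d \<Longrightarrow> chart_mat y $$ (r, k) = chart_entry y r k"
proof -
  let ?b = "mat n n (\<lambda>(r, j). chart_entry y r (inv_into UNIV w j))"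
  have wi: "w (inv_into UNIV w j) = j" for j using permutes_inverses(1)[OF w] by simp
  have iw: "inv_into UNIV w (w j) = j" for j using permutes_inverses(2)[OF w] by simp
  have b: "?b \<in> carrier_mat n n" by simp
  have ut: "upper_triangular ?b"
    unfolding upper_triangular_def using chart_entry_zero[of "inv_into UNIV w _"] wi by auto
  have "(\<Prod>i=0..<n. ?b $$ (i, i)) = 1"
    by (rule prod.neutral) (auto simp: chart_entry_def wi)
  then have "det ?b = 1" using det_upper_triangular[OF ut b] by (simp add: prod_list_diag_prod)
  then have "?b \<in> carrier (SL n)" by (simp add: carrier_SL)
  then show "chart_mat y \<in> carrier (SL n)"
    unfolding chart_mat_def using SL_mult signed_perm_SL[OF w d] by blast
  show "chart_mat y $$ (r, k) = chart_entry y r k" if "r < n" "k < d"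
    unfolding chart_mat_def using that d w_less[of k]
    by (subst index_mult_signed_perm[OF b w]) (auto simp: iw)
qed

lemma chart_in_cell: "pt (chart_mat y) \<in> cell"
  by (rule in_cellI[OF chart_mat_SL, where f = id])
    (use w_less d in \<open>auto simp: chart_mat_entry chart_entry_w chart_entry_zero\<close>)

text \<open>The submatrix on the pivot rows is triangular and invertible; multiplying the columns by
  its inverse yields the reduced echelon form.\<close>

lemma cell_chart:
  assumes "x \<in> cell"
  shows "\<exists>y. x = pt (chart_mat y)"
proof -
  obtain b where b: "b \<in> borel_subgroup n" and x: "x = pt (b * signed_perm n w 0)"
    and A: "b * signed_perm n w 0 \<in> carrier (SL n)" using assms by (rule cellE)
  let ?A = "b * signed_perm n w 0"
  have bc: "b \<in> carrier_mat n n" using borel_SL[OF b] carrier_SL by blast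
  have e: "?A $$ (r, k) = b $$ (r, w k) * (if k = 0 then of_int (sign w) else 1)" if "r < n" "k < d" for r k
    using index_mult_signed_perm[OF bc w] that d by simp
  have Az: "?A $$ (r, k) = 0" if "w k < r" "r < n" "k < d" for r k
    using e[OF that(2,3)] borel_zero[OF b that(1,2)] by simp
  have nz: "?A $$ (w i, i) \<noteq> 0" if "i < d" for i
    using e[of "w i" i] borel_diag_nonzero[OF b w_less[of i]] w_less[of i] that d by (simp add: sign_def)
  have Lz: "?A $$ (w i, k) = 0" if "k < i" "i < d" for i k
    using that d w_less[of i] w_mono[OF that] by (intro Az) auto
  obtain Q where Q: "\<And>i k. i < d \<Longrightarrow> k < d \<Longrightarrow> (\<Sum>s<d. ?A $$ (w i, s) * Q s k) = (if i = k then 1 else 0)"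
    "\<And>s k. k < s \<Longrightarrow> s < d \<Longrightarrow> Q s k = 0"
    using upper_triangular_right_inverse[of d "\<lambda>i k. ?A $$ (w i, k)", OF Lz nz] by blast
  define y where "y = (\<lambda>(r, k). \<Sum>s<d. ?A $$ (r, s) * Q s k)"
  have "pt ?A = pt (chart_mat y)"
  proof (rule coset_eqI[OF A chart_mat_SL])
    show "d \<le> n" using d by simp
    fix r k assume rk: "r < n" "k < d"
    show "chart_mat y $$ (r, k) = (\<Sum>s<d. ?A $$ (r, s) * Q s k)"
      unfolding chart_mat_entry[OF rk]
    proof (cases "r \<in> w ` {..<d}")
      case True
      then obtain i where i: "i < d" "r = w i" by auto
      then show "chart_entry y r k = (\<Sum>s<d. ?A $$ (r, s) * Q s k)"
        using Q(1)[OF i(1) rk(2)] chart_entry_w[OF i(1) rk(2)] by simp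
    next
      case False
      show "chart_entry y r k = (\<Sum>s<d. ?A $$ (r, s) * Q s k)"
      proof (cases "r < w k")
        case True
        then have "(r, k) \<in> positions" using False rk by (simp add: positions_def)
        then show ?thesis using True by (simp add: chart_entry_def y_def)
      next
        case nl: False
        then have "w k < r" using False rk by (metis image_eqI lessThan_iff linorder_neqE_nat)
        moreover have "?A $$ (r, s) * Q s k = 0" if s: "s < d" for s
        proof (cases "k < s")
          case False
          then have "w s \<le> w k" using w_mono[of s k] rk by (cases "s = k") auto
          then show ?thesis using Az[of s r] \<open>w k < r\<close> rk s by simp
        qed (use Q(2) s in simp)
        then have "(\<Sum>s<d. ?A $$ (r, s) * Q s k) = 0" by (intro sum.neutral) auto
        ultimately show ?thesis using chart_entry_zero by metis
      qed
    qed
  qed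
  then show ?thesis using x by blast
qed

section \<open>The Schubert variety and its dense affine chart\<close>

abbreviation variety where "variety \<equiv> schubert_variety n d w"

lemma points_variety: "points variety = ftop gr closure_of cell"
  unfolding schubert_variety_def by (simp add: inf_absorb2 closure_of_subset_topspace)

lemma cell_subset: "cell \<subseteq> points variety"
  unfolding points_variety by (rule closure_of_subset[OF cell_points])

lemma function_sheaf_variety: "function_sheaf variety"
  unfolding schubert_variety_def by (intro function_sheaf_sub function_sheaf_grassmannian)

lemma morphism_varietyI:
  "function_sheaf X \<Longrightarrow> morphism X gr \<phi> \<Longrightarrow> (\<And>x. x \<in> points X \<Longrightarrow> \<phi> x \<in> points variety) \<Longrightarrow> morphism X variety \<phi>"
  unfolding points_variety unfolding schubert_variety_def by (rule morphism_into_sub)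

lemma morphism_chart: "morphism (affine_space positions) variety (\<lambda>y. pt (chart_mat y))"
proof (rule morphism_varietyI[OF function_sheaf_quasi_affine])
  show "morphism (affine_space positions) gr (\<lambda>y. pt (chart_mat y))"
  proof (rule morphism_grassmannianI[OF function_sheaf_quasi_affine d, where a = chart_entry])
    fix r k
    have "(\<lambda>y. chart_entry y r k) \<in> polyfuns (coordinate_functions positions)"
      unfolding chart_entry_def coordinate_functions_def
      by (cases "r = w k"; cases "(r, k) \<in> positions") (auto intro: polyfuns.const polyfuns.coord)
    then show "(\<lambda>y. chart_entry y r k) \<in> sections (affine_space positions) (points (affine_space positions))"
      by (rule polyfuns_section) (metis ftop_quasi_affine openin_topspace)
  qed (use chart_mat_SL chart_mat_entry in blast)
qed (use chart_in_cell cell_subset in blast)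

lemma chart_dense: "ftop variety closure_of range (\<lambda>y. pt (chart_mat y)) = points variety"
proof -
  have "range (\<lambda>y. pt (chart_mat y)) = cell" using chart_in_cell cell_chart by blast
  moreover have "ftop variety closure_of cell = points variety"
    using cell_subset points_variety unfolding schubert_variety_def
    by (simp add: closure_of_subtopology inf_absorb2 inf_absorb1)
  ultimately show ?thesis by simp
qed

text \<open>Exchanging a single pivot row isolates one entry of the echelon form, so the coordinates
  of the chart are Pluecker coordinates.\<close>

lemma minor_chart:
  assumes "k < d" "j < n"
  shows "minor d (w(k := j)) (chart_mat y) = chart_entry y j k"
proof -
  have "mat d d (\<lambda>(i, c). chart_mat y $$ ((w(k := j)) i, c)) =
      mat d d (\<lambda>(i, c). if i = k then chart_entry y j c else if i = c then 1 else 0)"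
    using assms d w_less by (intro eq_matI) (auto simp: chart_mat_entry chart_entry_w)
  then show ?thesis unfolding minor_def using det_row_replaced[OF assms(1)] by simp
qed

end

section \<open>Toric Schubert varieties\<close>

lemma det_rows_scaled:
  "det (mat d d (\<lambda>(i, k). c i * a i k)) = (\<Prod>i<d. c i) * det (mat d d (\<lambda>(i, k). a i k :: complex))"
proof -
  have "det (mat d d (\<lambda>(i, k). c i * a i k)) =
      (\<Sum>p\<in>{p. p permutes {0..<d}}. signof p * (\<Prod>i=0..<d. c i * a i (p i)))"
    by (subst det_def'[of _ d])
      (auto intro!: sum.cong prod.cong arg_cong2[where f="(*)"] dest: permutes_in_image)
  also have "\<dots> = (\<Prod>i<d. c i) * (\<Sum>p\<in>{p. p permutes {0..<d}}. signof p * (\<Prod>i=0..<d. a i (p i)))"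
    by (simp add: prod.distrib sum_distrib_left lessThan_atLeast0 mult.left_commute)
  also have "(\<Sum>p\<in>{p. p permutes {0..<d}}. signof p * (\<Prod>i=0..<d. a i (p i))) = det (mat d d (\<lambda>(i, k). a i k))"
    by (subst det_def'[of _ d])
      (auto intro!: sum.cong prod.cong arg_cong2[where f="(*)"] dest: permutes_in_image)
  finally show ?thesis .
qed

lemma minor_torus:
  assumes t: "t \<in> diag_torus n" and A: "A \<in> carrier_mat n n" and d: "d \<le> n" and J: "\<And>i. i < d \<Longrightarrow> J i < n"
  shows "minor d J (t * A) = (\<Prod>i<d. t $$ (J i, J i)) * minor d J A"
proof -
  have tc: "t \<in> carrier_mat n n" and td: "diagonal_mat t" using t by (auto simp: diag_torus_def carrier_SL)
  have e: "(t * A) $$ (r, k) = t $$ (r, r) * A $$ (r, k)" if rk: "r < n" "k < n" for r k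
  proof -
    have "(t * A) $$ (r, k) = (\<Sum>j<n. if j = r then t $$ (r, r) * A $$ (r, k) else 0)"
      unfolding index_mult_square[OF tc A rk] using td tc rk by (intro sum.cong) (auto simp: diagonal_mat_def)
    then show ?thesis using rk by simp
  qed
  have "mat d d (\<lambda>(i, k). (t * A) $$ (J i, k)) = mat d d (\<lambda>(i, k). t $$ (J i, J i) * A $$ (J i, k))"
    using J d by (intro eq_matI) (auto simp: e simp del: index_mult_mat(1))
  then show ?thesis unfolding minor_def using det_rows_scaled[of d "\<lambda>i. t $$ (J i, J i)" "\<lambda>i k. A $$ (J i, k)"] by simp
qed

context schubert
begin

lemma w_gap: "i \<le> j \<Longrightarrow> j < d \<Longrightarrow> w i + (j - i) \<le> w j"
proof (induction j)
  case (Suc j)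
  then show ?case
  proof (cases "i = Suc j")
    case False
    then show ?thesis using Suc w_mono[of j "Suc j"] by simp
  qed simp
qed simp

text \<open>Homogeneity under the parabolic subgroup makes vanishing of \<open>f\<close> a closed
  condition on cosets. It therefore passes from a dense torus orbit to the whole variety, in
  particular to the cell.\<close>

lemma toric_vanishing:
  assumes A0: "A0 \<in> carrier (SL n)"
    and dense: "points variety \<subseteq> ftop gr closure_of ((\<lambda>t. t <#\<^bsub>SL n\<^esub> pt A0) ` diag_torus n)"
    and f: "f \<in> sections (SL_space n) (carrier (SL n))"
    and hom: "\<And>A h. A \<in> carrier (SL n) \<Longrightarrow> h \<in> parabolic n d \<Longrightarrow> f (A * h) = \<chi> h * f A"
    and z: "\<And>t. t \<in> diag_torus n \<Longrightarrow> f (t * A0) = 0"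
  shows "f (chart_mat y) = 0"
proof (rule closure_vanishing[where F = "{f}" and n = n and d = d and f = f and A = "chart_mat y"])
  show "g (A * h) = 0"
    if "A \<in> carrier (SL n)" "h \<in> parabolic n d" "\<forall>g\<in>{f}. g A = 0" "g \<in> {f}" for A h g
    using hom[OF that(1,2)] that(3,4) by simp
  show "chart_mat y \<in> carrier (SL n)" by (rule chart_mat_SL)
  show "pt (chart_mat y) \<in> ftop gr closure_of ((\<lambda>t. t <#\<^bsub>SL n\<^esub> pt A0) ` diag_torus n)"
    using dense cell_subset chart_in_cell by blast
  fix A g assume A: "A \<in> carrier (SL n)" "pt A \<in> (\<lambda>t. t <#\<^bsub>SL n\<^esub> pt A0) ` diag_torus n" and g: "g \<in> {f}"
  then obtain t where t: "t \<in> diag_torus n" "pt A = t <#\<^bsub>SL n\<^esub> pt A0" by auto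
  have tS: "t \<in> carrier (SL n)" using t(1) by (simp add: diag_torus_def)
  have "t <#\<^bsub>SL n\<^esub> pt A0 = (\<lambda>h. t * (A0 * h)) ` parabolic n d"
    unfolding coset_eq by (auto simp: l_coset_def mult_SL)
  also have "\<dots> = pt (t * A0)"
    unfolding coset_eq
  proof (rule image_cong[OF refl])
    fix h assume "h \<in> parabolic n d"
    then have "h \<in> carrier_mat n n" using parabolic_SL carrier_SL by blast
    then show "t * (A0 * h) = t * A0 * h"
      using tS A0 by (simp add: carrier_SL assoc_mult_mat[of t n n A0 n h n])
  qed
  finally have eq: "pt (t * A0) = pt A" using t(2) by simp
  obtain h where "h \<in> parabolic n d" "A = t * A0 * h"
    by (rule coset_eqD[OF SL_mult[OF tS A0] A(1) eq])
  then show "g A = 0" using hom[OF SL_mult[OF tS A0]] z[OF t(1)] g by simp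
qed (use f in auto)

text \<open>
  If the Young diagram of \<open>w\<close> contains a \<open>2 \<times> 2\<close> square, two products of minors have the same
  torus weight, hence are proportional on a torus orbit, but they are independent on the cell.
\<close>

lemma toric_imp_hook:
  assumes d2: "2 \<le> d" and toric: "toric_variety (diag_torus n) (\<lambda>t x. t <#\<^bsub>SL n\<^esub> x) variety"
  shows "w (d - 2) < d"
proof (rule ccontr)
  assume big: "\<not> w (d - 2) < d"
  define k where "k = d - 2"
  define l where "l = d - 1"
  have kl: "k < d" "l < d" "k \<noteq> l" "k < l" using d2 by (auto simp: k_def l_def)
  \<comment> \<open>Nonpivot rows before the pivot row of column \<open>k\<close>. There are at
    least \<open>w k - k \<ge> 2\<close> of them, and they also precede the larger pivot row of
    column \<open>l\<close>; two of them give the four boxes of a square.\<close>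
  let ?Z = "{..<w k} - w ` {..<k}"
  have "card (w ` {..<k}) \<le> k" using card_image_le[of "{..<k}" w] by simp
  then have "w k - k \<le> card ?Z" using diff_card_le_card_Diff[of "w ` {..<k}" "{..<w k}"] by simp
  then have "2 \<le> card ?Z" using big d2 by (simp add: k_def)
  then obtain j1 j2 where j: "j1 \<in> ?Z" "j2 \<in> ?Z" "j1 \<noteq> j2"
    by (metis card_le_Suc0_iff_eq finite_Diff finite_lessThan not_less_eq_eq numeral_2_eq_2)
  have jI: "j \<notin> w ` {..<d}" if "j \<in> ?Z" for j
  proof
    assume "j \<in> w ` {..<d}"
    then obtain i where i: "i < d" "j = w i" by auto
    then have "i < k" using that w_less_iff[of i k] kl by simp
    then show False using that i by auto
  qed
  have pos: "(j, k) \<in> positions" "(j, l) \<in> positions" if "j \<in> ?Z" for j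
    using that jI[OF that] kl w_mono[of k l] by (auto simp: positions_def)
  have jn: "j1 < n" "j2 < n" using j w_less[of k] kl d by auto
  have jw: "j1 \<noteq> w i" "j2 \<noteq> w i" if "i < d" for i using jI j that by auto
  define P where "P i j = minor d (w(i := j))" for i j
  have J: "(w(a := b)) i < n" if "b < n" "i < d" for a b i using that w_less[of i] d by simp
  have Preg: "P i j \<in> sections (SL_space n) (carrier (SL n))" if "j < n" for i j
    unfolding P_def using d J[OF that] by (intro minor_regular) auto
  let ?det = "\<lambda>h. det (mat d d (\<lambda>(i, k). h $$ (i, k)))"
  have Phom: "P i j (A * h) = P i j A * ?det h"
    if "j < n" "A \<in> carrier (SL n)" "h \<in> parabolic n d" for i j A h
    unfolding P_def
    by (rule minor_mult[OF _ that(3) _ J[OF that(1)]]) (use that(2) d in \<open>auto simp: carrier_SL\<close>)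
  have Pchart: "P i j (chart_mat y) = y (j, i)" if "i \<in> {k, l}" "j \<in> {j1, j2}" for i j y
  proof -
    have "i < d" "j < n" "(j, i) \<in> positions" "j \<noteq> w i" using that kl jn pos j jw by auto
    then show ?thesis unfolding P_def by (simp add: minor_chart chart_entry_def)
  qed
  obtain x where x: "x \<in> points variety" and
    dense: "ftop variety closure_of ((\<lambda>t. t <#\<^bsub>SL n\<^esub> x) ` diag_torus n) = points variety"
    using toric unfolding toric_variety_def by blast
  have "x \<in> points gr"
    using x closure_of_subset_topspace[of "ftop gr" cell] unfolding points_variety by blast
  then obtain A0 where A0: "A0 \<in> carrier (SL n)" "x = pt A0" unfolding points_grassmannian by blast
  have sub: "points variety \<subseteq> ftop gr closure_of ((\<lambda>t. t <#\<^bsub>SL n\<^esub> pt A0) ` diag_torus n)"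
    using closure_of_subtopology_subset[of "ftop gr" _ "(\<lambda>t. t <#\<^bsub>SL n\<^esub> pt A0) ` diag_torus n"]
    unfolding dense[symmetric] A0(2) unfolding schubert_variety_def ftop_sub .
  have A0c: "A0 \<in> carrier_mat n n" using A0(1) carrier_SL by blast
  define a where "a = P k j1 A0 * P l j2 A0"
  define b where "b = P k j2 A0 * P l j1 A0"
  \<comment> \<open>Both products have the same torus weight, so a linear relation between their
    values at \<open>A0\<close> holds along the orbit and hence on the cell.\<close>
  have van: "c1 * (y (j1, k) * y (j2, l)) + c2 * (y (j2, k) * y (j1, l)) = 0"
    if c: "c1 * a + c2 * b = 0" for c1 c2 y
  proof -
    let ?f = "\<lambda>A. c1 * (P k j1 A * P l j2 A) + c2 * (P k j2 A * P l j1 A)"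
    have "?f (chart_mat y) = 0"
    proof (rule toric_vanishing[OF A0(1) sub, where f = ?f and \<chi> = "\<lambda>h. ?det h * ?det h"])
      note O = function_sheaf_quasi_affine openin_SL
      show "?f \<in> sections (SL_space n) (carrier (SL n))"
        by (intro sheaf_add[OF O] sheaf_mult[OF O] sheaf_const[OF O] Preg jn)
      show "?f (A * h) = (?det h * ?det h) * ?f A" if "A \<in> carrier (SL n)" "h \<in> parabolic n d" for A h
        by (simp only: Phom[OF jn(1) that] Phom[OF jn(2) that]) (simp add: algebra_simps)
      fix t assume t: "t \<in> diag_torus n"
      define T where "T = (\<Prod>i\<in>{..<d} - {k}. t $$ (w i, w i)) * (\<Prod>i\<in>{..<d} - {l}. t $$ (w i, w i))"
      have Pt: "P i j (t * A0) = t $$ (j, j) * (\<Prod>i\<in>{..<d} - {i}. t $$ (w i, w i)) * P i j A0"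
        if "i < d" "j < n" for i j
      proof -
        have "P i j (t * A0) = (\<Prod>s<d. t $$ ((w(i := j)) s, (w(i := j)) s)) * P i j A0"
          unfolding P_def by (rule minor_torus[OF t A0c _ J[OF that(2)]]) (use d in auto)
        also have "(\<Prod>s<d. t $$ ((w(i := j)) s, (w(i := j)) s)) = t $$ (j, j) * (\<Prod>i\<in>{..<d} - {i}. t $$ (w i, w i))"
          using that by (subst prod.remove[of _ i]) auto
        finally show ?thesis .
      qed
      have "?f (t * A0) = t $$ (j1, j1) * t $$ (j2, j2) * T * (c1 * a + c2 * b)"
        unfolding Pt[OF kl(1) jn(1)] Pt[OF kl(1) jn(2)] Pt[OF kl(2) jn(1)] Pt[OF kl(2) jn(2)] T_def a_def b_def
        by (simp add: algebra_simps)
      then show "?f (t * A0) = 0" using c by simp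
    qed
    then show ?thesis using Pchart by simp
  qed
  \<comment> \<open>Each test point makes exactly one of the two products nonzero. The relation with
    coefficients \<open>b\<close> and \<open>- a\<close> then forces \<open>a = b = 0\<close>, after
    which every pair of coefficients is a relation.\<close>
  let ?y1 = "\<lambda>p. if p = (j1, k) \<or> p = (j2, l) then 1 else 0 :: complex"
  let ?y2 = "\<lambda>p. if p = (j2, k) \<or> p = (j1, l) then 1 else 0 :: complex"
  have "b = 0" using van[of b "- a" ?y1] j(3) kl(3) by simp
  have "a = 0" using van[of b "- a" ?y2] j(3) kl(3) by auto
  then show False using van[of 1 0 ?y1] \<open>b = 0\<close> j(3) by simp
qed


section \<open>Singular hooks\<close>

text \<open>Here \<open>w\<close> fixes the indices before \<open>m\<close>, shifts
  \<open>m, ..., d - 2\<close> up by one and sends \<open>d - 1\<close> to \<open>e\<close>. The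
  hook has \<open>(d - 1 - m) + (e - d + 1)\<close> boxes, whereas all
  \<open>(e - d + 1) * (d - m)\<close> matrix units in rows \<open>d, ..., e\<close> and columns
  \<open>m, ..., d - 1\<close> are tangent at the base point.\<close>

lemma hook_imp_not_smooth:
  assumes d2: "2 \<le> d" and w2: "w (d - 2) = d - 1" and w1: "d < w (d - 1)"
  shows "\<not> smooth_variety variety"
proof
  assume smooth: "smooth_variety variety"
  define e where "e = w (d - 1)"
  define m where "m = (LEAST m. w m \<noteq> m)"
  have m1: "w m \<noteq> m" unfolding m_def by (rule LeastI[of _ "d - 2"]) (use w2 d2 in simp)
  have m2: "m \<le> d - 2" unfolding m_def by (rule Least_le) (use w2 d2 in simp)
  have wlow: "w k = k" if "k < m" for k using not_less_Least[of k "\<lambda>m. w m \<noteq> m"] that unfolding m_def by blast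
  have whigh: "w k = Suc k" if "m \<le> k" "k \<le> d - 2" for k
  proof -
    have "m < d" using m2 d2 by simp
    then have "m < w m" using w_ge[of m] m1 by simp
    moreover have kd: "k < d" using that d2 by linarith
    then have "w m + (k - m) \<le> w k" using w_gap[OF that(1)] by blast
    ultimately have "Suc k \<le> w k" using that by linarith
    moreover have "d - 2 < d" using d2 by simp
    then have "w k + (d - 2 - k) \<le> w (d - 2)" by (rule w_gap[OF that(2)])
    ultimately show ?thesis using that d2 w2 by linarith
  qed
  have e: "d < e" "e < n" using w1 w_less[of "d - 1"] d d2 by (auto simp: e_def)

  have "positions \<subseteq> {m} \<times> {m..<d - 1} \<union> (insert m {d..<e}) \<times> {d - 1}"
  proof
    fix p assume "p \<in> positions"
    then obtain j k where p: "p = (j, k)" "k < d" "j < w k" and jI: "\<And>i. i < d \<Longrightarrow> j \<noteq> w i"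
      by (auto simp: positions_def)
    have low: "m = j" if "j < d"
    proof (rule ccontr)
      assume "m \<noteq> j"
      then consider "j < m" | "m < j" by linarith
      then show False
      proof cases
        case 1
        then show False using jI[of j] wlow[of j] that by simp
      next
        case 2
        then have "m \<le> j - 1" "j - 1 \<le> d - 2" "j - 1 < d" "Suc (j - 1) = j" using that by linarith+
        then show False using jI[of "j - 1"] whigh[of "j - 1"] by simp
      qed
    qed
    consider "k < m" | "m \<le> k" "k \<le> d - 2" | "k = d - 1" using p(2) by linarith
    then show "p \<in> {m} \<times> {m..<d - 1} \<union> (insert m {d..<e}) \<times> {d - 1}"
    proof cases
      case 1
      then show ?thesis using jI[of j] wlow[of k] wlow[of j] p by simp
    next
      case 2
      then show ?thesis using low whigh[of k] p d2 by auto
    next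
      case 3
      then show ?thesis using low p by (auto simp: e_def)
    qed
  qed
  then have "card positions \<le> card ({m} \<times> {m..<d - 1} \<union> (insert m {d..<e}) \<times> {d - 1})"
    by (rule card_mono[rotated]) simp
  also have "\<dots> \<le> card ({m} \<times> {m..<d - 1}) + card ((insert m {d..<e}) \<times> {d - 1})"
    by (rule card_Un_le)
  also have "\<dots> \<le> (d - 1 - m) + Suc (e - d)"
    by (simp add: card_cartesian_product card_insert_if)
  finally have card_le: "card positions \<le> (d - 1 - m) + Suc (e - d)" .

  \<comment> \<open>The line through the identity in direction \<open>(j, i)\<close>, deformed by
    \<open>s\<close> in the entries \<open>(e, i)\<close> and \<open>(i, m)\<close>. For general
    \<open>s\<close> this gives column \<open>i\<close> the pivot row \<open>e\<close> and column
    \<open>m\<close> the pivot row \<open>i\<close>, as the cell requires.\<close>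
  define u where "u j i t s r k = (if r = k then 1 else 0) + (if r = j \<and> k = i then t else 0)
      + (if r = e \<and> k = i then s else 0) + (if r = i \<and> k = m \<and> i \<noteq> m then s else (0::complex))"
    for j i :: nat and t s and r k :: nat
  define U where "U j i t s = mat n n (\<lambda>(r, k). u j i t s r k)" for j i t s
  let ?K = "{d..e} \<times> {m..<d}"
  have US: "U j i t s \<in> carrier (SL n)" if "(j, i) \<in> ?K" for j i t s
  proof -
    have c: "U j i t s \<in> carrier_mat n n" by (simp add: U_def)
    have "det (U j i t s) = prod_list (diag_mat (U j i t s))"
      by (rule det_lower_triangular[OF _ c]) (use that e in \<open>auto simp: U_def u_def\<close>)
    also have "\<dots> = (\<Prod>r=0..<n. 1)"
      unfolding prod_list_diag_prod by (rule prod.cong) (use that e in \<open>auto simp: U_def u_def\<close>)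
    finally show ?thesis using c by (simp add: carrier_SL)
  qed
  \<comment> \<open>Either parameter may be the one that varies: \<open>s\<close> for the limit that
    enters the variety, \<open>t\<close> for the tangent direction.\<close>
  have curve: "morphism affine_line gr (\<lambda>x. pt (U j i (p x) (q x)))"
    if "(j, i) \<in> ?K" and pq: "p \<in> polyfuns {\<lambda>t. t}" "q \<in> polyfuns {\<lambda>t. t}" for j i p q
  proof (rule morphism_grassmannianI[OF function_sheaf_quasi_affine d, where a = "\<lambda>x. u j i (p x) (q x)"])
    fix r k assume "r < n" "k < d"
    have cond: "(\<lambda>x. if C then g x else 0) \<in> polyfuns {\<lambda>t. t}" if "g \<in> polyfuns {\<lambda>t. t}" for C g
      using that by (cases C) (simp_all add: polyfuns.const)
    have "(\<lambda>x. u j i (p x) (q x) r k) \<in> polyfuns {\<lambda>t. t}"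
      unfolding u_def by (intro polyfuns.add polyfuns.const cond pq)
    then show "(\<lambda>x. u j i (p x) (q x) r k) \<in> sections affine_line (points affine_line)"
      by (rule polyfuns_section) (metis ftop_quasi_affine openin_topspace)
  next
    fix x
    show "\<exists>A\<in>carrier (SL n). pt (U j i (p x) (q x)) = pt A \<and> (\<forall>r<n. \<forall>k<d. A $$ (r, k) = u j i (p x) (q x) r k)"
      by (rule bexI[OF _ US[OF that(1), of "p x" "q x"]]) (use d in \<open>simp add: U_def\<close>)
  qed
  \<comment> \<open>If \<open>j = e\<close>, the pivot entry of column \<open>i\<close> is
    \<open>t + s\<close>; this is why \<open>- t\<close> is excluded as well as 0.\<close>
  have in_cell: "pt (U j i t s) \<in> cell" if ji: "(j, i) \<in> ?K" and s: "s \<notin> {0, - t}" for j i t s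
  proof -
    \<comment> \<open>The column whose pivot row is \<open>w k\<close>: column \<open>i\<close> for
      row \<open>e\<close>, column \<open>m\<close> for row \<open>i\<close>, and otherwise the
      column numbered like the row.\<close>
    define f where "f k = (if k < m then k else if k = d - 1 then i else if Suc k = i then m else Suc k)" for k
    have ji': "d \<le> j" "j \<le> e" "m \<le> i" "i < d" using ji by auto
    have key: "u j i t s (w k) (f k) \<noteq> 0 \<and> (\<forall>r>w k. u j i t s r (f k) = 0) \<and> f k < d" if k: "k < d" for k
    proof -
      consider "k < m" | "k = d - 1" | "m \<le> k" "k < d - 1" "Suc k = i" | "m \<le> k" "k < d - 1" "Suc k \<noteq> i"
        using k by linarith
      then show ?thesis
      proof cases
        case 1
        then show ?thesis using wlow[OF 1] ji' e m2 k by (auto simp: f_def u_def)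
      next
        case 2
        moreover have "t + s \<noteq> 0" using s by (auto simp: add_eq_0_iff)
        moreover have "\<not> k < m" using 2 m2 d2 by simp
        ultimately show ?thesis using ji' e s by (auto simp: f_def u_def e_def)
      next
        case 3
        then have "w k = i" "f k = m" using whigh[of k] by (auto simp: f_def)
        then show ?thesis using 3 ji' e s k by (auto simp: u_def)
      next
        case 4
        then have "w k = Suc k" "f k = Suc k" using whigh[of k] by (auto simp: f_def)
        then show ?thesis using 4 ji' e k by (auto simp: u_def)
      qed
    qed
    show ?thesis
    proof (rule in_cellI[OF US[OF ji], where f = f])
      fix k assume k: "k < d"
      show "f k < d" using key[OF k] by simp
      have n: "w k < n" "f k < n" using k d w_less[of k] key[OF k] by auto
      show "U j i t s $$ (w k, f k) \<noteq> 0" using key[OF k] n by (simp add: U_def)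
      show "U j i t s $$ (r, f k) = 0" if "w k < r" "r < n" for r using key[OF k] n that by (simp add: U_def)
    qed
  qed
  have in_variety: "pt (U j i t 0) \<in> points variety" if ji: "(j, i) \<in> ?K" for j i t
  proof -
    have "morphism affine_line gr (\<lambda>s. pt (U j i t s))"
      using curve[OF ji polyfuns.const[of t] polyfuns.coord[of "\<lambda>t. t"]] by simp
    then show ?thesis unfolding points_variety
      by (rule curve_limit[of _ _ "{0, - t}" _ 0]) (use in_cell[OF ji] in auto)
  qed
  have U0: "U j i 0 0 = 1\<^sub>m n" for j i unfolding U_def u_def by (intro eq_matI) auto
  define x where "x = pt (1\<^sub>m n)"
  have "(d, m) \<in> ?K" using e m2 d2 by auto
  then have x: "x \<in> points variety" using in_variety[of d m 0] U0 unfolding x_def by simp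

  \<comment> \<open>The affine coordinate \<open>(l, k)\<close> around the base point. A ratio of
    minors does not depend on the representative chosen by \<open>SOME\<close>.\<close>
  define z where "z l k q = (let A = (SOME A. A \<in> carrier (SL n) \<and> pt A = q) in
      minor d (id(k := l)) A / minor d id A)" for l k q
  have zpt: "z l k (pt A) = minor d (id(k := l)) A / minor d id A" if A: "A \<in> carrier (SL n)" and l: "l < n" for l k A
  proof -
    define B where "B = (SOME B. B \<in> carrier (SL n) \<and> pt B = pt A)"
    have B: "B \<in> carrier (SL n)" "pt B = pt A"
      using someI[of "\<lambda>B. B \<in> carrier (SL n) \<and> pt B = pt A" A] A unfolding B_def by auto
    obtain h where h: "h \<in> parabolic n d" "B = A * h" by (rule coset_eqD[OF A B(1) B(2)[symmetric]])
    have Ac: "A \<in> carrier_mat n n" using A carrier_SL by blast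
    have dn: "d \<le> n" using d by simp
    have J: "(id(k := l)) i < n" "id i < n" if "i < d" for i using that l d by auto
    have "z l k (pt A) = minor d (id(k := l)) B / minor d id B"
      unfolding z_def B_def Let_def ..
    moreover have "minor d (id(k := l)) B = minor d (id(k := l)) A * det (mat d d (\<lambda>(i, k). h $$ (i, k)))"
      unfolding h(2) by (rule minor_mult[OF Ac h(1) dn J(1)])
    moreover have "minor d id B = minor d id A * det (mat d d (\<lambda>(i, k). h $$ (i, k)))"
      unfolding h(2) by (rule minor_mult[OF Ac h(1) dn J(2)])
    ultimately show ?thesis using parabolic_block_nonzero[OF h(1) dn] by simp
  qed
  let ?\<Omega> = "pt ` {A \<in> carrier (SL n). minor d id A \<noteq> 0}"
  have dn: "d \<le> n" using d by simp
  have mreg: "minor d id \<in> sections (SL_space n) (carrier (SL n))" using d by (intro minor_regular) auto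
  have minv: "minor d id A \<noteq> 0" if "A \<in> carrier (SL n)" "h \<in> parabolic n d" "minor d id (A * h) \<noteq> 0" for A h
    using that minor_mult[of A n h d id] d by (auto simp: carrier_SL)
  have \<Omega>: "openin (ftop gr) ?\<Omega>"
    by (rule openin_grassmannian_nonzero(1)[OF mreg]) (rule minv)
  have in_\<Omega>: "pt A \<in> ?\<Omega> \<longleftrightarrow> minor d id A \<noteq> 0" if "A \<in> carrier (SL n)" for A
    by (rule openin_grassmannian_nonzero(2)[OF mreg _ that]) (rule minv)
  have id1: "minor d id (1\<^sub>m n) = 1"
  proof -
    have "mat d d (\<lambda>(i, k). 1\<^sub>m n $$ (id i, k)) = (1\<^sub>m d :: complex mat)" using d by (intro eq_matI) auto
    then show ?thesis unfolding minor_def by simp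
  qed
  have zloc: "z l k \<in> local_functions variety x" if l: "l < n" for l k
  proof -
    have "{A \<in> carrier (SL n). pt A \<in> ?\<Omega>} = {A \<in> carrier (SL n). minor d id A \<noteq> 0}" using in_\<Omega> by blast
    moreover have "z l k \<circ> pt \<in> sections (SL_space n) {A \<in> carrier (SL n). minor d id A \<noteq> 0}"
    proof -
      note X = function_sheaf_quasi_affine
      let ?V = "{A \<in> carrier (SL n). minor d id A \<noteq> 0}"
      have V: "openin (ftop (SL_space n)) ?V" by (rule sheaf_nonzero[OF X openin_SL mreg])
      have s1: "minor d (id(k := l)) \<in> sections (SL_space n) (carrier (SL n))"
        using d l by (intro minor_regular) auto
      have r: "minor d (id(k := l)) \<in> sections (SL_space n) ?V" "minor d id \<in> sections (SL_space n) ?V"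
        by (rule sheaf_restrict[OF X openin_SL s1 V], blast) (rule sheaf_restrict[OF X openin_SL mreg V], blast)
      have "(\<lambda>A. minor d (id(k := l)) A / minor d id A) \<in> sections (SL_space n) ?V"
        by (rule sheaf_divide[OF X V r]) auto
      then show ?thesis by (rule sheaf_cong[OF X V]) (simp add: zpt l)
    qed
    ultimately have "z l k \<in> sections gr ?\<Omega>" unfolding grassmannian_def sections_quotient by simp
    then have "z l k \<in> sections variety (?\<Omega> \<inter> points variety)"
      unfolding schubert_variety_def
      by (rule sections_sub_restrict[OF function_sheaf_grassmannian \<Omega>]) auto
    moreover have "openin (ftop variety) (?\<Omega> \<inter> points variety)"
      using \<Omega> unfolding points_variety unfolding schubert_variety_def by (auto simp: openin_subtopology)
    moreover have "x \<in> ?\<Omega>" unfolding x_def using id1 by (intro imageI) (simp add: carrier_SL)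
    ultimately show ?thesis unfolding local_functions_def using x by blast
  qed
  \<comment> \<open>The coordinates are dual to the lines: each is the parameter on its own line and
    zero on all the others.\<close>
  have zU: "z l k (pt (U j i t 0)) = (if (j, i) = (l, k) then t else 0)"
    if ji: "(j, i) \<in> ?K" and lk: "(l, k) \<in> ?K" for j i l k t
  proof -
    have lk': "k < d" "l < n" "d \<le> l" using lk e by auto
    have ji': "d \<le> j" "j < n" "i < d" using ji e by auto
    have "mat d d (\<lambda>(i', k'). U j i t 0 $$ ((id(k := l)) i', k')) =
        mat d d (\<lambda>(i', c). if i' = k then u j i t 0 l c else if i' = c then 1 else 0)"
      using lk' ji' d by (intro eq_matI) (auto simp: U_def u_def)
    then have "minor d (id(k := l)) (U j i t 0) = u j i t 0 l k"
      unfolding minor_def using det_row_replaced[OF lk'(1)] by simp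
    moreover have "mat d d (\<lambda>(i', k'). U j i t 0 $$ (id i', k')) = 1\<^sub>m d"
      using lk' ji' d by (intro eq_matI) (auto simp: U_def u_def)
    then have "minor d id (U j i t 0) = 1" unfolding minor_def by simp
    ultimately show ?thesis
      unfolding zpt[OF US[OF ji] lk'(2)] using lk' ji' by (auto simp: u_def)
  qed
  have "card ?K \<le> card positions"
  proof (rule regular_point_bound[OF function_sheaf_variety finite_positions morphism_chart chart_dense x,
        where c = "\<lambda>(j, i) t. pt (U j i t 0)" and z = "\<lambda>(l, k). z l k"])
    show "regular_local_ring (stalk variety x)" using smooth x unfolding smooth_variety_def by blast
    show "finite ?K" by simp
  next
    fix p assume p: "p \<in> ?K"
    obtain j i where ji: "p = (j, i)" by (cases p)
    have "morphism affine_line gr (\<lambda>t. pt (U j i t 0))"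
      by (rule curve[of j i "\<lambda>t. t" "\<lambda>_. 0"]) (use p ji in \<open>auto intro: polyfuns.const polyfuns.coord\<close>)
    then show "morphism affine_line variety ((\<lambda>(j, i) t. pt (U j i t 0)) p)"
      unfolding ji prod.case
      by (rule morphism_varietyI[OF function_sheaf_quasi_affine]) (use in_variety p ji in blast)
    show "((\<lambda>(j, i) t. pt (U j i t 0)) p) 0 = x" by (simp add: ji U0 x_def)
    show "(case p of (l, k) \<Rightarrow> z l k) \<in> local_functions variety x"
      using zloc[of j i] p e unfolding ji by auto
    show "(case p of (l, k) \<Rightarrow> z l k) x = 0"
      using zU[of j i j i 0] p unfolding ji U0 x_def by simp
  next
    fix p q assume pq: "p \<in> ?K" "q \<in> ?K"
    obtain j i l k where ji: "p = (j, i)" "q = (l, k)" by (cases p, cases q)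
    have "((\<lambda>t. if (j, i) = (l, k) then t else 0) has_field_derivative (if (j, i) = (l, k) then 1 else 0)) (at (0::complex))"
      by auto
    then show "((\<lambda>t. (case q of (l, k) \<Rightarrow> z l k) ((\<lambda>(j, i) t. pt (U j i t 0)) p t)) has_field_derivative
        (if p = q then 1 else 0)) (at 0)"
      using zU[of j i l k] pq unfolding ji by simp
  qed
  then have "Suc (e - d) * (d - m) \<le> (d - 1 - m) + Suc (e - d)"
    using card_le e by (simp add: card_cartesian_product Suc_diff_le)
  \<comment> \<open>With \<open>e - d + 1 = a + 2\<close> and \<open>d - m = b + 2\<close> the
    inequality reads \<open>(a + 2) * (b + 2) \<le> a + b + 3\<close>.\<close>
  moreover obtain a b where ab: "e - d = Suc a" "d - m = Suc (Suc b)"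
    using that[of "e - d - 1" "d - m - 2"] e(1) m2 d2 by linarith
  moreover have "d - 1 - m = Suc b" using ab(2) by linarith
  ultimately show False by simp
qed

end

section \<open>Schubert varieties of one-row shape\<close>

lemma sum_eq_single:
  fixes g :: "nat \<Rightarrow> complex"
  assumes "j < n" "\<And>k. k < n \<Longrightarrow> k \<noteq> j \<Longrightarrow> g k = 0"
  shows "(\<Sum>k<n. g k) = g j"
proof -
  have "(\<Sum>k<n. g k) = (\<Sum>k\<in>{j}. g k)"
    by (rule sum.mono_neutral_right) (use assms in auto)
  then show ?thesis by simp
qed

lemma punctured_line_smult: "c \<noteq> 0 \<Longrightarrow> punctured_line (c \<cdot>\<^sub>v v) = punctured_line v"
  unfolding punctured_line_def
proof (intro equalityI subsetI)
  fix u assume c: "c \<noteq> 0"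
  {
    assume "u \<in> {a \<cdot>\<^sub>v (c \<cdot>\<^sub>v v) |a. a \<noteq> 0}"
    then obtain a where "a \<noteq> 0" "u = a \<cdot>\<^sub>v (c \<cdot>\<^sub>v v)" by blast
    then show "u \<in> {a \<cdot>\<^sub>v v |a. a \<noteq> 0}"
      using c by (auto simp: smult_smult_assoc intro!: exI[of _ "a * c"])
  }
  assume "u \<in> {a \<cdot>\<^sub>v v |a. a \<noteq> 0}"
  then obtain a where "a \<noteq> 0" "u = a \<cdot>\<^sub>v v" by blast
  then show "u \<in> {a \<cdot>\<^sub>v (c \<cdot>\<^sub>v v) |a. a \<noteq> 0}"
    using c by (auto simp: smult_smult_assoc intro!: exI[of _ "a / c"])
qed

lemma self_in_punctured_line: "v \<in> punctured_line v"
  unfolding punctured_line_def using one_smult_vec[of v] by (intro CollectI exI[of _ 1]) auto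

abbreviation punctured_space :: "nat \<Rightarrow> complex vec fspace" where
  "punctured_space l \<equiv> quasi_affine {(\<lambda>v. v $ i) | i. i < l + 1} (carrier_vec (l + 1) - {0\<^sub>v (l + 1)})"

lemma points_projective_space:
  "points (projective_space l) = punctured_line ` (carrier_vec (l + 1) - {0\<^sub>v (l + 1)})"
  unfolding projective_space_def points_quotient_fspace by simp

lemma morphism_punctured_line: "morphism (punctured_space l) (projective_space l) punctured_line"
  unfolding projective_space_def by (rule morphism_quotient_map)

locale row_schubert = schubert +
  assumes d1: "1 \<le> d" and row: "\<And>k. k < d - 1 \<Longrightarrow> w k = k"
begin

text \<open>\<open>p\<close> is the only one of the first \<open>d\<close> columns that varies,
  \<open>e\<close> is its pivot row, and \<open>a\<close> is the length of the single row of the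
  diagram, hence the dimension.\<close>

definition p where "p = d - 1"
definition e where "e = w p"
definition a where "a = e - p"

lemma dims: "p < d" "d = Suc p" "p \<le> e" "e < n" "e = p + a" "p < n" "\<And>k. k < p \<Longrightarrow> w k = k"
  using d1 d w_ge[of "d - 1"] w_less[of "d - 1"] row by (auto simp: p_def e_def a_def)

abbreviation vecs where "vecs \<equiv> carrier_vec (a + 1) - {0\<^sub>v (a + 1)}"

text \<open>A basis of the subspace spanned by the first \<open>p\<close> unit vectors together with
  \<open>v\<close>, where \<open>v\<close> is placed in the rows \<open>p, ..., e\<close>.\<close>

definition row_entry :: "complex vec \<Rightarrow> nat \<Rightarrow> nat \<Rightarrow> complex" where
  "row_entry v r k = (if k < p then if r = k then 1 else 0 else if p \<le> r \<and> r \<le> e then v $ (r - p) else 0)"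

lemma ex_row_mat:
  assumes v: "v \<in> vecs"
  shows "\<exists>A\<in>carrier (SL n). \<forall>r<n. \<forall>k<d. A $$ (r, k) = row_entry v r k"
proof -
  have "\<exists>c. c < a + 1 \<and> v $ c \<noteq> 0"
  proof (rule ccontr)
    assume "\<not> ?thesis"
    then have "v = 0\<^sub>v (a + 1)" using v by (intro eq_vecI) auto
    with v show False by simp
  qed
  then obtain c where c: "c \<le> a" "v $ c \<noteq> 0" by (auto simp: less_Suc_eq_le)
  \<comment> \<open>Some entry \<open>c\<close> of \<open>v\<close> is nonzero. The swap reserves
    row \<open>p + c\<close> for the column of \<open>v\<close>, so the completing columns use up
    exactly the other unit vectors.\<close>
  define \<sigma> where "\<sigma> = Transposition.transpose p (p + c)"
  have \<sigma>_inj: "\<sigma> i = \<sigma> j \<longleftrightarrow> i = j" for i j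
    unfolding \<sigma>_def transpose_def by auto
  have \<sigma>_ge: "p \<le> \<sigma> k" if "p \<le> k" for k using that unfolding \<sigma>_def transpose_def by auto
  have \<sigma>_lt: "\<sigma> k < n" if "k < n" for k using that c dims unfolding \<sigma>_def transpose_def by auto
  have \<sigma>_p: "\<sigma> k = p + c \<longleftrightarrow> k = p" for k unfolding \<sigma>_def transpose_def by auto
  define m where "m r k = (if k < d then row_entry v r k else if r = \<sigma> k then 1 else 0)" for r k
  define M where "M = mat n n (\<lambda>(r, k). m r k)"
  have M: "M \<in> carrier_mat n n" by (simp add: M_def)
  have "det M \<noteq> 0"
  proof (rule det_nonzero_if_kernel_trivial[OF M])
    fix x :: "nat \<Rightarrow> complex" and j
    assume z: "\<And>i. i < n \<Longrightarrow> (\<Sum>k<n. M $$ (i, k) * x k) = 0" and j: "j < n"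
    have z': "(\<Sum>k<n. m i k * x k) = 0" if "i < n" for i
      using z[OF that] that by (simp add: M_def)
    have pc: "p + c < n" using c dims by simp
    have "(\<Sum>k<n. m (p + c) k * x k) = m (p + c) p * x p"
    proof (rule sum_eq_single[OF dims(6)])
      fix k assume "k < n" "k \<noteq> p"
      then show "m (p + c) k * x k = 0" using dims \<sigma>_p[of k] by (auto simp: m_def row_entry_def)
    qed
    then have xp: "x p = 0" using z'[OF pc] c dims by (simp add: m_def row_entry_def)
    show "x j = 0"
    proof (cases "j = p")
      case jp: False
      define r where "r = (if j < p then j else \<sigma> j)"
      have r: "r < n" using j \<sigma>_lt by (auto simp: r_def)
      have "(\<Sum>k<n. m r k * x k) = m r j * x j"
      proof (rule sum_eq_single[OF j])
        fix k assume k: "k < n" "k \<noteq> j"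
        show "m r k * x k = 0"
        proof (cases "k = p")
          case kp: False
          then consider "k < p" | "d \<le> k" using dims by linarith
          then have "m r k = 0"
          proof cases
            case 1
            then have "r \<noteq> k" using k jp \<sigma>_ge[of j] by (auto simp: r_def split: if_splits)
            then show ?thesis using 1 dims by (simp add: m_def row_entry_def)
          next
            case 2
            then have "r \<noteq> \<sigma> k" using k jp \<sigma>_ge[of k] \<sigma>_inj[of j k] dims by (auto simp: r_def split: if_splits)
            then show ?thesis using 2 by (simp add: m_def)
          qed
          then show ?thesis by simp
        qed (simp add: xp)
      qed
      moreover have "m r j = 1" using jp dims by (auto simp: m_def r_def row_entry_def)
      ultimately show ?thesis using z'[OF r] by simp
    qed (simp add: xp)
  qed
  then have "rescale_column d M \<in> carrier (SL n)" by (rule rescale_column_SL[OF M d])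
  moreover have "\<forall>r<n. \<forall>k<d. rescale_column d M $$ (r, k) = row_entry v r k"
    using d by (auto simp: rescale_column_def M_def m_def)
  ultimately show ?thesis by blast
qed

definition row_mat where
  "row_mat v = (SOME A. A \<in> carrier (SL n) \<and> (\<forall>r<n. \<forall>k<d. A $$ (r, k) = row_entry v r k))"

lemma row_mat:
  assumes "v \<in> vecs"
  shows "row_mat v \<in> carrier (SL n)" "r < n \<Longrightarrow> k < d \<Longrightarrow> row_mat v $$ (r, k) = row_entry v r k"
proof -
  have "row_mat v \<in> carrier (SL n) \<and> (\<forall>r<n. \<forall>k<d. row_mat v $$ (r, k) = row_entry v r k)"
    unfolding row_mat_def by (rule someI_ex) (use ex_row_mat[OF assms] in blast)
  then show "row_mat v \<in> carrier (SL n)" "r < n \<Longrightarrow> k < d \<Longrightarrow> row_mat v $$ (r, k) = row_entry v r k" by auto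
qed

lemma morphism_row_mat:
  assumes X: "function_sheaf X" and g: "\<And>x. x \<in> points X \<Longrightarrow> g x \<in> vecs"
    and c: "\<And>i. i \<le> a \<Longrightarrow> (\<lambda>x. g x $ i) \<in> sections X (points X)"
  shows "morphism X gr (\<lambda>x. pt (row_mat (g x)))"
proof (rule morphism_grassmannianI[OF X d, where a = "\<lambda>x. row_entry (g x)"])
  fix r k assume "r < n" "k < d"
  note C = sheaf_const[OF X openin_topspace]
  show "(\<lambda>x. row_entry (g x) r k) \<in> sections X (points X)"
  proof (cases "k < p \<or> \<not> (p \<le> r \<and> r \<le> e)")
    case True
    then have eq: "(\<lambda>x. row_entry (g x) r k) = (\<lambda>x. if k < p \<and> r = k then 1 else 0)"
      by (auto simp: row_entry_def)
    show ?thesis unfolding eq by (rule C)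
  next
    case False
    then have eq: "(\<lambda>x. row_entry (g x) r k) = (\<lambda>x. g x $ (r - p))"
      by (auto simp: row_entry_def)
    show ?thesis unfolding eq using False by (intro c) (simp add: a_def diff_le_mono)
  qed
next
  fix x assume "x \<in> points X"
  then show "\<exists>A\<in>carrier (SL n). pt (row_mat (g x)) = pt A \<and> (\<forall>r<n. \<forall>k<d. A $$ (r, k) = row_entry (g x) r k)"
    using row_mat[OF g] by blast
qed

lemma row_mat_cell:
  assumes v: "v \<in> vecs" and top: "v $ a \<noteq> 0"
  shows "pt (row_mat v) \<in> cell"
proof (rule in_cellI[OF row_mat(1)[OF v], where f = id])
  fix k assume k: "k < d"
  have wn: "w k < n" "k < n" using k d w_less[of k] by auto
  have "row_entry v (w k) k \<noteq> 0 \<and> (\<forall>r>w k. row_entry v r k = 0)"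
  proof (cases "k < p")
    case False
    then have "k = p" using k dims by simp
    then show ?thesis using top dims by (auto simp: row_entry_def e_def[symmetric])
  qed (use dims in \<open>simp add: row_entry_def\<close>)
  then show "row_mat v $$ (w k, id k) \<noteq> 0" "\<And>r. w k < r \<Longrightarrow> r < n \<Longrightarrow> row_mat v $$ (r, id k) = 0"
    using row_mat(2)[OF v] wn k by auto
qed simp

text \<open>A nonzero last coordinate of \<open>v\<close> puts the point into the cell. If it is
  zero, replace it by \<open>s\<close> and let \<open>s\<close> tend to 0.\<close>

lemma row_mat_variety:
  assumes v: "v \<in> vecs"
  shows "pt (row_mat v) \<in> points variety"
proof (cases "v $ a = 0")
  case True
  define g where "g s = vec (a + 1) (\<lambda>i. v $ i + (if i = a then s else 0))" for s
  have g: "g s \<in> vecs" for s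
  proof -
    have "g s \<noteq> 0\<^sub>v (a + 1)"
    proof
      assume z: "g s = 0\<^sub>v (a + 1)"
      have "v $ i = 0" if i: "i < a + 1" for i
      proof -
        have "g s $ i = 0" using z i by simp
        then show ?thesis using i True by (cases "i = a") (auto simp: g_def)
      qed
      then have "v = 0\<^sub>v (a + 1)" using v by (intro eq_vecI) auto
      with v show False by simp
    qed
    then show ?thesis by (simp add: g_def)
  qed
  have g0: "g 0 = v" using v by (intro eq_vecI) (auto simp: g_def)
  have "morphism affine_line gr (\<lambda>s. pt (row_mat (g s)))"
  proof (rule morphism_row_mat[OF function_sheaf_quasi_affine g])
    fix i assume "i \<le> a"
    then have eq: "(\<lambda>s. g s $ i) = (\<lambda>s. v $ i + (if i = a then 1 else 0) * s)" by (auto simp: g_def)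
    have "(\<lambda>s. g s $ i) \<in> polyfuns {\<lambda>t. t}"
      unfolding eq by (intro polyfuns.add polyfuns.mult polyfuns.const polyfuns.coord) simp
    then show "(\<lambda>s. g s $ i) \<in> sections affine_line (points affine_line)"
      by (rule polyfuns_section) (metis ftop_quasi_affine openin_topspace)
  qed
  then have "pt (row_mat (g 0)) \<in> ftop gr closure_of cell"
  proof (rule curve_limit[of _ _ "{0}" _ 0])
    fix s :: complex assume "s \<notin> {0}"
    then show "pt (row_mat (g s)) \<in> cell" using True by (intro row_mat_cell[OF g]) (simp add: g_def)
  qed simp
  then show ?thesis unfolding points_variety g0 .
qed (use row_mat_cell[OF v] cell_subset in blast)

text \<open>The closed condition that the subspace lies in the span of the unit vectors
  \<open>0, ..., e\<close>. It holds on the cell because no pivot exceeds \<open>e\<close>.\<close>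

lemma variety_rows_zero:
  assumes A: "A \<in> carrier (SL n)" "pt A \<in> points variety" and r: "e < r" "r < n" and k: "k < d"
  shows "A $$ (r, k) = 0"
proof -
  let ?F = "{(\<lambda>A. A $$ (r, k)) | r k. e < r \<and> r < n \<and> k < d}"
  have dn: "d \<le> n" using d by simp
  have inv: "f (A * h) = 0" if A: "A \<in> carrier (SL n)" and h: "h \<in> parabolic n d"
    and z: "\<forall>f\<in>?F. f A = 0" and f: "f \<in> ?F" for A h f
  proof -
    have z': "A $$ (r, k) = 0" if "e < r" "r < n" "k < d" for r k
    proof -
      have "(\<lambda>A. A $$ (r, k)) \<in> ?F" using that by blast
      from bspec[OF z this] show ?thesis .
    qed
    obtain r k where f': "f = (\<lambda>A. A $$ (r, k))" "e < r" "r < n" "k < d" using f by blast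
    have "A \<in> carrier_mat n n" using A carrier_SL by blast
    then show ?thesis unfolding f'(1) using index_mult_parabolic[OF _ h dn f'(3,4)] z'[OF f'(2,3)] by simp
  qed
  have "(\<lambda>A. A $$ (r, k)) A = 0"
  proof (rule closure_vanishing[where F = ?F and d = d and n = n and S = cell and A = A and f = "\<lambda>A. A $$ (r, k)"])
    show "f \<in> sections (SL_space n) (carrier (SL n))" if "f \<in> ?F" for f
      using that entry_regular[of _ n] d by fastforce
    show "f A = 0" if A: "A \<in> carrier (SL n)" "pt A \<in> cell" and f: "f \<in> ?F" for A f
    proof -
      obtain b where b: "b \<in> borel_subgroup n" "pt A = pt (b * signed_perm n w 0)"
        "b * signed_perm n w 0 \<in> carrier (SL n)" using A(2) by (rule cellE)
      obtain h where h: "h \<in> parabolic n d" "A = b * signed_perm n w 0 * h"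
        by (rule coset_eqD[OF b(3) A(1) b(2)[symmetric]])
      have bc: "b \<in> carrier_mat n n" using borel_SL[OF b(1)] carrier_SL by blast
      have "g (b * signed_perm n w 0) = 0" if g: "g \<in> ?F" for g
      proof -
        obtain r k where g': "g = (\<lambda>A. A $$ (r, k))" "e < r" "r < n" "k < d" using g by blast
        have "w k \<le> e" using g'(4) dims w_mono[of k p] by (cases "k = p") (auto simp: e_def)
        then show ?thesis unfolding g'(1) using g' d index_mult_signed_perm[OF bc w g'(3), of k 0]
          borel_zero[OF b(1), of "w k" r] by simp
      qed
      then have "\<forall>g\<in>?F. g (b * signed_perm n w 0) = 0" by (rule ballI)
      then show ?thesis unfolding h(2) by (rule inv[OF b(3) h(1) _ f])
    qed
    show "(\<lambda>A. A $$ (r, k)) \<in> ?F" using r k by blast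
  qed (use A inv points_variety in auto)
  then show ?thesis .
qed

text \<open>The last \<open>n - d\<close> rows of the inverse are linear equations for the span of
  the first \<open>d\<close> columns, so the entries in column \<open>k\<close> vanish exactly when
  that span contains the unit vector \<open>k\<close>. This is how containing the first
  \<open>p\<close> unit vectors becomes a closed condition.\<close>

lemma variety_adj_zero:
  assumes A: "A \<in> carrier (SL n)" "pt A \<in> points variety" and s: "d \<le> s" "s < n" and k: "k < p"
  shows "adj_mat A $$ (s, k) = 0"
proof -
  let ?F = "{(\<lambda>A. adj_mat A $$ (s, k)) | s k. d \<le> s \<and> s < n \<and> k < p}"
  have dn: "d \<le> n" using d by simp
  have inv: "f (A * h) = 0" if A: "A \<in> carrier (SL n)" and h: "h \<in> parabolic n d"
    and z: "\<forall>f\<in>?F. f A = 0" and f: "f \<in> ?F" for A h f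
  proof -
    have z': "adj_mat A $$ (s, k) = 0" if "d \<le> s" "s < n" "k < p" for s k
    proof -
      have "(\<lambda>A. adj_mat A $$ (s, k)) \<in> ?F" using that by blast
      from bspec[OF z this] show ?thesis .
    qed
    obtain s k where f': "f = (\<lambda>A. adj_mat A $$ (s, k))" "d \<le> s" "s < n" "k < p" using f by blast
    have kn: "k < n" using f'(4) dims by simp
    have hi: "adj_mat h \<in> parabolic n d" by (rule parabolic_adj[OF h dn])
    have c: "adj_mat h \<in> carrier_mat n n" "adj_mat A \<in> carrier_mat n n"
      using parabolic_SL[OF hi] SL_adj(1)[OF A] carrier_SL by blast+
    have "adj_mat (A * h) $$ (s, k) = (\<Sum>t<n. adj_mat h $$ (s, t) * adj_mat A $$ (t, k))"
      unfolding adj_mat_mult_SL[OF A parabolic_SL[OF h]] by (rule index_mult_square[OF c f'(3) kn])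
    also have "\<dots> = 0"
    proof (rule sum.neutral, rule ballI)
      fix t assume "t \<in> {..<n}"
      then show "adj_mat h $$ (s, t) * adj_mat A $$ (t, k) = 0"
        using parabolic_zero[OF hi f'(2,3), of t] z'[of t k] f'(4) by (cases "t < d") auto
    qed
    finally show ?thesis unfolding f'(1) .
  qed
  have "(\<lambda>A. adj_mat A $$ (s, k)) A = 0"
  proof (rule closure_vanishing[where F = ?F and d = d and n = n and S = cell and A = A and f = "\<lambda>A. adj_mat A $$ (s, k)"])
    show "f \<in> sections (SL_space n) (carrier (SL n))" if f: "f \<in> ?F" for f
    proof -
      obtain s k where f': "f = (\<lambda>A. adj_mat A $$ (s, k))" "s < n" "k < p" using f by blast
      then show ?thesis using adj_regular[of s n k] dims by simp
    qed
    show "f A = 0" if A: "A \<in> carrier (SL n)" "pt A \<in> cell" and f: "f \<in> ?F" for A f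
    proof -
      obtain b where b: "b \<in> borel_subgroup n" "pt A = pt (b * signed_perm n w 0)"
        "b * signed_perm n w 0 \<in> carrier (SL n)" using A(2) by (rule cellE)
      let ?B = "b * signed_perm n w 0"
      obtain h where h: "h \<in> parabolic n d" "A = ?B * h"
        by (rule coset_eqD[OF b(3) A(1) b(2)[symmetric]])
      have bc: "b \<in> carrier_mat n n" "?B \<in> carrier_mat n n" "adj_mat ?B \<in> carrier_mat n n"
        using borel_SL[OF b(1)] b(3) SL_adj(1)[OF b(3)] by (simp_all only: carrier_SL)
      have Be: "?B $$ (r, i) = b $$ (r, i) * (if i = 0 then of_int (sign w) else 1)" if "r < n" "i < p" for r i
        using index_mult_signed_perm[OF bc(1) w that(1), of i 0] that dims by simp
      have Bz: "?B $$ (r, i) = 0" if "i < r" "r < n" "i < p" for r i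
        using Be[OF that(2,3)] borel_zero[OF b(1) that(1,2)] by simp
      have Bnz: "?B $$ (i, i) \<noteq> 0" if "i < p" for i
        using Be[of i i] borel_diag_nonzero[OF b(1), of i] that dims by (simp add: sign_def)
      have Bz': "?B $$ (i, k) = 0" if "k < i" "i < p" for i k using Bz[of k i] that dims by simp
      \<comment> \<open>On the cell the first \<open>p\<close> columns are triangular with nonzero
        diagonal; inverting this block writes the unit vectors \<open>0, ..., p - 1\<close> as
        combinations of those columns.\<close>
      have "\<exists>Q. \<forall>i<p. \<forall>k<p. (\<Sum>s<p. ?B $$ (i, s) * Q s k) = (if i = k then 1 else 0)"
      proof (rule upper_triangular_right_inverse[of p "\<lambda>i k. ?B $$ (i, k)"])
        fix Q assume "\<And>i k. i < p \<Longrightarrow> k < p \<Longrightarrow> (\<Sum>s<p. ?B $$ (i, s) * Q s k) = (if i = k then 1 else 0)"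
        then show ?thesis by (intro exI[of _ Q]) simp
      qed (use Bz' Bnz in simp_all)
      then obtain Q where Q: "\<forall>i<p. \<forall>k<p. (\<Sum>s<p. ?B $$ (i, s) * Q s k) = (if i = k then 1 else 0)" ..
      have unit: "(\<Sum>s<p. ?B $$ (r, s) * Q s k) = (if r = k then 1 else 0)" if "r < n" "k < p" for r k
      proof (cases "r < p")
        case False
        then have "(\<Sum>s<p. ?B $$ (r, s) * Q s k) = 0" using Bz[of _ r] that by (intro sum.neutral) auto
        then show ?thesis using False that by auto
      qed (use Q that in blast)
      have "g ?B = 0" if g: "g \<in> ?F" for g
      proof -
        obtain s k where g': "g = (\<lambda>A. adj_mat A $$ (s, k))" "d \<le> s" "s < n" "k < p" using g by blast
        have kn: "k < n" using g'(4) dims by simp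
        have "adj_mat ?B $$ (s, k) = (\<Sum>r<n. adj_mat ?B $$ (s, r) * (if r = k then 1 else 0))"
          using kn by (simp add: if_distrib[of "\<lambda>u. _ * u"] cong: if_cong)
        also have "\<dots> = (\<Sum>r<n. adj_mat ?B $$ (s, r) * (\<Sum>i<p. ?B $$ (r, i) * Q i k))"
          by (intro sum.cong) (auto simp: unit g'(4) simp del: index_mult_mat)
        also have "\<dots> = (\<Sum>i<p. (\<Sum>r<n. adj_mat ?B $$ (s, r) * ?B $$ (r, i)) * Q i k)"
          unfolding sum_distrib_left sum_distrib_right by (subst sum.swap) (simp only: mult.assoc)
        also have "\<dots> = (\<Sum>i<p. (adj_mat ?B * ?B) $$ (s, i) * Q i k)"
          using index_mult_square[OF bc(3,2) g'(3)] dims by (intro sum.cong) auto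
        also have "\<dots> = 0"
          unfolding SL_adj(3)[OF b(3)] using g' dims by (intro sum.neutral) auto
        finally show ?thesis unfolding g'(1) .
      qed
      then have "\<forall>g\<in>?F. g (b * signed_perm n w 0) = 0" by (rule ballI)
      then show ?thesis unfolding h(2) by (rule inv[OF b(3) h(1) _ f])
    qed
    show "(\<lambda>A. adj_mat A $$ (s, k)) \<in> ?F" using s k by blast
  qed (use A inv points_variety in auto)
  then show ?thesis .
qed

text \<open>Some column has a nonzero entry in a row from \<open>p\<close> on. Cleared of its rows
  \<open>0, ..., p - 1\<close> with the unit vectors known to lie in the subspace, it becomes the
  vector \<open>v\<close>.\<close>

lemma variety_row_mat:
  assumes q: "q \<in> points variety"
  obtains v where "v \<in> vecs" "q = pt (row_mat v)"
proof -
  have "q \<in> points gr"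
    using q closure_of_subset_topspace[of "ftop gr" cell] unfolding points_variety by blast
  then obtain A where A: "A \<in> carrier (SL n)" "q = pt A" unfolding points_grassmannian by blast
  have dn: "d \<le> n" using d by simp
  have Ac: "A \<in> carrier_mat n n" "adj_mat A \<in> carrier_mat n n" using A(1) SL_adj(1)[OF A(1)] carrier_SL by blast+
  note zero = variety_rows_zero[OF A(1) q[unfolded A(2)]]
  note adj = variety_adj_zero[OF A(1) q[unfolded A(2)]]
  have unit: "(\<Sum>s<d. A $$ (r, s) * adj_mat A $$ (s, k)) = (if r = k then 1 else 0)" if rk: "r < n" "k < p" for r k
  proof -
    have kn: "k < n" using rk dims by simp
    have "(\<Sum>s<d. A $$ (r, s) * adj_mat A $$ (s, k)) = (\<Sum>s<n. A $$ (r, s) * adj_mat A $$ (s, k))"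
      by (rule sum.mono_neutral_left) (use adj[OF _ _ rk(2)] dn in auto)
    also have "\<dots> = (A * adj_mat A) $$ (r, k)" by (rule index_mult_square[OF Ac rk(1) kn, symmetric])
    finally show ?thesis unfolding SL_adj(2)[OF A(1)] using rk kn by simp
  qed
  have "\<exists>c r. c < d \<and> p \<le> r \<and> r < n \<and> A $$ (r, c) \<noteq> 0"
  proof (rule ccontr)
    assume "\<not> ?thesis"
    then have z: "A $$ (r, c) = 0" if "c < d" "p \<le> r" "r < n" for c r using that by blast
    \<comment> \<open>Otherwise the first \<open>d = p + 1\<close> columns would live in the first
      \<open>p\<close> rows and be linearly dependent, contrary to invertibility.\<close>
    obtain x where x: "\<exists>k\<in>{..<d}. x k \<noteq> 0" "\<And>m. m \<in> {..<p} \<Longrightarrow> (\<Sum>k\<in>{..<d}. x k * A $$ (m, k)) = 0"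
      using homogeneous_system[of "{..<p}" "{..<d}" "\<lambda>k m. A $$ (m, k)"] dims by auto
    define y where "y k = (if k < d then x k else 0)" for k
    have "(\<Sum>k<n. A $$ (r, k) * y k) = 0" if r: "r < n" for r
    proof -
      have "(\<Sum>k<n. A $$ (r, k) * y k) = (\<Sum>k<d. x k * A $$ (r, k))"
        by (rule sum.mono_neutral_cong_right) (use dn in \<open>auto simp: y_def\<close>)
      also have "\<dots> = 0" using x(2)[of r] z[of _ r] r by (cases "r < p") auto
      finally show ?thesis .
    qed
    from SL_kernel[OF A(1) this] have "y k = 0" if "k < n" for k using that by blast
    moreover obtain k where "k < d" "x k \<noteq> 0" using x(1) by blast
    ultimately show False using dn unfolding y_def by (metis order_less_le_trans)
  qed
  then obtain c r0 where c: "c < d" "p \<le> r0" "r0 < n" "A $$ (r0, c) \<noteq> 0" by blast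
  have r0: "r0 \<le> e" using zero[of r0 c] c by (metis not_less)
  define v where "v = vec (a + 1) (\<lambda>i. A $$ (p + i, c))"
  have v: "v \<in> vecs"
  proof -
    have "v $ (r0 - p) \<noteq> 0" using c r0 dims by (simp add: v_def)
    then have "v \<noteq> 0\<^sub>v (a + 1)" using c r0 dims by auto
    then show ?thesis by (simp add: v_def)
  qed
  have "pt A = pt (row_mat v)"
  \<comment> \<open>For \<open>k < p\<close> column \<open>k\<close> of the inverse produces the
    unit vector \<open>k\<close>; the last column of \<open>Q\<close> selects column
    \<open>c\<close> of \<open>A\<close> and subtracts its first \<open>p\<close> rows.\<close>
  proof (rule coset_eqI[OF A(1) row_mat(1)[OF v] dn, where Q = "\<lambda>s k. if k < p then adj_mat A $$ (s, k)
      else (if s = c then 1 else 0) - (\<Sum>i<p. A $$ (i, c) * adj_mat A $$ (s, i))"])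
    fix r k assume rk: "r < n" "k < d"
    show "row_mat v $$ (r, k) = (\<Sum>s<d. A $$ (r, s) * (if k < p then adj_mat A $$ (s, k)
      else (if s = c then 1 else 0) - (\<Sum>i<p. A $$ (i, c) * adj_mat A $$ (s, i))))"
    proof (cases "k < p")
      case True
      then show ?thesis using unit[OF rk(1) True] row_mat(2)[OF v rk] by (simp add: row_entry_def)
    next
      case False
      have "(\<Sum>s<d. A $$ (r, s) * (\<Sum>i<p. A $$ (i, c) * adj_mat A $$ (s, i))) =
          (\<Sum>i<p. A $$ (i, c) * (\<Sum>s<d. A $$ (r, s) * adj_mat A $$ (s, i)))"
        unfolding sum_distrib_left by (subst sum.swap) (simp only: mult.left_commute)
      also have "\<dots> = (\<Sum>i<p. if i = r then A $$ (r, c) else 0)"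
        using rk by (intro sum.cong) (auto simp: unit)
      also have "\<dots> = (if r < p then A $$ (r, c) else 0)" by simp
      finally have 1: "(\<Sum>s<d. A $$ (r, s) * (\<Sum>i<p. A $$ (i, c) * adj_mat A $$ (s, i))) = (if r < p then A $$ (r, c) else 0)" .
      have 2: "(\<Sum>s<d. A $$ (r, s) * (if s = c then 1 else 0)) = A $$ (r, c)"
        using c by (simp add: if_distrib[of "\<lambda>u. _ * u"] cong: if_cong)
      have "row_mat v $$ (r, k) = A $$ (r, c) - (if r < p then A $$ (r, c) else 0)"
        unfolding row_mat(2)[OF v rk] row_entry_def using False zero[of r c] rk c dims by (auto simp: v_def)
      then show ?thesis using False 1 2 by (simp add: right_diff_distrib sum_subtractf)
    qed
  qed
  then show ?thesis using that v A(2) by blast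
qed

text \<open>The minors on the rows \<open>0, ..., p - 1, p + i\<close>. They serve as homogeneous
  coordinates and recover \<open>v\<close> from \<open>row_mat v\<close> without a factor.\<close>

definition plucker where "plucker A = vec (a + 1) (\<lambda>i. minor d (id(p := p + i)) A)"

lemma plucker_index: "i \<le> a \<Longrightarrow> r < d \<Longrightarrow> (id(p := p + i)) r < n"
  using dims d by auto

lemma plucker_row_mat: "v \<in> vecs \<Longrightarrow> plucker (row_mat v) = v"
proof (rule eq_vecI)
  assume v: "v \<in> vecs"
  then show "dim_vec (plucker (row_mat v)) = dim_vec v" by (auto simp: plucker_def)
  fix i assume "i < dim_vec v"
  then have i: "i \<le> a" using v by auto
  have "mat d d (\<lambda>(i', k'). row_mat v $$ ((id(p := p + i)) i', k')) =
      mat d d (\<lambda>(i', c). if i' = p then row_entry v (p + i) c else if i' = c then 1 else 0)"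
    using plucker_index[OF i] dims by (intro eq_matI) (auto simp: row_mat(2)[OF v] row_entry_def)
  then have "minor d (id(p := p + i)) (row_mat v) = row_entry v (p + i) p"
    unfolding minor_def using det_row_replaced[OF dims(1)] by simp
  then show "plucker (row_mat v) $ i = v $ i" using i dims by (simp add: plucker_def row_entry_def)
qed

text \<open>Both maps descend from explicit ones: \<open>row_mat\<close> from the punctured affine
  space and \<open>plucker\<close> from the special linear group. Changing the representative
  changes a vector by a scalar and a matrix by a parabolic factor, and neither matters after
  projection.\<close>

lemma isomorphic_projective_space: "isomorphic_fspaces variety (projective_space a)"
proof -
  define \<psi> where "\<psi> L = pt (row_mat (SOME v. v \<in> vecs \<and> punctured_line v = L))" for L
  have line_eq: "pt (row_mat u) = pt (row_mat v)"
    if u: "u \<in> vecs" and v: "v \<in> vecs" and uv: "punctured_line u = punctured_line v" for u v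
  proof -
    have "u \<in> punctured_line v" using self_in_punctured_line[of u] uv by simp
    then obtain c where c: "u = c \<cdot>\<^sub>v v" unfolding punctured_line_def by blast
    show ?thesis
    proof (rule coset_eqI[OF row_mat(1)[OF v] row_mat(1)[OF u], symmetric,
          where Q = "\<lambda>s k. if s = k then (if k = p then c else 1) else 0"])
      fix r k assume rk: "r < n" "k < d"
      have "row_entry u r k = row_entry v r k * (if k = p then c else 1)"
        using rk v dims unfolding c by (auto simp: row_entry_def)
      then show "row_mat u $$ (r, k) = (\<Sum>s<d. row_mat v $$ (r, s) * (if s = k then if k = p then c else 1 else 0))"
        using rk by (simp add: row_mat(2)[OF v] row_mat(2)[OF u] if_distrib[of "\<lambda>u. _ * u"] cong: if_cong)
    qed (use d in simp)
  qed
  have \<psi>: "\<psi> (punctured_line v) = pt (row_mat v)" if v: "v \<in> vecs" for v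
  proof -
    have "(SOME u. u \<in> vecs \<and> punctured_line u = punctured_line v) \<in> vecs \<and>
        punctured_line (SOME u. u \<in> vecs \<and> punctured_line u = punctured_line v) = punctured_line v"
      by (rule someI[of _ v]) (use v in simp)
    then show ?thesis unfolding \<psi>_def using line_eq v by blast
  qed
  have "morphism (punctured_space a) variety (\<lambda>v. pt (row_mat v))"
  proof (rule morphism_varietyI[OF function_sheaf_quasi_affine morphism_row_mat[OF function_sheaf_quasi_affine]])
    fix i assume i: "i \<le> a"
    show "(\<lambda>v. v $ i) \<in> sections (punctured_space a) (points (punctured_space a))"
    proof (rule polyfuns_section[OF polyfuns.coord])
      show "openin (zariski {\<lambda>v. v $ i |i. i < a + 1} vecs) (points (punctured_space a))"
        using openin_topspace[of "ftop (punctured_space a)"] by simp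
    qed (use i in auto)
  qed (use row_mat_variety in auto)
  then have "morphism (punctured_space a) variety (\<psi> \<circ> punctured_line)"
    by (rule morphism_cong[OF function_sheaf_quasi_affine]) (simp add: \<psi>)
  then have \<psi>_mor: "morphism (projective_space a) variety \<psi>"
    unfolding projective_space_def by (rule morphism_quotient)

  define \<phi> where "\<phi> q = punctured_line (plucker (SOME A. A \<in> carrier (SL n) \<and> pt A = q))" for q
  have dn: "d \<le> n" using d by simp
  have Phom: "minor d (id(p := p + i)) (A * h) = minor d (id(p := p + i)) A * det (mat d d (\<lambda>(i, k). h $$ (i, k)))"
    if "A \<in> carrier (SL n)" "h \<in> parabolic n d" "i \<le> a" for A h i
    by (rule minor_mult[OF _ that(2) dn plucker_index[OF that(3)]]) (use that(1) carrier_SL in blast)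
  have \<phi>: "\<phi> (pt A) = punctured_line (plucker A)" if A: "A \<in> carrier (SL n)" for A
  proof -
    define B where "B = (SOME B. B \<in> carrier (SL n) \<and> pt B = pt A)"
    have B: "B \<in> carrier (SL n)" "pt B = pt A"
      using someI[of "\<lambda>B. B \<in> carrier (SL n) \<and> pt B = pt A" A] A unfolding B_def by auto
    obtain h where h: "h \<in> parabolic n d" "B = A * h" by (rule coset_eqD[OF A B(1) B(2)[symmetric]])
    have "plucker B = det (mat d d (\<lambda>(i, k). h $$ (i, k))) \<cdot>\<^sub>v plucker A"
      unfolding h(2) by (intro eq_vecI) (auto simp: plucker_def Phom[OF A h(1)])
    then show ?thesis
      unfolding \<phi>_def B_def[symmetric] using punctured_line_smult[OF parabolic_block_nonzero[OF h(1) dn]] by simp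
  qed
  \<comment> \<open>The homogeneous coordinates may vanish simultaneously on the Grassmannian; this
    is the open set where they do not, and it contains the Schubert variety.\<close>
  define \<Omega> where "\<Omega> = (\<Union>i\<in>{..a}. pt ` {A \<in> carrier (SL n). minor d (id(p := p + i)) A \<noteq> 0})"
  have mreg: "minor d (id(p := p + i)) \<in> sections (SL_space n) (carrier (SL n))" if "i \<le> a" for i
    by (rule minor_regular[OF dn plucker_index[OF that]])
  have minv: "minor d (id(p := p + i)) A \<noteq> 0"
    if "i \<le> a" "A \<in> carrier (SL n)" "h \<in> parabolic n d" "minor d (id(p := p + i)) (A * h) \<noteq> 0" for i A h
    using that Phom by auto
  have "openin (ftop gr) (pt ` {A \<in> carrier (SL n). minor d (id(p := p + i)) A \<noteq> 0})" if "i \<le> a" for i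
    by (rule openin_grassmannian_nonzero(1)[OF mreg[OF that]]) (rule minv[OF that])
  then have \<Omega>_open: "openin (ftop gr) \<Omega>" unfolding \<Omega>_def by blast
  have in_\<Omega>: "pt A \<in> \<Omega> \<longleftrightarrow> (\<exists>i\<le>a. minor d (id(p := p + i)) A \<noteq> 0)" if A: "A \<in> carrier (SL n)" for A
  proof -
    have "pt A \<in> pt ` {A \<in> carrier (SL n). minor d (id(p := p + i)) A \<noteq> 0} \<longleftrightarrow> minor d (id(p := p + i)) A \<noteq> 0"
      if "i \<le> a" for i
      by (rule openin_grassmannian_nonzero(2)[OF mreg[OF that] _ A]) (rule minv[OF that])
    then show ?thesis unfolding \<Omega>_def by auto
  qed
  have plucker_vecs: "plucker A \<in> vecs \<longleftrightarrow> pt A \<in> \<Omega>" if "A \<in> carrier (SL n)" for A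
    unfolding in_\<Omega>[OF that] plucker_def by (auto simp: vec_eq_iff less_Suc_eq_le)
  let ?P = "{A \<in> points (SL_space n). pt A \<in> \<Omega>}"
  have \<Omega>_pre: "openin (ftop (SL_space n)) ?P" by (rule morphism_preimage[OF morphism_coset \<Omega>_open])
  have "regular_on (SL_space n) (punctured_space a) ?P plucker"
  proof (rule regular_on_quasi_affine[OF function_sheaf_quasi_affine \<Omega>_pre])
    show "plucker A \<in> vecs" if "A \<in> ?P" for A using that plucker_vecs by simp
    fix c :: "complex vec \<Rightarrow> complex" assume "c \<in> {\<lambda>v. v $ i |i. i < a + 1}"
    then obtain i where i: "c = (\<lambda>v. v $ i)" "i < a + 1" by blast
    have "minor d (id(p := p + i)) \<in> sections (SL_space n) ?P"
      by (rule sheaf_restrict[OF function_sheaf_quasi_affine openin_SL mreg \<Omega>_pre]) (use i in auto)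
    then show "(\<lambda>A. c (plucker A)) \<in> sections (SL_space n) ?P" using i by (simp add: plucker_def)
  qed
  then have "regular_on (SL_space n) (projective_space a) ?P (punctured_line \<circ> plucker)"
    by (rule regular_on_comp[OF _ morphism_punctured_line])
  then have "regular_on (SL_space n) (projective_space a) ?P (\<phi> \<circ> pt)"
    by (rule regular_on_cong[OF function_sheaf_quasi_affine]) (simp add: \<phi>)
  then have "regular_on gr (projective_space a) \<Omega> \<phi>"
    using \<Omega>_open unfolding grassmannian_def by (intro regular_on_quotient)
  moreover have "points variety \<subseteq> \<Omega>"
  proof
    fix q assume "q \<in> points variety"
    then obtain v where v: "v \<in> vecs" "q = pt (row_mat v)" by (rule variety_row_mat)
    then show "q \<in> \<Omega>" using plucker_vecs[OF row_mat(1)[OF v(1)]] plucker_row_mat[OF v(1)] by simp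
  qed
  ultimately have \<phi>_mor: "morphism variety (projective_space a) \<phi>"
    unfolding points_variety unfolding schubert_variety_def by (rule regular_on_sub[OF function_sheaf_grassmannian])
  have \<phi>_row: "\<phi> (pt (row_mat v)) = punctured_line v" if "v \<in> vecs" for v
    using \<phi>[OF row_mat(1)[OF that]] plucker_row_mat[OF that] by simp
  show ?thesis
    unfolding isomorphic_fspaces_def
  proof (intro exI conjI ballI)
    fix q assume "q \<in> points variety"
    then obtain v where v: "v \<in> vecs" "q = pt (row_mat v)" by (rule variety_row_mat)
    then show "\<psi> (\<phi> q) = q" by (simp add: \<phi>_row \<psi>)
  next
    fix L assume "L \<in> points (projective_space a)"
    then obtain v where v: "v \<in> vecs" "L = punctured_line v" unfolding points_projective_space by blast
    then show "\<phi> (\<psi> L) = L" by (simp add: \<phi>_row \<psi>)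
  qed (rule \<phi>_mor \<psi>_mor)+
qed

end

section \<open>Duality\<close>

definition flip :: "nat \<Rightarrow> nat \<Rightarrow> nat" where
  "flip n k = (if k < n then n - 1 - k else k)"

lemma flip_flip [simp]: "flip n (flip n k) = k"
  by (auto simp: flip_def)

lemma flip_less [simp]: "flip n k < n \<longleftrightarrow> k < n"
  by (auto simp: flip_def)

lemma flip_permutes: "flip n permutes {0..<n}"
proof (rule bij_imp_permutes)
  show "bij_betw (flip n) {0..<n} {0..<n}" by (rule bij_betw_byWitness[where f' = "flip n"]) auto
qed (simp add: flip_def)

lemma sign_flip: "sign (flip n) * sign (flip n) = 1"
  by (simp add: sign_def)

text \<open>Conjugation by the longest element of the Weyl group, which transposes the Young
  diagram.\<close>

definition dual_perm :: "nat \<Rightarrow> (nat \<Rightarrow> nat) \<Rightarrow> nat \<Rightarrow> nat" where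
  "dual_perm n w = flip n \<circ> w \<circ> flip n"

lemma dual_perm_dual_perm [simp]: "dual_perm n (dual_perm n w) = w"
  by (auto simp: dual_perm_def)

lemma dual_perm_permutes: "w permutes {..<n} \<Longrightarrow> dual_perm n w permutes {..<n}"
  unfolding dual_perm_def using flip_permutes[of n]
  by (intro permutes_compose) (simp_all add: lessThan_atLeast0)

lemma sign_dual_perm:
  assumes w: "w permutes {..<n}"
  shows "sign (dual_perm n w) = sign w"
proof -
  have p: "permutation (flip n)" "permutation w"
    using flip_permutes[of n] w permutation_permutes by blast+
  then have "sign (dual_perm n w) = sign (flip n) * sign w * sign (flip n)"
    unfolding dual_perm_def by (simp add: sign_compose permutation_compose)
  then show ?thesis using sign_flip[of n] by (simp add: mult.commute mult.left_commute)
qed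

lemma dual_min_coset_reps:
  assumes w: "w \<in> min_coset_reps n d" and d: "d \<le> n"
  shows "dual_perm n w \<in> min_coset_reps n (n - d)"
proof -
  have perm: "w permutes {..<n}" and m1: "\<And>i j. i < j \<Longrightarrow> j < d \<Longrightarrow> w i < w j"
    and m2: "\<And>i j. d \<le> i \<Longrightarrow> i < j \<Longrightarrow> j < n \<Longrightarrow> w i < w j"
    using w by (auto simp: min_coset_reps_def strict_mono_on_def)
  have wn: "w i < n" if "i < n" for i using permutes_in_image[OF perm, of i] that by simp
  have dual: "dual_perm n w i = n - 1 - w (n - 1 - i)" if "i < n" for i
  proof -
    have "flip n i = n - 1 - i" "w (n - 1 - i) < n" using that wn by (simp_all add: flip_def)
    then show ?thesis unfolding dual_perm_def o_apply by (simp only: flip_def if_True)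
  qed
  have "dual_perm n w i < dual_perm n w j" if "i < j" "j < n - d" for i j
  proof -
    have "d \<le> n - 1 - j" "n - 1 - j < n - 1 - i" "n - 1 - i < n" using that by linarith+
    then have "w (n - 1 - j) < w (n - 1 - i)" by (rule m2)
    moreover have "n - 1 - j < n" "n - 1 - i < n" using that by linarith+
    then have "w (n - 1 - j) < n" "w (n - 1 - i) < n" using wn by blast+
    moreover have "i < n" "j < n" using that by linarith+
    ultimately show ?thesis unfolding dual[OF \<open>i < n\<close>] dual[OF \<open>j < n\<close>] by linarith
  qed
  moreover have "dual_perm n w i < dual_perm n w j" if "n - d \<le> i" "i < j" "j < n" for i j
  proof -
    have "n - 1 - j < n - 1 - i" "n - 1 - i < d" using that d by linarith+
    then have "w (n - 1 - j) < w (n - 1 - i)" by (rule m1)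
    moreover have "n - 1 - j < n" "n - 1 - i < n" using that by linarith+
    then have "w (n - 1 - j) < n" "w (n - 1 - i) < n" using wn by blast+
    moreover have "i < n" "j < n" using that by linarith+
    ultimately show ?thesis unfolding dual[OF \<open>i < n\<close>] dual[OF \<open>j < n\<close>] by linarith
  qed
  ultimately show ?thesis
    using dual_perm_permutes[OF perm] by (auto simp: min_coset_reps_def strict_mono_on_def)
qed

lemma adj_mat_unique:
  assumes A: "A \<in> carrier (SL n)" and B: "B \<in> carrier_mat n n" and AB: "A * B = 1\<^sub>m n"
  shows "adj_mat A = B"
proof -
  have c: "A \<in> carrier_mat n n" "adj_mat A \<in> carrier_mat n n"
    using A SL_adj(1)[OF A] by (simp_all only: carrier_SL)
  have "adj_mat A = adj_mat A * 1\<^sub>m n" using right_mult_one_mat[OF c(2)] by simp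
  also have "\<dots> = adj_mat A * A * B" unfolding AB[symmetric] using c B by (simp add: assoc_mult_mat[of _ n n _ n _ n])
  also have "\<dots> = B" unfolding SL_adj(3)[OF A] using left_mult_one_mat[OF B] .
  finally show ?thesis .
qed

text \<open>The automorphism \<open>A \<mapsto> J (A\<^sup>-\<^sup>1)\<^sup>T J\<close> with the antidiagonal matrix \<open>J\<close>.\<close>

definition dual_mat :: "nat \<Rightarrow> complex mat \<Rightarrow> complex mat" where
  "dual_mat n A = mat n n (\<lambda>(i, j). adj_mat A $$ (flip n j, flip n i))"

lemma dual_mat_carrier: "dual_mat n A \<in> carrier_mat n n"
  by (simp add: dual_mat_def)

lemma dual_mat_SL:
  assumes A: "A \<in> carrier (SL n)"
  shows "dual_mat n A \<in> carrier (SL n)"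
proof -
  let ?X = "transpose_mat (adj_mat A)"
  have X: "?X \<in> carrier_mat n n" "det ?X = 1" and B: "adj_mat A \<in> carrier_mat n n"
    using SL_adj(1)[OF A] det_transpose[of "adj_mat A" n] by (auto simp: carrier_SL)
  define Y where "Y = mat n n (\<lambda>(i, j). ?X $$ (flip n i, j))"
  have Y: "Y \<in> carrier_mat n n" by (simp add: Y_def)
  have dY: "det Y = signof (flip n)" unfolding Y_def det_permute_rows[OF X(1) flip_permutes] X(2) by simp
  have "transpose_mat (dual_mat n A) = mat n n (\<lambda>(i, j). transpose_mat Y $$ (flip n i, j))"
    using B by (intro eq_matI) (auto simp: dual_mat_def Y_def)
  then have "det (transpose_mat (dual_mat n A)) = signof (flip n) * det (transpose_mat Y)"
    using Y by (simp add: det_permute_rows[OF _ flip_permutes])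
  then have "det (dual_mat n A) = signof (flip n) * signof (flip n)"
    unfolding det_transpose[OF Y] det_transpose[OF dual_mat_carrier] dY .
  then show ?thesis using sign_flip[of n] by (simp add: carrier_SL dual_mat_carrier flip: of_int_mult)
qed

lemma sum_flip: "(\<Sum>k<n. f (flip n k)) = (\<Sum>k<n. f k)"
  by (rule sum.reindex_bij_witness[where i = "flip n" and j = "flip n"]) auto

lemma dual_mat_mult:
  assumes A: "A \<in> carrier (SL n)" and B: "B \<in> carrier (SL n)"
  shows "dual_mat n (A * B) = dual_mat n A * dual_mat n B"
proof (rule eq_matI)
  fix i j assume "i < dim_row (dual_mat n A * dual_mat n B)" "j < dim_col (dual_mat n A * dual_mat n B)"
  then have ij: "i < n" "j < n" by (simp_all add: dual_mat_def)
  have c: "adj_mat A \<in> carrier_mat n n" "adj_mat B \<in> carrier_mat n n"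
    using SL_adj(1)[OF A] SL_adj(1)[OF B] by (simp_all only: carrier_SL)
  have f: "flip n j < n" "flip n i < n" using ij by auto
  have "(dual_mat n A * dual_mat n B) $$ (i, j) =
      (\<Sum>k<n. adj_mat A $$ (flip n k, flip n i) * adj_mat B $$ (flip n j, flip n k))"
    unfolding index_mult_square[OF dual_mat_carrier dual_mat_carrier ij] using ij by (simp add: dual_mat_def)
  also have "\<dots> = (\<Sum>k<n. adj_mat B $$ (flip n j, k) * adj_mat A $$ (k, flip n i))"
    unfolding sum_flip[of "\<lambda>k. adj_mat A $$ (k, flip n i) * adj_mat B $$ (flip n j, k)"] by (simp add: mult.commute)
  also have "\<dots> = dual_mat n (A * B) $$ (i, j)"
    using ij index_mult_square[OF c(2,1) f] by (simp add: dual_mat_def adj_mat_mult_SL[OF A B] del: index_mult_mat)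
  finally show "dual_mat n (A * B) $$ (i, j) = (dual_mat n A * dual_mat n B) $$ (i, j)" ..
qed (simp_all add: dual_mat_def)

lemma dual_mat_one: "dual_mat n (1\<^sub>m n) = 1\<^sub>m n"
proof -
  have "adj_mat (1\<^sub>m n :: complex mat) = 1\<^sub>m n" by (rule adj_mat_unique) (auto simp: carrier_SL)
  moreover have "flip n j = flip n i \<longleftrightarrow> i = j" for i j by (metis flip_flip)
  ultimately show ?thesis by (intro eq_matI) (auto simp: dual_mat_def)
qed

lemma dual_mat_dual_mat:
  assumes A: "A \<in> carrier (SL n)"
  shows "dual_mat n (dual_mat n A) = A"
proof -
  have B: "adj_mat A \<in> carrier (SL n)" by (rule SL_adj(1)[OF A])
  have Ac: "A \<in> carrier_mat n n" using A carrier_SL by blast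
  have "adj_mat (dual_mat n A) = dual_mat n (adj_mat A)"
    by (rule adj_mat_unique[OF dual_mat_SL[OF A] dual_mat_carrier])
      (simp add: dual_mat_mult[OF A B, symmetric] SL_adj(2)[OF A] dual_mat_one)
  moreover have "adj_mat (adj_mat A) = A" by (rule adj_mat_unique[OF B Ac SL_adj(3)[OF A]])
  ultimately show ?thesis
    unfolding dual_mat_def[of n "dual_mat n A"] using Ac by (intro eq_matI) (auto simp: dual_mat_def)
qed

lemma dual_mat_parabolic:
  assumes h: "h \<in> parabolic n d" and d: "d \<le> n"
  shows "dual_mat n h \<in> parabolic n (n - d)"
proof -
  have "adj_mat h \<in> parabolic n d" by (rule parabolic_adj[OF h d])
  then have "dual_mat n h $$ (i, j) = 0" if "n - d \<le> i" "i < n" "j < n - d" for i j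
    using that d parabolic_zero[of "adj_mat h" n d "flip n j" "flip n i"] by (auto simp: dual_mat_def flip_def)
  then show ?thesis using dual_mat_SL[OF parabolic_SL[OF h]] by (simp add: parabolic_def)
qed

lemma dual_mat_borel:
  assumes b: "b \<in> borel_subgroup n"
  shows "dual_mat n b \<in> borel_subgroup n"
proof -
  have "adj_mat b $$ (i, j) = 0" if ij: "j < i" "i < n" for i j
  proof -
    \<comment> \<open>An upper triangular matrix preserves every step of the standard flag, so
      \<open>parabolic_adj\<close> yields the zeros of the inverse row by row.\<close>
    have "b \<in> parabolic n i"
      using borel_SL[OF b] borel_zero[OF b] by (simp add: parabolic_def)
    then have "adj_mat b \<in> parabolic n i" using ij by (intro parabolic_adj) auto
    then show ?thesis using parabolic_zero ij by blast
  qed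
  then have "upper_triangular (dual_mat n b)"
    unfolding upper_triangular_def by (auto simp: dual_mat_def flip_def)
  then show ?thesis using dual_mat_SL[OF borel_SL[OF b]] by (simp add: borel_subgroup_def)
qed

text \<open>A signed permutation matrix is orthogonal, so the inverse transpose does nothing and
  only the conjugation by the antidiagonal matrix remains; it moves the sign to the last
  column.\<close>

lemma dual_mat_signed_perm:
  assumes w: "w permutes {..<n}" and n: "0 < n"
  shows "dual_mat n (signed_perm n w 0) = signed_perm n (dual_perm n w) (n - 1)"
proof -
  let ?S = "signed_perm n w 0"
  let ?T = "transpose_mat ?S"
  have S: "?S \<in> carrier (SL n)" by (rule signed_perm_SL[OF w n])
  have c: "?S \<in> carrier_mat n n" "?T \<in> carrier_mat n n" by (auto simp: signed_perm_def)
  have inj: "w i = w j \<longleftrightarrow> i = j" for i j using permutes_inj[OF w] by (auto simp: inj_def)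
  have wn: "w i < n" if "i < n" for i using permutes_in_image[OF w, of i] that by simp
  have "?S * ?T = 1\<^sub>m n"
  proof (rule eq_matI)
    fix i j assume "i < dim_row (1\<^sub>m n :: complex mat)" "j < dim_col (1\<^sub>m n :: complex mat)"
    then have ij: "i < n" "j < n" by auto
    obtain k0 where k0: "i = w k0" using permutes_surj[OF w] by (metis surjD)
    have k0n: "k0 < n" using k0 ij permutes_in_image[OF w, of k0] by simp
    have "(?S * ?T) $$ (i, j) = (\<Sum>k<n. ?S $$ (i, k) * ?S $$ (j, k))"
      unfolding index_mult_square[OF c ij] using c ij by (intro sum.cong) auto
    also have "\<dots> = ?S $$ (i, k0) * ?S $$ (j, k0)"
      by (rule sum_eq_single[OF k0n]) (use ij k0 inj in \<open>auto simp: signed_perm_def\<close>)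
    also have "\<dots> = 1\<^sub>m n $$ (i, j)"
      using ij k0n k0 by (auto simp: signed_perm_def simp flip: of_int_mult)
    finally show "(?S * ?T) $$ (i, j) = 1\<^sub>m n $$ (i, j)" .
  qed (use c in auto)
  then have adj: "adj_mat ?S = ?T" by (rule adj_mat_unique[OF S c(2)])
  show ?thesis
  proof (rule eq_matI)
    fix i j assume "i < dim_row (signed_perm n (dual_perm n w) (n - 1))" "j < dim_col (signed_perm n (dual_perm n w) (n - 1))"
    then have ij: "i < n" "j < n" by (auto simp: signed_perm_def)
    have "flip n i = w (flip n j) \<longleftrightarrow> i = dual_perm n w j"
      unfolding dual_perm_def o_apply by (metis flip_flip)
    moreover have "flip n j = 0 \<longleftrightarrow> j = n - 1" using ij by (auto simp: flip_def)
    moreover have "dual_mat n ?S $$ (i, j) = ?S $$ (flip n i, flip n j)"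
      using ij c(1) by (simp add: dual_mat_def adj)
    ultimately show "dual_mat n ?S $$ (i, j) = signed_perm n (dual_perm n w) (n - 1) $$ (i, j)"
      using ij by (simp add: signed_perm_def sign_dual_perm[OF w])
  qed (auto simp: dual_mat_def signed_perm_def)
qed

section \<open>Duality on cosets, cells and Schubert varieties\<close>

lemma dual_coset:
  assumes A: "A \<in> carrier (SL n)" and d: "d \<le> n"
  shows "dual_mat n ` coset n d A = coset n (n - d) (dual_mat n A)"
proof -
  have "dual_mat n ` parabolic n d = parabolic n (n - d)"
  proof
    show "dual_mat n ` parabolic n d \<subseteq> parabolic n (n - d)" using dual_mat_parabolic[OF _ d] by blast
    show "parabolic n (n - d) \<subseteq> dual_mat n ` parabolic n d"
    proof
      fix h assume h: "h \<in> parabolic n (n - d)"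
      then have "dual_mat n h \<in> parabolic n d" using dual_mat_parabolic[OF h] d by simp
      moreover have "h = dual_mat n (dual_mat n h)" using dual_mat_dual_mat[OF parabolic_SL[OF h]] by simp
      ultimately show "h \<in> dual_mat n ` parabolic n d" by blast
    qed
  qed
  moreover have "dual_mat n ` coset n d A = (\<lambda>h. dual_mat n A * h) ` dual_mat n ` parabolic n d"
    unfolding coset_eq image_image by (rule image_cong[OF refl]) (simp add: dual_mat_mult[OF A] parabolic_SL)
  ultimately show ?thesis unfolding coset_eq by simp
qed

lemma morphism_dual_mat: "morphism (SL_space n) (SL_space n) (dual_mat n)"
proof (rule morphism_quasi_affine[OF function_sheaf_quasi_affine])
  fix c :: "complex mat \<Rightarrow> complex" assume "c \<in> {(\<lambda>A. A $$ (i, j)) | i j. i < n \<and> j < n}"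
  then obtain i j where c: "c = (\<lambda>A. A $$ (i, j))" "i < n" "j < n" by blast
  have "(\<lambda>A. adj_mat A $$ (flip n j, flip n i)) \<in> sections (SL_space n) (carrier (SL n))"
    by (rule adj_regular) (use c in auto)
  then show "(\<lambda>A. c (dual_mat n A)) \<in> sections (SL_space n) (points (SL_space n))"
    using c by (simp add: dual_mat_def)
qed (auto intro: dual_mat_SL)

lemma morphism_dual:
  assumes d: "d \<le> n"
  shows "morphism (grassmannian n d) (grassmannian n (n - d)) (image (dual_mat n))"
proof -
  have "morphism (SL_space n) (grassmannian n (n - d)) (coset n (n - d) \<circ> dual_mat n)"
    by (rule morphism_comp[OF morphism_dual_mat morphism_coset])
  then have "morphism (SL_space n) (grassmannian n (n - d)) (image (dual_mat n) \<circ> coset n d)"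
    by (rule morphism_cong[OF function_sheaf_quasi_affine]) (simp add: dual_coset[OF _ d])
  then show ?thesis unfolding grassmannian_def[of n d] by (rule morphism_quotient)
qed

lemma dual_cell:
  assumes "schubert n d w" and d: "1 \<le> d"
  shows "image (dual_mat n) ` schubert_cell n d w \<subseteq> schubert_cell n (n - d) (dual_perm n w)"
proof clarify
  interpret schubert n d w by fact
  interpret D: schubert n "n - d" "dual_perm n w"
    by unfold_locales (use assms(2) schubert.d[OF assms(1)] rep dual_min_coset_reps[of w n d] in auto)
  fix x assume "x \<in> schubert_cell n d w"
  then obtain b where b: "b \<in> borel_subgroup n" "x = pt (b * signed_perm n w 0)"
    "b * signed_perm n w 0 \<in> carrier (SL n)" by (rule cellE)
  have n: "0 < n" and dn: "d \<le> n" using schubert.d[OF assms(1)] by auto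
  have "dual_mat n ` x = coset n (n - d) (dual_mat n b * signed_perm n (dual_perm n w) (n - 1))"
    unfolding b(2) dual_coset[OF b(3) dn] dual_mat_mult[OF borel_SL[OF b(1)] signed_perm_SL[OF w n]]
      dual_mat_signed_perm[OF w n] ..
  also have "\<dots> \<in> schubert_cell n (n - d) (dual_perm n w)"
    by (rule D.cell_signed_perm[OF _ dual_mat_borel[OF b(1)]]) (use n in simp)
  finally show "dual_mat n ` x \<in> schubert_cell n (n - d) (dual_perm n w)" .
qed

lemma morphism_dual_variety:
  assumes "schubert n d w" and d: "1 \<le> d"
  shows "morphism (schubert_variety n d w) (schubert_variety n (n - d) (dual_perm n w)) (image (dual_mat n))"
proof -
  interpret schubert n d w by fact
  have dn: "d \<le> n" using schubert.d[OF assms(1)] by simp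
  interpret D: schubert n "n - d" "dual_perm n w"
    by unfold_locales (use assms(2) schubert.d[OF assms(1)] rep dual_min_coset_reps[of w n d] in auto)
  show ?thesis
  proof (rule D.morphism_varietyI[OF function_sheaf_variety])
    show "morphism variety (grassmannian n (n - d)) (image (dual_mat n))"
      unfolding schubert_variety_def by (rule morphism_sub[OF function_sheaf_grassmannian morphism_dual[OF dn]])
    show "dual_mat n ` x \<in> points D.variety" if "x \<in> points variety" for x
      unfolding D.points_variety
      by (rule morphism_closure[OF morphism_dual[OF dn] _ dual_cell[OF assms]]) (use that points_variety in simp)
  qed
qed

text \<open>Duality is an involution on matrices, permutations and \<open>d\<close>, so the morphism
  in the opposite direction is given by the same formula.\<close>

lemma isomorphic_dual:
  assumes "schubert n d w" and d: "1 \<le> d"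
  shows "isomorphic_fspaces (schubert_variety n d w) (schubert_variety n (n - d) (dual_perm n w))"
proof -
  interpret schubert n d w by fact
  have dn: "d < n" by (rule schubert.d[OF assms(1)])
  interpret D: schubert n "n - d" "dual_perm n w"
    by unfold_locales (use assms(2) dn rep dual_min_coset_reps[of w n d] in auto)
  have inv: "dual_mat n ` dual_mat n ` x = x" if x: "x \<in> coset n d' ` carrier (SL n)" "d' \<le> n" for x d'
  proof -
    obtain A where A: "A \<in> carrier (SL n)" "x = coset n d' A" using x(1) by blast
    have "n - (n - d') = d'" using x(2) by simp
    then show ?thesis
      unfolding A(2) dual_coset[OF A(1) x(2)] using dual_coset[OF dual_mat_SL[OF A(1)], of "n - d'"]
      by (simp add: dual_mat_dual_mat[OF A(1)])
  qed
  have "morphism D.variety variety (image (dual_mat n))"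
    using morphism_dual_variety[OF D.schubert_axioms] dn by simp
  moreover have "points variety \<subseteq> coset n d ` carrier (SL n)"
    "points D.variety \<subseteq> coset n (n - d) ` carrier (SL n)"
    unfolding points_variety D.points_variety points_grassmannian[symmetric] by (rule closure_of_subset_topspace)+
  then have "dual_mat n ` dual_mat n ` x = x" if "x \<in> points variety \<or> x \<in> points D.variety" for x
    using inv[of x d] inv[of x "n - d"] that dn by auto
  ultimately show ?thesis
    unfolding isomorphic_fspaces_def using morphism_dual_variety[OF assms]
    by (intro exI[of _ "image (dual_mat n)"] conjI ballI) simp_all
qed


section \<open>Length\<close>

abbreviation perm_word :: "nat list \<Rightarrow> nat \<Rightarrow> nat" where
  "perm_word js \<equiv> foldr (\<lambda>j u. Transposition.transpose j (j + 1) \<circ> u) js id"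

text \<open>An adjacent transposition moves a point by at most one step; applied to the displacement
  of \<open>p\<close>, this bounds the length in the row case from below.\<close>

lemma perm_word_displacement: "perm_word js x \<le> x + length js"
proof (induction js)
  case (Cons j js)
  then show ?case by (auto simp: transpose_def)
qed simp

text \<open>The factors act with indices increasing from \<open>p\<close>, so they carry
  \<open>p\<close> up to \<open>p + a\<close> and push each point it passes down by one.\<close>

lemma perm_word_cycle:
  "perm_word (rev [p..<p + a]) x = (if x = p then p + a else if p < x \<and> x \<le> p + a then x - 1 else x)"
proof (induction a)
  case (Suc a)
  then show ?case by (auto simp: transpose_def)
qed simp

text \<open>Conjugation by \<open>flip n\<close> exchanges the simple reflections with indices
  \<open>j\<close> and \<open>n - 2 - j\<close>, hence preserves the length of words.\<close>

lemma dual_perm_word: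
  assumes "\<forall>j\<in>set js. j + 1 < n"
  shows "dual_perm n (perm_word js) = perm_word (map (\<lambda>j. n - 2 - j) js)"
  using assms
proof (induction js)
  case Nil
  show ?case by (auto simp: dual_perm_def)
next
  case (Cons j js)
  have t: "dual_perm n (Transposition.transpose j (j + 1)) = Transposition.transpose (n - 2 - j) (n - 2 - j + 1)"
  proof
    fix x
    have "flip n x = b \<longleftrightarrow> x = flip n b" for b by (metis flip_flip)
    then have "dual_perm n (Transposition.transpose j (j + 1)) x = Transposition.transpose (flip n j) (flip n (j + 1)) x"
      by (simp add: dual_perm_def transpose_def)
    moreover have "flip n j = n - 2 - j + 1" "flip n (j + 1) = n - 2 - j" using Cons.prems by (auto simp: flip_def)
    ultimately show "dual_perm n (Transposition.transpose j (j + 1)) x =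
        Transposition.transpose (n - 2 - j) (n - 2 - j + 1) x"
      by (simp only: transpose_commute)
  qed
  have comp: "dual_perm n (f \<circ> g) = dual_perm n f \<circ> dual_perm n g" for f g
    by (auto simp: dual_perm_def)
  have "perm_word (j # js) = Transposition.transpose j (j + 1) \<circ> perm_word js"
    "perm_word (map (\<lambda>j. n - 2 - j) (j # js)) =
      Transposition.transpose (n - 2 - j) (n - 2 - j + 1) \<circ> perm_word (map (\<lambda>j. n - 2 - j) js)"
    by simp_all
  moreover have "dual_perm n (perm_word js) = perm_word (map (\<lambda>j. n - 2 - j) js)"
    by (rule Cons.IH) (use Cons.prems in simp)
  ultimately show ?case by (simp only: comp t)
qed

lemma perm_length_dual: "perm_length n (dual_perm n w) = perm_length n w"
proof -
  have imp: "\<exists>js. length js = k \<and> (\<forall>j\<in>set js. j + 1 < n) \<and> dual_perm n w = perm_word js"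
    if "\<exists>js. length js = k \<and> (\<forall>j\<in>set js. j + 1 < n) \<and> w = perm_word js" for k w
  proof -
    from that obtain js where js: "length js = k" "\<forall>j\<in>set js. j + 1 < n" "w = perm_word js" by blast
    have "dual_perm n w = perm_word (map (\<lambda>j. n - 2 - j) js)" unfolding js(3) by (rule dual_perm_word[OF js(2)])
    moreover have "\<forall>j\<in>set (map (\<lambda>j. n - 2 - j) js). j + 1 < n" using js(2) by auto
    ultimately show ?thesis using js(1) by (intro exI[of _ "map (\<lambda>j. n - 2 - j) js"]) simp
  qed
  have "(\<exists>js. length js = k \<and> (\<forall>j\<in>set js. j + 1 < n) \<and> dual_perm n w = perm_word js) \<longleftrightarrow>
      (\<exists>js. length js = k \<and> (\<forall>j\<in>set js. j + 1 < n) \<and> w = perm_word js)" for k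
    using imp[of k w] imp[of k "dual_perm n w"] by auto
  then show ?thesis unfolding perm_length_def by simp
qed

context schubert
begin

lemma w_gap': "d \<le> i \<Longrightarrow> i \<le> j \<Longrightarrow> j < n \<Longrightarrow> w i + (j - i) \<le> w j"
proof (induction j)
  case (Suc j)
  then show ?case
  proof (cases "i = Suc j")
    case False
    then show ?thesis using Suc w_mono'[of j "Suc j"] by simp
  qed simp
qed simp

lemma w_le: "d \<le> k \<Longrightarrow> k < n \<Longrightarrow> w k \<le> k"
proof -
  assume k: "d \<le> k" "k < n"
  then have n: "k \<le> n - 1" "n - 1 < n" by auto
  have "w k + (n - 1 - k) \<le> w (n - 1)" "w (n - 1) < n"
    using w_gap'[OF k(1) n] w_less[OF n(2)] .
  then show "w k \<le> k" using k by linarith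
qed

end

context row_schubert
begin

text \<open>From \<open>d\<close> on, \<open>w k\<close> can only be \<open>k - 1\<close> or
  \<open>k\<close>. If some \<open>k \<le> p + a\<close> kept its place, or some \<open>k\<close>
  beyond \<open>p + a\<close> moved down, monotonicity would give the value \<open>p + a\<close> a
  second time, although it belongs to \<open>p\<close>.\<close>

lemma perm_word_w: "w = perm_word (rev [p..<p + a])"
proof
  fix k
  have wp: "w p = p + a" using dims by (simp add: e_def)
  have high: "w k \<in> {k - 1, k}" if "d \<le> k" "k < n" for k
  proof -
    have "\<not> w d < p"
    proof
      assume l: "w d < p"
      then have "w (w d) = w d" using dims by simp
      then have "w d = d" by (simp add: w_eq_iff)
      with l dims show False by simp
    qed
    then have "k - 1 \<le> w k" using w_gap'[of d k] that dims by simp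
    then show ?thesis using w_le[OF that] by auto
  qed
  show "w k = perm_word (rev [p..<p + a]) k"
    unfolding perm_word_cycle
  proof (cases "k < d \<or> n \<le> k")
    case True
    then consider "k < p" | "k = p" | "n \<le> k" using dims by linarith
    then show "w k = (if k = p then p + a else if p < k \<and> k \<le> p + a then k - 1 else k)"
    proof cases
      case 3
      then have "w k = k" using permutes_not_in[OF w, of k] by simp
      then show ?thesis using 3 dims by simp
    qed (use wp dims in auto)
  next
    case False
    then have k: "d \<le> k" "k < n" by auto
    show "w k = (if k = p then p + a else if p < k \<and> k \<le> p + a then k - 1 else k)"
    proof (cases "k \<le> p + a")
      case True
      have "w k \<noteq> k"
      proof
        assume "w k = k"
        then have "p + a \<le> w (p + a)" using w_gap'[of k "p + a"] k True dims by simp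
        moreover have "w (p + a) \<le> p + a" using w_le[of "p + a"] k True dims by simp
        ultimately have "w (p + a) = w p" using wp by simp
        then show False using True k dims by (simp add: w_eq_iff)
      qed
      then show ?thesis using high[OF k] True k dims by auto
    next
      case False
      have "w k \<noteq> k - 1"
      proof
        assume "w k = k - 1"
        then have "w (p + a + 1) \<le> p + a" using w_gap'[of "p + a + 1" k] k False dims by simp
        moreover have "p + a \<le> w (p + a + 1)" using high[of "p + a + 1"] k False dims by auto
        ultimately have "w (p + a + 1) = w p" using wp by simp
        then show False by (simp add: w_eq_iff)
      qed
      then show ?thesis using high[OF k] False k dims by auto
    qed
  qed
qed

lemma perm_length_w: "perm_length n w = a"
  unfolding perm_length_def
proof (rule Least_equality)
  have "\<forall>j\<in>set (rev [p..<p + a]). j + 1 < n" using dims by auto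
  then show "\<exists>js. length js = a \<and> (\<forall>j\<in>set js. j + 1 < n) \<and> w = perm_word js"
    using perm_word_w by (intro exI[of _ "rev [p..<p + a]"]) simp
  fix k assume "\<exists>js. length js = k \<and> (\<forall>j\<in>set js. j + 1 < n) \<and> w = perm_word js"
  then obtain js where js: "length js = k" "w = perm_word js" by blast
  have "w p \<le> p + k" using perm_word_displacement[of js p] unfolding js(1) js(2)[symmetric] .
  then show "a \<le> k" using dims unfolding e_def by linarith
qed

lemma isomorphic_perm_length: "isomorphic_fspaces variety (projective_space (perm_length n w))"
  unfolding perm_length_w by (rule isomorphic_projective_space)

end

text \<open>If \<open>w (d + 1) \<le> d\<close>, then \<open>d + 2\<close> indices would map into
  \<open>0, ..., d\<close>. So \<open>w (d + 1) > d\<close>, and monotonicity fixes every index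
  beyond \<open>d\<close>, which dualizes to the fixed initial segment of a one-row shape.\<close>

lemma (in schubert) dual_row:
  assumes d1: "1 \<le> d" and wd: "w (d - 1) = d" and k: "k < n - d - 1"
  shows "dual_perm n w k = k"
proof -
  let ?j = "n - 1 - k"
  have j: "d < ?j" "?j < n" using k by auto
  have "\<not> w (d + 1) \<le> d"
  proof
    assume le: "w (d + 1) \<le> d"
    have dn: "d + 1 < n" using j by simp
    have "w i \<le> d" if i: "i < d + 2" for i
    proof -
      consider "i < d" | "i = d" | "i = d + 1" using i by linarith
      then show ?thesis
      proof cases
        case 1
        then have "i = d - 1 \<or> i < d - 1" "d - 1 < d" using d1 by linarith+
        then show ?thesis using w_mono[of i "d - 1"] wd by auto
      next
        case 2
        then show ?thesis using w_mono'[of d "d + 1"] dn le by simp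
      qed (use le in simp)
    qed
    then have "card (w ` {..<d + 2}) \<le> card {..d}" by (intro card_mono) auto
    moreover have "card (w ` {..<d + 2}) = d + 2"
      by (subst card_image) (auto simp: inj_on_def w_eq_iff)
    ultimately show False by simp
  qed
  then have "?j \<le> w ?j" using w_gap'[of "d + 1" ?j] j by simp
  moreover have "w ?j \<le> ?j" using w_le[of ?j] j by simp
  ultimately have "w ?j = ?j" by simp
  then show ?thesis using k by (simp add: dual_perm_def flip_def)
qed

theorem corollary4p3:
  fixes n d :: nat and w :: "nat \<Rightarrow> nat"
  assumes "1 \<le> d" and "d \<le> n - 1"
    and "w \<in> min_coset_reps n d"
    and "smooth_variety (schubert_variety n d w)"
    and "toric_variety (diag_torus n) (\<lambda>t x. t <#\<^bsub>SL n\<^esub> x) (schubert_variety n d w)"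
  shows "isomorphic_fspaces (schubert_variety n d w) (projective_space (perm_length n w))"
proof -
  have dn: "d < n" using assms(1,2) by simp
  interpret schubert n d w by unfold_locales (use dn assms(3) in auto)
  show ?thesis
  proof (cases "\<forall>k<d - 1. w k = k")
    case True
    interpret row_schubert n d w by unfold_locales (use assms(1) True in auto)
    show ?thesis by (rule isomorphic_perm_length)
  next
    case False
    then obtain k where k: "k < d - 1" "w k \<noteq> k" by blast
    then have d2: "2 \<le> d" by simp
    have "k < d" using k(1) by linarith
    then have "k < w k" using w_ge[of k] k(2) by simp
    moreover have "k \<le> d - 2" "d - 2 < d" using k by auto
    \<comment> \<open>A moved index pushes up all later values among the first \<open>d\<close>;
      together with the absence of a square this pins down \<open>w (d - 2)\<close>.\<close>
    ultimately have "d - 1 \<le> w (d - 2)" using w_gap[of k "d - 2"] by simp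
    then have w2: "w (d - 2) = d - 1" using toric_imp_hook[OF d2 assms(5)] by simp
    moreover have "d - 2 < d - 1" "d - 1 < d" using d2 by linarith+
    then have "w (d - 2) < w (d - 1)" by (rule w_mono)
    ultimately have "d \<le> w (d - 1)" by linarith
    then have w1: "w (d - 1) = d" using hook_imp_not_smooth[OF d2 w2] assms(4) by linarith
    \<comment> \<open>Only a single column is left, and its dual is a single row.\<close>
    interpret D: row_schubert n "n - d" "dual_perm n w"
      by unfold_locales (use dn assms(1,3) dual_min_coset_reps[of w n d] dual_row[OF assms(1) w1] in auto)
    show ?thesis
      using isomorphic_fspaces_trans[OF isomorphic_dual[OF schubert_axioms assms(1)] D.isomorphic_perm_length]
      unfolding perm_length_dual .
  qed
qed

end
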